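(* Let $\mathcal X$ be an RD-space and let $\rho$ be an admissible function on $\mathcal X$. Let $\{Q_t\}_{t>0}$ be a family of operators bounded on $L^2(\mathcal X)$ with integral kernels $\{Q_t(x,y)\}_{t>0}$ such that there exist constants $C_1\in(0,\infty)$, $\delta_1\in(0,\infty)$, $\beta\in(0,1]$, $\delta_2\in(0,1)$ and $\gamma\in(0,\infty)$ such that for all $t\in(0,\infty)$ and $x,x',y\in\mathcal X$ with $d(x,x')\le\frac t2$: (Q)$_{\rm i}$ $|Q_t(x,y)|\le C_1\frac1{V_t(x)+V(x,y)}\left(\frac t{t+d(x,y)}\right)^\gamma\left(\frac{\rho(x)}{t+\rho(x)}\right)^{\delta_1}$; (Q)$_{\rm ii}$ $|Q_t(x,y)-Q_t(x',y)|\le C_1\left(\frac{d(x,x')}{t+d(x,y)}\right)^\beta\frac1{V_t(x)+V(x,y)}\left(\frac t{t+d(x,y)}\right)^\gamma$; (Q)$_{\rm iii}$ $\left|\int_{\mathcal X}Q_t(x,y)\,d\mu(y)\right|\le C_1\left(\frac t{t+\rho(x)}\right)^{\delta_2}$. Let $g(f)(x)=\left(\int_0^\infty|Q_t(f)(x)|^2\frac{dt}t\right)^{1/2}$, and suppose that the operator $g$ is bounded on $L^2(\mathcal X)$. Then there exists a positive constant $C$ such that for all $f\in\mathrm{BMO}_\rho(\mathcal X)$, $[g(f)]^2\in\mathrm{BLO}_\rho(\mathcal X)$ and $$\|[g(f)]^2\|_{\mathrm{BLO}_\rho(\mathcal X)}\le C\|f\|^2_{\mathrm{BMO}_\rho(\mathcal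 X)}.$$
   Context: RD-space: $(\mathcal X,d)$ is a metric space with a regular Borel measure $\mu$ such that all balls $B(x,r)=\{y: d(x,y)<r\}$ have finite and positive measure; $\mu$ is doubling, i.e. there is $A_1\ge1$ with $\mu(B(x,2r))\le A_1\mu(B(x,r))$ for all $x\in\mathcal X$, $r>0$; and there are $0<\kappa\le n$, $A_2\in(0,1]$, $A_3\in[1,\infty)$ such that $A_2\lambda^\kappa\mu(B(x,r))\le\mu(B(x,\lambda r))\le A_3\lambda^n\mu(B(x,r))$ for all $x\in\mathcal X$, $0<r\le \mathrm{diam}(\mathcal X)/2$ and $1\le\lambda\le \mathrm{diam}(\mathcal X)/(2r)$. Balls are understood together with their center and radius. Write $V_r(x)=\mu(B(x,r))$ and $V(x,y)=\mu(B(x,d(x,y)))$. Admissible function: $\rho:\mathcal X\to(0,\infty)$ is admissible if there are positive constants $C_0,k_0$ such that $\frac1{\rho(x)}\le C_0\frac1{\rho(y)}\left(1+\frac{d(x,y)}{\rho(y)}\right)^{k_0}$ for all $x,y\in\mathcal X$. The operators act through their kernels, $Q_t(f)(x)=\int_{\mathcal X}Q_t(x,y)f(y)\,d\mu(y)$, and $Q_t(x,y)$ is understood to be jointly measurable in $(t,x,y)$ so that $g(f)$ makes sense. $L^1_{\rm loc}(\mathcal X)$ means integrable on every ball; $f_B=\frac1{\mu(B)}\int_B f\,d\mu$. With $\mathcal D$ the collection of balls $B(x,r)$ with $r\ge\rho(x)$, $\mathrm{BMO}_\rho(\mathcal X)$ and $\mathrm{BLO}_\rho(\mathcal X)$ (the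 latter consisting of real-valued functions) are the sets of $f\in L^1_{\rm loc}(\mathcal X)$ for which, respectively, the following are finite: $$\|f\|_{\mathrm{BMO}_\rho(\mathcal X)}=\sup_{B\notin\mathcal D}\frac1{\mu(B)}\int_B|f-f_B|\,d\mu+\sup_{B\in\mathcal D}\frac1{\mu(B)}\int_B|f|\,d\mu,$$ $$\|f\|_{\mathrm{BLO}_\rho(\mathcal X)}=\sup_{B\notin\mathcal D}\frac1{\mu(B)}\int_B\left[f-\operatorname*{ess\,inf}_B f\right]d\mu+\sup_{B\in\mathcal D}\frac1{\mu(B)}\int_B|f|\,d\mu.$$ *)

theory Defs
  imports "HOL-Analysis.Analysis"
begin

text \<open>The library's \<open>diameter\<close> is real-valued and returns 0 on unbounded sets.\<close>

definition ediam :: "'a::metric_space set \<Rightarrow> ereal" where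
  "ediam S = (SUP p\<in>S \<times> S. ereal (dist (fst p) (snd p)))"

text \<open>Inner approximation is by closed sets, since neither completeness nor local compactness of
  the space is assumed; this is implied by inner approximation by compact sets.\<close>

definition regular_borel_measure :: "'a::metric_space measure \<Rightarrow> bool" where
  "regular_borel_measure M \<longleftrightarrow> sets M = sets borel \<and>
     (\<forall>A\<in>sets M. emeasure M A = (INF U\<in>{U. open U \<and> A \<subseteq> U}. emeasure M U) \<and>
                 emeasure M A = (SUP F\<in>{F. closed F \<and> F \<subseteq> A}. emeasure M F))"

definition doubling_measure :: "'a::metric_space measure \<Rightarrow> bool" where
  "doubling_measure M \<longleftrightarrow> (\<exists>A\<^sub>1\<ge>1. \<forall>x. \<forall>r>0.
     measure M (ball x (2 * r)) \<le> A\<^sub>1 * measure M (ball x r))"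

definition rd_space :: "'a::metric_space measure \<Rightarrow> bool" where
  "rd_space M \<longleftrightarrow>
     regular_borel_measure M \<and>
     (\<forall>x. \<forall>r>0. 0 < emeasure M (ball x r) \<and> emeasure M (ball x r) < \<infinity>) \<and>
     doubling_measure M \<and>
     (\<exists>\<kappa> n A\<^sub>2 A\<^sub>3 :: real. 0 < \<kappa> \<and> \<kappa> \<le> n \<and> 0 < A\<^sub>2 \<and> A\<^sub>2 \<le> 1 \<and> 1 \<le> A\<^sub>3 \<and>
       (\<forall>x. \<forall>r l. 0 < r \<longrightarrow> ereal r \<le> ediam (UNIV :: 'a set) / 2 \<longrightarrow>
          1 \<le> l \<longrightarrow> ereal l \<le> ediam (UNIV :: 'a set) / ereal (2 * r) \<longrightarrow>
          A\<^sub>2 * l powr \<kappa> * measure M (ball x r) \<le> measure M (ball x (l * r)) \<and>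
          measure M (ball x (l * r)) \<le> A\<^sub>3 * l powr n * measure M (ball x r)))"

definition vol :: "'a::metric_space measure \<Rightarrow> real \<Rightarrow> 'a \<Rightarrow> real" where
  "vol M r x = measure M (ball x r)"

definition vol2 :: "'a::metric_space measure \<Rightarrow> 'a \<Rightarrow> 'a \<Rightarrow> real" where
  "vol2 M x y = measure M (ball x (dist x y))"

definition admissible :: "('a::metric_space \<Rightarrow> real) \<Rightarrow> bool" where
  "admissible \<rho> \<longleftrightarrow> (\<forall>x. 0 < \<rho> x) \<and>
     (\<exists>C\<^sub>0>0. \<exists>k\<^sub>0>0. \<forall>x y.
        1 / \<rho> x \<le> C\<^sub>0 * (1 / \<rho> y) * (1 + dist x y / \<rho> y) powr k\<^sub>0)"

text \<open>A ball is represented by the pair of its center and its radius.\<close>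

definition balls_D :: "('a::metric_space \<Rightarrow> real) \<Rightarrow> ('a \<times> real) set" where
  "balls_D \<rho> = {(x, r). 0 < r \<and> \<rho> x \<le> r}"

definition balls_not_D :: "('a::metric_space \<Rightarrow> real) \<Rightarrow> ('a \<times> real) set" where
  "balls_not_D \<rho> = {(x, r). 0 < r \<and> r < \<rho> x}"

definition L1_loc :: "'a::metric_space measure \<Rightarrow> ('a \<Rightarrow> 'b::{banach, second_countable_topology}) set"
  where "L1_loc M = {f. \<forall>x. \<forall>r>0. set_integrable M (ball x r) f}"

definition ball_avg :: "'a measure \<Rightarrow> 'a set \<Rightarrow> ('a \<Rightarrow> 'b::{banach, second_countable_topology}) \<Rightarrow> 'b"
  where "ball_avg M B f = (LINT y:B|M. f y) /\<^sub>R measure M B"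

definition ess_inf :: "'a measure \<Rightarrow> 'a set \<Rightarrow> ('a \<Rightarrow> real) \<Rightarrow> ereal" where
  "ess_inf M B f = Sup {c. AE y\<in>B in M. c \<le> ereal (f y)}"

definition BMO_norm :: "'a::metric_space measure \<Rightarrow> ('a \<Rightarrow> real) \<Rightarrow> ('a \<Rightarrow> complex) \<Rightarrow> ennreal"
  where "BMO_norm M \<rho> f =
    (SUP (x, r)\<in>balls_not_D \<rho>.
       (\<integral>\<^sup>+y\<in>ball x r. ennreal (norm (f y - ball_avg M (ball x r) f)) \<partial>M) / emeasure M (ball x r)) +
    (SUP (x, r)\<in>balls_D \<rho>.
       (\<integral>\<^sup>+y\<in>ball x r. ennreal (norm (f y)) \<partial>M) / emeasure M (ball x r))"

definition BMO :: "'a::metric_space measure \<Rightarrow> ('a \<Rightarrow> real) \<Rightarrow> ('a \<Rightarrow> complex) set" where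
  "BMO M \<rho> = {f \<in> L1_loc M. BMO_norm M \<rho> f < \<infinity>}"

text \<open>\<open>f - ess_inf M B f\<close> is nonnegative almost everywhere on \<open>B\<close>, so \<open>e2ennreal\<close>, which
  truncates negative values, changes nothing; if the essential infimum is \<open>-\<infinity>\<close> then
  the integrand, and hence the norm, is infinite.\<close>

definition BLO_norm :: "'a::metric_space measure \<Rightarrow> ('a \<Rightarrow> real) \<Rightarrow> ('a \<Rightarrow> real) \<Rightarrow> ennreal"
  where "BLO_norm M \<rho> f =
    (SUP (x, r)\<in>balls_not_D \<rho>.
       (\<integral>\<^sup>+y\<in>ball x r. e2ennreal (ereal (f y) - ess_inf M (ball x r) f) \<partial>M)
         / emeasure M (ball x r)) +
    (SUP (x, r)\<in>balls_D \<rho>.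
       (\<integral>\<^sup>+y\<in>ball x r. ennreal \<bar>f y\<bar> \<partial>M) / emeasure M (ball x r))"

definition BLO :: "'a::metric_space measure \<Rightarrow> ('a \<Rightarrow> real) \<Rightarrow> ('a \<Rightarrow> real) set" where
  "BLO M \<rho> = {f \<in> L1_loc M. BLO_norm M \<rho> f < \<infinity>}"

definition ennsqrt :: "ennreal \<Rightarrow> ennreal" where
  "ennsqrt a = (if a = \<infinity> then \<infinity> else ennreal (sqrt (enn2real a)))"

definition L2_norm :: "'a measure \<Rightarrow> ('a \<Rightarrow> ennreal) \<Rightarrow> ennreal" where
  "L2_norm M h = ennsqrt (\<integral>\<^sup>+x. (h x)\<^sup>2 \<partial>M)"

definition L2_space :: "'a measure \<Rightarrow> ('a \<Rightarrow> complex) set" where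
  "L2_space M = {f \<in> borel_measurable M. L2_norm M (\<lambda>x. ennreal (norm (f x))) < \<infinity>}"

definition L2_bounded :: "'a measure \<Rightarrow> (('a \<Rightarrow> complex) \<Rightarrow> 'a \<Rightarrow> complex) \<Rightarrow> bool" where
  "L2_bounded M T \<longleftrightarrow> (\<exists>K::real. 0 \<le> K \<and> (\<forall>f\<in>L2_space M. T f \<in> L2_space M \<and>
     L2_norm M (\<lambda>x. ennreal (norm (T f x))) \<le> ennreal K * L2_norm M (\<lambda>x. ennreal (norm (f x)))))"

text \<open>The variant for operators, such as square functions, with values in \<open>[0, \<infinity>]\<close>.\<close>

definition L2_bounded_nonneg :: "'a measure \<Rightarrow> (('a \<Rightarrow> complex) \<Rightarrow> 'a \<Rightarrow> ennreal) \<Rightarrow> bool" where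
  "L2_bounded_nonneg M T \<longleftrightarrow> (\<exists>K::real. 0 \<le> K \<and> (\<forall>f\<in>L2_space M. T f \<in> borel_measurable M \<and>
     L2_norm M (T f) \<le> ennreal K * L2_norm M (\<lambda>x. ennreal (norm (f x)))))"

definition kernel_op :: "'a measure \<Rightarrow> ('a \<Rightarrow> 'a \<Rightarrow> complex) \<Rightarrow> ('a \<Rightarrow> complex) \<Rightarrow> 'a \<Rightarrow> complex"
  where "kernel_op M q f x = (LINT y|M. q x y * f y)"

text \<open>Kernels are indexed by all reals, but only \<open>Q t\<close> for \<open>t > 0\<close> is ever used.\<close>

definition jointly_measurable_kernel :: "'a measure \<Rightarrow> (real \<Rightarrow> 'a \<Rightarrow> 'a \<Rightarrow> complex) \<Rightarrow> bool" where
  "jointly_measurable_kernel M Q \<longleftrightarrow>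
     (\<lambda>(t, x, y). Q t x y) \<in> borel_measurable (restrict_space borel {0<..} \<Otimes>\<^sub>M (M \<Otimes>\<^sub>M M))"

definition g_function ::
    "'a measure \<Rightarrow> (real \<Rightarrow> 'a \<Rightarrow> 'a \<Rightarrow> complex) \<Rightarrow> ('a \<Rightarrow> complex) \<Rightarrow> 'a \<Rightarrow> ennreal" where
  "g_function M Q f x =
     ennsqrt (\<integral>\<^sup>+t\<in>{0<..}. ennreal ((norm (kernel_op M (Q t) f x))\<^sup>2 / t) \<partial>lborel)"

end

theory Submission
  imports Defs
begin

text \<open>
Let \<open>N > 0\<close> be an upper bound of the BMO norm of \<open>f\<close> and, for a ball \<open>B\<close> of center \<open>z\<close> and radius \<open>r\<close>, cut the square function
at the scale of the ball: \<open>g(f)\<^sup>2 = G_near + G_far\<close>, where \<open>G_near\<close> collects the scales \<open>t \<le> 4r\<close>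
(\<open>sq_part {0<..4 * r}\<close>) and \<open>G_far\<close> the scales \<open>t > 4r\<close>. The proof rests on three estimates.

\<^item> On every ball, \<open>G_near\<close> has mean at most \<open>C N\<^sup>2\<close> (\<open>near_estimate\<close>). Subtract a constant \<open>c\<close> from \<open>f\<close>
  (\<open>c = 0\<close> if \<open>r \<ge> \<rho>(z)\<close>, the mean of \<open>f\<close> over \<open>B\<close> otherwise). The part of \<open>f - c\<close> inside the doubled
  ball is handled by the \<open>L\<^sup>2\<close> bound of \<open>g\<close>; it has the right \<open>L\<^sup>2\<close> norm by the John--Nirenberg inequality
  (\<open>john_nirenberg\<close>, \<open>osc_le_imp_L2\<close>). The part outside is handled pointwise: the decay of the kernel
  yields a power of \<open>t/r\<close>, which is square integrable for \<open>dt/t\<close> near \<open>0\<close>. The constant is handled by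
  the cancellation \<open>Q_t 1 = O((t/\<rho>)\<^sup>\<delta>\<^sup>2)\<close>, which absorbs the logarithmic growth of the means of \<open>f\<close>.
\<^item> If \<open>R \<ge> \<rho>(z)\<close>, the size condition makes \<open>Q_t f\<close> decay like \<open>(R/t)\<^sup>\<delta>\<^sup>1 N\<close> for \<open>t \<ge> R\<close>
  (\<open>tail_pointwise\<close>). So on balls of radius \<open>r \<ge> \<rho>(z)\<close> also \<open>G_far \<le> C N\<^sup>2\<close>, and the mean of \<open>g(f)\<^sup>2\<close>
  is bounded (\<open>large_ball_estimate\<close>).
\<^item> If \<open>r < \<rho>(z)\<close>, then \<open>G_far\<close> need not be small but it is almost constant on the ball: any two of its
  values differ by at most \<open>C N\<^sup>2\<close> (\<open>small_ball_far_comparison\<close>). For \<open>t < \<rho>(z)\<close> this comes from the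
  smoothness condition (\<open>middle_pointwise\<close>), for larger \<open>t\<close> from the decay just mentioned.

On a ball of the last kind, \<open>g(f)\<^sup>2 \<ge> G_far\<close> everywhere, so the essential infimum of \<open>g(f)\<^sup>2\<close> is at least
\<open>G_far(x) - C N\<^sup>2\<close> for each \<open>x\<close> in the ball, and \<open>g(f)\<^sup>2 - ess inf g(f)\<^sup>2 \<le> G_near + C N\<^sup>2\<close> almost
everywhere. The means of the right-hand side are bounded by the first estimate. This one-sided use of
the infimum is what gives BLO rather than BMO: nothing is ever subtracted from \<open>G_near\<close>.

The geometry enters through the doubling property, combined with the covering lemma \<open>vitali_five_r\<close>.
The bound \<open>N\<close> has to be strictly positive because it sets the height of the stopping time in the
John--Nirenberg argument; at the end \<open>N\<close> decreases to the norm, which may be \<open>0\<close>.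
\<close>

section \<open>The Vitali covering lemma\<close>

text \<open>
  Zorn's lemma is applied to the disjoint subfamilies with this property: a ball of the family that meets
  the subfamily meets a member of at least half its radius. If some ball met no member of a maximal
  subfamily, one could add a ball of nearly largest radius among the balls of this kind.
\<close>

lemma vitali_five_r:
  fixes Y :: "'a::metric_space set" and s :: "'a \<Rightarrow> real"
  assumes pos: "\<And>y. y \<in> Y \<Longrightarrow> 0 < s y" and bd: "\<And>y. y \<in> Y \<Longrightarrow> s y \<le> R"
  obtains J where "J \<subseteq> Y" "disjoint_family_on (\<lambda>y. ball y (s y)) J"
    "\<And>y. y \<in> Y \<Longrightarrow> \<exists>z\<in>J. ball y (s y) \<subseteq> ball z (5 * s z)"
proof -
  define b where "b y = ball y (s y)" for y
  define \<F> where "\<F> = {J. J \<subseteq> Y \<and> disjoint_family_on b J \<and>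
    (\<forall>y\<in>Y. (\<exists>z\<in>J. b y \<inter> b z \<noteq> {}) \<longrightarrow> (\<exists>z\<in>J. b y \<inter> b z \<noteq> {} \<and> s y \<le> 2 * s z))}"
  have "\<exists>J\<in>\<F>. \<forall>X\<in>\<F>. J \<subseteq> X \<longrightarrow> X = J"
  proof (rule subset_Zorn')
    fix C assume C: "subset.chain \<F> C"
    then have CF: "\<And>X. X \<in> C \<Longrightarrow> X \<in> \<F>" and
      lin: "\<And>X X'. X \<in> C \<Longrightarrow> X' \<in> C \<Longrightarrow> X \<subseteq> X' \<or> X' \<subseteq> X"
      by (auto simp: subset_chain_def)
    have "disjoint_family_on b (\<Union>C)"
      unfolding disjoint_family_on_def
    proof (intro ballI impI)
      fix x y assume "x \<in> \<Union>C" "y \<in> \<Union>C" "x \<noteq> y"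
      then obtain X X' where X: "x \<in> X" "X \<in> C" "y \<in> X'" "X' \<in> C" by blast
      with lin[of X X'] obtain Z where "Z \<in> C" "x \<in> Z" "y \<in> Z" by blast
      with CF[of Z] \<open>x \<noteq> y\<close> show "b x \<inter> b y = {}"
        by (auto simp: \<F>_def disjoint_family_on_def)
    qed
    moreover have "\<exists>z\<in>\<Union>C. b y \<inter> b z \<noteq> {} \<and> s y \<le> 2 * s z"
      if "y \<in> Y" "\<exists>z\<in>\<Union>C. b y \<inter> b z \<noteq> {}" for y
    proof -
      from that obtain z X where "X \<in> C" "z \<in> X" "b y \<inter> b z \<noteq> {}" by blast
      then have "\<exists>z\<in>X. b y \<inter> b z \<noteq> {} \<and> s y \<le> 2 * s z"
        using CF[of X] \<open>y \<in> Y\<close> unfolding \<F>_def by blast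
      then show ?thesis using \<open>X \<in> C\<close> by blast
    qed
    moreover have "\<Union>C \<subseteq> Y" using CF unfolding \<F>_def by blast
    ultimately show "\<Union>C \<in> \<F>" unfolding \<F>_def by blast
  qed
  then obtain J where J: "J \<in> \<F>" and mx: "\<And>X. X \<in> \<F> \<Longrightarrow> J \<subseteq> X \<Longrightarrow> X = J" by blast
  have meet: "\<exists>z\<in>J. b y \<inter> b z \<noteq> {}" if "y \<in> Y" for y
  proof (rule ccontr)
    assume neg: "\<not> ?thesis"
    define W where "W = {y \<in> Y. \<forall>z\<in>J. b y \<inter> b z = {}}"
    have "y \<in> W" using neg that by (auto simp: W_def)
    have bdd: "bdd_above (s ` W)" using bd by (auto simp: W_def bdd_above_def)
    define \<sigma> where "\<sigma> = Sup (s ` W)"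
    have le: "s w \<le> \<sigma>" if "w \<in> W" for w
      unfolding \<sigma>_def using bdd that by (intro cSup_upper) auto
    have "0 < \<sigma>" using le[OF \<open>y \<in> W\<close>] pos[OF that] by simp
    then have "\<sigma> / 2 < Sup (s ` W)" by (simp add: \<sigma>_def)
    then obtain v where "v \<in> s ` W" "\<sigma> / 2 < v"
      by (rule less_cSupE) (use \<open>y \<in> W\<close> in auto)
    then obtain w where w: "w \<in> W" "\<sigma> / 2 < s w" by auto
    have wY: "w \<in> Y" and wJ: "\<And>z. z \<in> J \<Longrightarrow> b w \<inter> b z = {}" using w by (auto simp: W_def)
    have "w \<notin> J"
    proof
      assume "w \<in> J"
      then have "b w = {}" using wJ by blast
      moreover have "w \<in> b w" using pos[OF wY] by (simp add: b_def)
      ultimately show False by blast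
    qed
    have "insert w J \<in> \<F>"
    proof -
      have "insert w J \<subseteq> Y" using wY J by (auto simp: \<F>_def)
      moreover have "disjoint_family_on b (insert w J)"
        using J wJ \<open>w \<notin> J\<close> unfolding \<F>_def disjoint_family_on_def by blast
      moreover have "\<exists>z\<in>insert w J. b v \<inter> b z \<noteq> {} \<and> s v \<le> 2 * s z"
        if v: "v \<in> Y" "\<exists>z\<in>insert w J. b v \<inter> b z \<noteq> {}" for v
      proof (cases "\<exists>z\<in>J. b v \<inter> b z \<noteq> {}")
        case True
        then show ?thesis using J v(1) unfolding \<F>_def by blast
      next
        case False
        then have "v \<in> W" using v by (auto simp: W_def)
        then have "s v \<le> 2 * s w" using le[of v] w by linarith
        then show ?thesis using v False by blast
      qed
      ultimately show ?thesis by (auto simp: \<F>_def)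
    qed
    then show False using mx[of "insert w J"] \<open>w \<notin> J\<close> by blast
  qed
  show thesis
  proof
    show "J \<subseteq> Y" "disjoint_family_on (\<lambda>y. ball y (s y)) J"
      using J by (auto simp: \<F>_def b_def[abs_def])
    fix y assume y: "y \<in> Y"
    then obtain z where z: "z \<in> J" "b y \<inter> b z \<noteq> {}" "s y \<le> 2 * s z"
      using meet[OF y] J unfolding \<F>_def by blast
    then obtain p where p: "dist y p < s y" "dist z p < s z" by (auto simp: b_def)
    have "ball y (s y) \<subseteq> ball z (5 * s z)"
    proof
      fix q assume "q \<in> ball y (s y)"
      then have "dist z q \<le> dist z p + dist p y + dist y q" "dist y q < s y"
        by (metric, simp)
      then show "q \<in> ball z (5 * s z)" using p z(3) by (simp add: dist_commute)
    qed
    then show "\<exists>z\<in>J. ball y (s y) \<subseteq> ball z (5 * s z)" using z(1) by blast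
  qed
qed

section \<open>Sums, powers and integrals over scales\<close>

lemma nn_integral_UN_le:
  assumes "countable I" "\<And>i. i \<in> I \<Longrightarrow> X i \<in> sets M" "h \<in> borel_measurable M"
  shows "(\<integral>\<^sup>+y\<in>(\<Union>i\<in>I. X i). h y \<partial>M) \<le> (\<integral>\<^sup>+i. (\<integral>\<^sup>+y\<in>X i. h y \<partial>M) \<partial>count_space I)"
proof -
  note [measurable] = assms(2,3)
  have "(\<integral>\<^sup>+y\<in>(\<Union>i\<in>I. X i). h y \<partial>M) \<le> (\<integral>\<^sup>+y. (\<integral>\<^sup>+i. h y * indicator (X i) y \<partial>count_space I) \<partial>M)"
  proof (rule nn_integral_mono)
    fix y
    show "h y * indicator (\<Union>i\<in>I. X i) y \<le> (\<integral>\<^sup>+i. h y * indicator (X i) y \<partial>count_space I)"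
    proof (cases "\<exists>i\<in>I. y \<in> X i")
      case True
      then obtain i where i: "i \<in> I" "y \<in> X i" by blast
      have "h y * indicator (X i) y \<le> (\<integral>\<^sup>+i. h y * indicator (X i) y \<partial>count_space I)"
        by (rule nn_integral_ge_point[OF i(1)])
      moreover have "y \<in> (\<Union>i\<in>I. X i)" using i by blast
      ultimately show ?thesis using i by simp
    qed auto
  qed
  also have "\<dots> = (\<integral>\<^sup>+i. (\<integral>\<^sup>+y\<in>X i. h y \<partial>M) \<partial>count_space I)"
    using assms by (intro nn_integral_count_space_nn_integral) auto
  finally show ?thesis .
qed

lemma nn_integral_disjoint_UN_le:
  assumes "countable I" "\<And>i. i \<in> I \<Longrightarrow> X i \<in> sets M" "disjoint_family_on X I"
    and "h \<in> borel_measurable M" and "(\<Union>i\<in>I. X i) \<subseteq> W" "W \<in> sets M"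
  shows "(\<integral>\<^sup>+i. (\<integral>\<^sup>+y\<in>X i. h y \<partial>M) \<partial>count_space I) \<le> (\<integral>\<^sup>+y\<in>W. h y \<partial>M)"
proof -
  note [measurable] = assms(2,4,6)
  have "(\<integral>\<^sup>+i. (\<integral>\<^sup>+y\<in>X i. h y \<partial>M) \<partial>count_space I) = (\<integral>\<^sup>+i. emeasure (density M h) (X i) \<partial>count_space I)"
    by (intro nn_integral_cong) (simp add: emeasure_density)
  also have "\<dots> = emeasure (density M h) (\<Union>i\<in>I. X i)"
    using assms by (intro emeasure_UN_countable[symmetric]) auto
  also have "\<dots> \<le> emeasure (density M h) W"
    using assms by (intro emeasure_mono) auto
  also have "\<dots> = (\<integral>\<^sup>+y\<in>W. h y \<partial>M)"
    by (simp add: emeasure_density)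
  finally show ?thesis .
qed

lemma term_le_suminf: "f j \<le> (\<Sum>j. f j)" for f :: "nat \<Rightarrow> ennreal"
  using sum_le_suminf[of f "{j}"] by simp

text \<open>
  A discrete layer-cake formula. If \<open>kK < u \<le> (k+1)K\<close> then \<open>u \<le> 2\<^sup>k K\<close>, so the layer of index \<open>k\<close> alone
  dominates \<open>u\<^sup>2\<close>; the weights \<open>4\<^sup>k\<close> are later beaten by the factors \<open>8\<^sup>-\<^sup>k\<close> of the John--Nirenberg inequality.
\<close>

lemma power2_le_layers:
  assumes K: "0 < (K::real)" and u: "0 \<le> u"
  shows "ennreal (u\<^sup>2) \<le> (\<Sum>k. ennreal (K\<^sup>2 * (4 ^ k)) * (if real k * K < u then 1 else 0))"
proof (cases "u = 0")
  case False
  then have u: "0 < u" using u by simp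
  define k where "k = nat (\<lceil>u / K\<rceil> - 1)"
  have pos: "0 < u / K" using u K by simp
  have "real k = real_of_int (\<lceil>u / K\<rceil> - 1)" unfolding k_def using pos by (subst of_nat_nat) (auto simp: less_ceiling_iff)
  then have k: "real k < u / K" "u / K \<le> real k + 1" by linarith+
  have kk: "real k * K < u" "u \<le> (real k + 1) * K" using k K by (auto simp: field_simps)
  have "real k + 1 \<le> 2 ^ k"
    using of_nat_mono[of "Suc k" "2 ^ k", where ?'a = real] Suc_leI[OF less_exp[of k]] by simp
  then have "u \<le> 2 ^ k * K" using kk(2) K by (meson mult_right_mono order_trans less_imp_le)
  then have "u\<^sup>2 \<le> (2 ^ k * K)\<^sup>2" using u by (intro power_mono) auto
  also have "\<dots> = K\<^sup>2 * 4 ^ k" by (simp add: power_mult_distrib power2_eq_square power_mult_distrib[symmetric])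
  finally have "ennreal (u\<^sup>2) \<le> ennreal (K\<^sup>2 * (4 ^ k)) * (if real k * K < u then 1 else 0)"
    using kk(1) by (simp add: ennreal_leI)
  also have "\<dots> \<le> (\<Sum>k. ennreal (K\<^sup>2 * (4 ^ k)) * (if real k * K < u then 1 else 0))"
    by (rule term_le_suminf)
  finally show ?thesis .
qed simp

lemma nn_integral_powr_ratio_up_to:
  assumes "0 < a" "0 < R"
  shows "(\<integral>\<^sup>+t\<in>{0<..R}. ennreal ((t / R) powr a / t) \<partial>lborel) = ennreal (1 / a)"
proof -
  have "((\<lambda>t. t powr (a - 1) / R powr a) has_integral (R powr (a - 1 + 1) / (a - 1 + 1)) / R powr a) {0..R}"
    using assms by (intro has_integral_divide has_integral_powr_from_0) auto
  then have "((\<lambda>t. t powr (a - 1) / R powr a) has_integral (1 / a)) {0..R}"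
    using assms by simp
  then have "(\<integral>\<^sup>+t. ennreal (indicator {0..R} t * (t powr (a - 1) / R powr a)) \<partial>lborel) = ennreal (1 / a)"
    by (intro nn_integral_has_integral_lebesgue) auto
  moreover have "ennreal ((t / R) powr a / t) * indicator {0<..R} t
      = ennreal (indicator {0..R} t * (t powr (a - 1) / R powr a))" for t
    using assms by (cases "t = 0") (auto simp: indicator_def powr_divide powr_diff)
  ultimately show ?thesis by simp
qed

lemma nn_integral_powr_ratio_up_to_4r_cmult:
  assumes "0 < a" "0 < r" "0 \<le> B"
  shows "(\<integral>\<^sup>+t\<in>{0<..4 * r}. ennreal (B * (t / r) powr a / t) \<partial>lborel) = ennreal (B * (4 powr a / a))"
proof -
  have "(\<integral>\<^sup>+t\<in>{0<..4 * r}. ennreal (B * (t / r) powr a / t) \<partial>lborel)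
    = (\<integral>\<^sup>+t. ennreal (B * 4 powr a) * (ennreal ((t / (4 * r)) powr a / t) * indicator {0<..4 * r} t) \<partial>lborel)"
  proof (rule nn_integral_cong)
    fix t
    show "ennreal (B * (t / r) powr a / t) * indicator {0<..4 * r} t
      = ennreal (B * 4 powr a) * (ennreal ((t / (4 * r)) powr a / t) * indicator {0<..4 * r} t)"
    proof (cases "t \<in> {0<..4 * r}")
      case True
      then have "(t / r) powr a = 4 powr a * (t / (4 * r)) powr a"
        using assms by (subst powr_mult[symmetric]) auto
      then show ?thesis using assms True by (simp add: ennreal_mult'[symmetric] mult_ac)
    qed simp
  qed
  also have "\<dots> = ennreal (B * 4 powr a) * ennreal (1 / a)"
    using assms by (subst nn_integral_cmult) (auto simp: nn_integral_powr_ratio_up_to)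
  also have "\<dots> = ennreal (B * (4 powr a / a))"
    using assms by (subst ennreal_mult[symmetric]) auto
  finally show ?thesis .
qed

lemma nn_integral_powr_ratio_from:
  assumes "0 < a" "0 < R"
  shows "(\<integral>\<^sup>+t\<in>{R..}. ennreal ((R / t) powr a / t) \<partial>lborel) = ennreal (1 / a)"
proof -
  have "((\<lambda>t. R powr a * t powr (- a - 1)) has_integral R powr a * (- (R powr (- a - 1 + 1)) / (- a - 1 + 1))) {R..}"
    using assms by (intro has_integral_mult_right has_integral_powr_to_inf) auto
  then have "((\<lambda>t. R powr a * t powr (- a - 1)) has_integral (1 / a)) {R..}"
    using assms by (simp add: powr_minus)
  then have "(\<integral>\<^sup>+t. ennreal (indicator {R..} t * (R powr a * t powr (- a - 1))) \<partial>lborel) = ennreal (1 / a)"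
    by (intro nn_integral_has_integral_lebesgue) auto
  moreover have "ennreal ((R / t) powr a / t) * indicator {R..} t
      = ennreal (indicator {R..} t * (R powr a * t powr (- a - 1)))" for t
    using assms by (auto simp: indicator_def powr_divide powr_diff powr_minus field_simps)
  ultimately show ?thesis by simp
qed

lemma nn_integral_powr_ratio_from_cmult:
  assumes "0 < a" "0 < R" "0 \<le> B"
  shows "(\<integral>\<^sup>+t\<in>{R..}. ennreal (B * (R / t) powr a / t) \<partial>lborel) = ennreal (B / a)"
proof -
  have "(\<integral>\<^sup>+t\<in>{R..}. ennreal (B * (R / t) powr a / t) \<partial>lborel)
    = (\<integral>\<^sup>+t. ennreal B * (ennreal ((R / t) powr a / t) * indicator {R..} t) \<partial>lborel)"
    using assms by (intro nn_integral_cong) (auto simp: indicator_def ennreal_mult'[symmetric])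
  also have "\<dots> = ennreal B * ennreal (1 / a)"
    using assms by (subst nn_integral_cmult) (auto simp: nn_integral_powr_ratio_from)
  also have "\<dots> = ennreal (B / a)"
    using assms by (subst ennreal_mult[symmetric]) auto
  finally show ?thesis .
qed

lemma powr_power2: "(x powr a)\<^sup>2 = x powr (2 * a)" for x a :: real
  by (simp add: power2_eq_square powr_add[symmetric])

text \<open>
  The means of a BMO function grow logarithmically with the ratio of the radii; this trades the logarithm
  for an arbitrarily small power, which the cancellation of the kernel absorbs.
\<close>

lemma one_plus_log_le_powr:
  assumes "0 < d" "1 \<le> (u::real)"
  shows "1 + log 2 u \<le> (1 + 1 / (d * ln 2)) * u powr d"
proof -
  have "log 2 u \<le> u powr d / d / ln 2"
    unfolding log_def using ln_powr_bound[OF assms(2,1)] by (intro divide_right_mono) auto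
  moreover have "1 \<le> u powr d" using assms by (intro ge_one_powr_ge_zero) auto
  ultimately show ?thesis by (simp add: algebra_simps)
qed

lemma norm_add2_power2: "(norm (a + b))\<^sup>2 \<le> 2 * ((norm a)\<^sup>2 + (norm b)\<^sup>2)"
  for a b :: "'b::real_normed_vector"
proof -
  have "(norm (a + b))\<^sup>2 \<le> (norm a + norm b)\<^sup>2" by (intro power_mono norm_triangle_ineq) auto
  moreover have "0 \<le> (norm a - norm b)\<^sup>2" by simp
  ultimately show ?thesis by (simp add: power2_eq_square algebra_simps)
qed

lemma norm_add3_power2: "(norm (a + b + c))\<^sup>2 \<le> 3 * ((norm a)\<^sup>2 + (norm b)\<^sup>2 + (norm c)\<^sup>2)"
  for a b c :: "'b::real_normed_vector"
proof -
  have "norm (a + b + c) \<le> norm a + norm b + norm c"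
    by (meson add_right_mono norm_triangle_ineq order_trans)
  then have "(norm (a + b + c))\<^sup>2 \<le> (norm a + norm b + norm c)\<^sup>2" by (intro power_mono) auto
  moreover have "0 \<le> (norm a - norm b)\<^sup>2 + (norm b - norm c)\<^sup>2 + (norm a - norm c)\<^sup>2" by simp
  ultimately show ?thesis by (simp add: power2_eq_square algebra_simps)
qed

lemma ennsqrt_power2: "(ennsqrt a)\<^sup>2 = a"
proof (cases "a = \<infinity>")
  case False
  then obtain b where b: "a = ennreal b" "0 \<le> b" by (cases a) auto
  then show ?thesis by (simp add: ennsqrt_def ennreal_power)
qed (simp add: ennsqrt_def power2_eq_square ennreal_top_mult)

lemma L2_norm_power2: "(L2_norm M h)\<^sup>2 = (\<integral>\<^sup>+x. (h x)\<^sup>2 \<partial>M)"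
  by (simp add: L2_norm_def ennsqrt_power2)

section \<open>Doubling spaces\<close>

text \<open>
  \<open>A\<close> is the doubling constant. Outer regularity stands in for the Lebesgue differentiation theorem, in \<open>small_averages_bound\<close>.
\<close>

locale doubling_space =
  fixes M :: "'a::metric_space measure" and A :: real
  assumes sets_M: "sets M = sets borel"
    and outer_regular: "\<And>E. E \<in> sets M \<Longrightarrow>
          emeasure M E = (INF U\<in>{U. open U \<and> E \<subseteq> U}. emeasure M U)"
    and ball_pos: "\<And>x r. 0 < r \<Longrightarrow> 0 < emeasure M (ball x r)"
    and ball_finite: "\<And>x r. emeasure M (ball x r) < \<infinity>"
    and A_ge_1: "1 \<le> A"
    and doubling: "\<And>x r. 0 < r \<Longrightarrow> measure M (ball x (2 * r)) \<le> A * measure M (ball x r)"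

begin

abbreviation V :: "'a \<Rightarrow> real \<Rightarrow> real" where "V x r \<equiv> measure M (ball x r)"

lemma sets_ball [measurable, simp]: "ball x r \<in> sets M"
  by (simp add: sets_M)

lemma sets_open: "open U \<Longrightarrow> U \<in> sets M"
  by (simp add: sets_M)

lemma space_M [simp]: "space M = UNIV"
  using sets_eq_imp_space_eq[OF sets_M] by simp

lemma emeasure_ball: "emeasure M (ball x r) = ennreal (V x r)"
  using ball_finite[of x r] by (intro emeasure_eq_ennreal_measure) auto

lemma V_pos: "0 < r \<Longrightarrow> 0 < V x r"
  using ball_pos[of r x] by (simp add: emeasure_ball)

lemma V_mono: "ball x r \<subseteq> ball y s \<Longrightarrow> V x r \<le> V y s"
  using ball_finite[of y s] by (intro measure_mono_fmeasurable) (auto simp: fmeasurable_def)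

lemma V_mono_radius: "r \<le> s \<Longrightarrow> V x r \<le> V x s"
  by (intro V_mono) auto

lemma V_doubling_pow: "0 < r \<Longrightarrow> V x (2 ^ k * r) \<le> A ^ k * V x r"
proof (induction k)
  case (Suc k)
  have "V x (2 * (2 ^ k * r)) \<le> A * V x (2 ^ k * r)" using Suc.prems by (intro doubling) simp
  also have "\<dots> \<le> A * (A ^ k * V x r)" using Suc A_ge_1 by (intro mult_left_mono) auto
  finally show ?case by (simp add: mult_ac)
qed simp

lemma V_le_of_subset:
  assumes "0 < r" "ball y s \<subseteq> ball x u" "u \<le> 2 ^ k * r"
  shows "V y s \<le> A ^ k * V x r"
proof -
  have "V y s \<le> V x (2 ^ k * r)" using assms by (intro V_mono) (auto intro: order_trans)
  then show ?thesis using V_doubling_pow[OF assms(1), of x k] by linarith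
qed

lemma V_le_of_dist:
  assumes "0 < r" "dist x y + s \<le> 2 ^ k * r"
  shows "V y s \<le> A ^ k * V x r"
proof (rule V_le_of_subset[OF assms(1) _ assms(2)])
  show "ball y s \<subseteq> ball x (dist x y + s)"
    by (auto simp: mem_ball) metric
qed

lemma average_le_iff:
  assumes "0 < r" "0 \<le> c"
  shows "I / emeasure M (ball x r) \<le> ennreal c \<longleftrightarrow> I \<le> ennreal (c * V x r)"
proof -
  have V: "0 < V x r" by (rule V_pos[OF assms(1)])
  have e: "emeasure M (ball x r) = ennreal (V x r)" by (rule emeasure_ball)
  show ?thesis
  proof
    assume "I / emeasure M (ball x r) \<le> ennreal c"
    then have "I / emeasure M (ball x r) * ennreal (V x r) \<le> ennreal c * ennreal (V x r)"
      by (intro mult_right_mono) auto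
    moreover have "I / ennreal (V x r) * ennreal (V x r) = I"
      using V by (simp add: ennreal_divide_times mult_divide_eq_ennreal)
    ultimately show "I \<le> ennreal (c * V x r)" using assms by (simp add: e ennreal_mult)
  next
    assume "I \<le> ennreal (c * V x r)"
    then have "I / ennreal (V x r) \<le> ennreal (c * V x r) / ennreal (V x r)" by (rule divide_right_mono_ennreal)
    also have "\<dots> = ennreal c" using V assms by (subst divide_ennreal) auto
    finally show "I / emeasure M (ball x r) \<le> ennreal c" by (simp add: e)
  qed
qed

lemma sigma_finite: "sigma_finite_measure M"
proof
  fix x0 :: 'a
  show "\<exists>F. countable F \<and> F \<subseteq> sets M \<and> \<Union>F = space M \<and> (\<forall>a\<in>F. emeasure M a \<noteq> \<infinity>)"
  proof (intro exI[of _ "range (\<lambda>n::nat. ball x0 (real n))"] conjI)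
    show "\<Union>(range (\<lambda>n::nat. ball x0 (real n))) = space M"
      using reals_Archimedean2 by auto
    show "\<forall>a\<in>range (\<lambda>n::nat. ball x0 (real n)). emeasure M a \<noteq> \<infinity>"
      using ball_finite by (auto simp: less_top)
  qed auto
qed

text \<open>
  The measures of the balls are positive and have a finite sum, so there are only countably many of them.
\<close>

lemma countable_disjoint_balls:
  assumes disj: "disjoint_family_on (\<lambda>y. ball y (s y)) J" and pos: "\<And>y. y \<in> J \<Longrightarrow> 0 < s y"
    and sub: "\<And>y. y \<in> J \<Longrightarrow> ball y (s y) \<subseteq> W" and W: "W \<in> sets M" "emeasure M W < \<infinity>"
  shows "countable J"
proof -
  have "(\<lambda>y. V y (s y)) summable_on J"
  proof (rule nonneg_bdd_above_summable_on)
    show "bdd_above (sum (\<lambda>y. V y (s y)) ` {F. F \<subseteq> J \<and> finite F})"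
    proof (rule bdd_aboveI2)
      fix F assume F: "F \<in> {F. F \<subseteq> J \<and> finite F}"
      have "disjoint_family_on (\<lambda>y. ball y (s y)) F"
        using F by (intro disjoint_family_on_mono[OF _ disj]) auto
      then have "(\<Sum>y\<in>F. V y (s y)) = measure M (\<Union>y\<in>F. ball y (s y))"
        using F by (intro measure_finite_Union[symmetric]) (auto simp: emeasure_ball)
      also have "\<dots> \<le> measure M W"
        using F sub W by (intro measure_mono_fmeasurable) (auto simp: fmeasurable_def)
      finally show "(\<Sum>y\<in>F. V y (s y)) \<le> measure M W" .
    qed
  qed simp
  then have "countable {y\<in>J. V y (s y) \<noteq> 0}" by (rule summable_countable_real)
  also have "{y\<in>J. V y (s y) \<noteq> 0} = J"
    using V_pos[OF pos] by (auto simp: less_le)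
  finally show ?thesis .
qed

lemma nn_integral_disjoint_balls_le:
  assumes "disjoint_family_on (\<lambda>y. ball y (s y)) J" "countable J"
    and "h \<in> borel_measurable M" "\<And>y. y \<in> J \<Longrightarrow> ball y (s y) \<subseteq> W" "W \<in> sets M"
  shows "(\<integral>\<^sup>+y. (\<integral>\<^sup>+z\<in>ball y (s y). h z \<partial>M) \<partial>count_space J) \<le> (\<integral>\<^sup>+z\<in>W. h z \<partial>M)"
  using assms by (intro nn_integral_disjoint_UN_le) auto

text \<open>
  A substitute for the Lebesgue differentiation theorem: a function with averages at most \<open>l\<close> over all small
  balls centered in \<open>E\<close> cannot exceed a fixed multiple of \<open>l\<close> on a non-null part of \<open>E\<close>. Enclose \<open>E\<close> in an open set
  \<open>U\<close> of at most twice its measure and cover \<open>E\<close> by balls whose shrunken copies are disjoint and lie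
  in \<open>U\<close>: the integral of \<open>h\<close> over \<open>E\<close> is at most \<open>l\<close> times the measure of the covering balls, which is at most
  \<open>A\<^sup>3\<close> times that of \<open>U\<close>.
\<close>

lemma small_averages_bound:
  fixes h :: "'a \<Rightarrow> ennreal"
  assumes h [measurable]: "h \<in> borel_measurable M" and E [measurable]: "E \<in> sets M"
    and fin: "emeasure M E < \<infinity>" and r: "0 < r" and lam: "0 < l"
    and small: "\<And>y s. y \<in> E \<Longrightarrow> 0 < s \<Longrightarrow> s \<le> r \<Longrightarrow>
        (\<integral>\<^sup>+z\<in>ball y s. h z \<partial>M) \<le> ennreal (l * V y s)"
    and big: "\<And>y. y \<in> E \<Longrightarrow> ennreal (4 * A ^ 3 * l) \<le> h y"
  shows "emeasure M E = 0"
proof (rule ccontr)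
  assume "emeasure M E \<noteq> 0"
  then have E0: "0 < emeasure M E" by (simp add: zero_less_iff_neq_zero)
  obtain e where e: "emeasure M E = ennreal e" "0 < e"
    using E0 fin by (cases "emeasure M E") auto
  have "(INF U\<in>{U. open U \<and> E \<subseteq> U}. emeasure M U) < ennreal (2 * e)"
    unfolding outer_regular[OF E, symmetric] e using e by (simp add: ennreal_less_iff)
  then obtain U where U: "open U" "E \<subseteq> U" "emeasure M U < ennreal (2 * e)"
    by (auto simp: INF_less_iff)
  \<comment> \<open>The balls of radius \<open>5 * s\<close> will cover \<open>E\<close>; \<open>s \<le> r / 5\<close> keeps them within the radii of \<open>small\<close>.\<close>
  have "\<forall>y\<in>E. \<exists>s. 0 < s \<and> s \<le> r / 5 \<and> ball y (5 * s) \<subseteq> U"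
  proof
    fix y assume "y \<in> E"
    then obtain d where d: "0 < d" "ball y d \<subseteq> U" using U open_contains_ball by blast
    have "ball y (5 * min (d / 5) (r / 5)) \<subseteq> ball y d" by auto
    then show "\<exists>s. 0 < s \<and> s \<le> r / 5 \<and> ball y (5 * s) \<subseteq> U"
      using d r by (intro exI[of _ "min (d / 5) (r / 5)"]) auto
  qed
  then obtain s where s: "\<And>y. y \<in> E \<Longrightarrow> 0 < s y" "\<And>y. y \<in> E \<Longrightarrow> s y \<le> r / 5"
    "\<And>y. y \<in> E \<Longrightarrow> ball y (5 * s y) \<subseteq> U" by metis
  obtain J where J: "J \<subseteq> E" "disjoint_family_on (\<lambda>y. ball y (s y)) J"
    "\<And>y. y \<in> E \<Longrightarrow> \<exists>z\<in>J. ball y (s y) \<subseteq> ball z (5 * s z)"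
    by (rule vitali_five_r[of E s "r / 5", OF s(1,2)]) blast+
  have subU: "ball y (s y) \<subseteq> U" if "y \<in> J" for y
  proof -
    have "ball y (s y) \<subseteq> ball y (5 * s y)" using s(1)[of y] that J(1) by (intro subset_ball) auto
    then show ?thesis using s(3)[of y] that J(1) by blast
  qed
  have UM: "U \<in> sets M" "emeasure M U < \<infinity>"
    using sets_open[OF U(1)] order.strict_trans[OF U(3) ennreal_less_top] by simp_all
  have cJ: "countable J"
    by (rule countable_disjoint_balls[OF J(2) _ subU UM]) (use s J in auto)
  have EJ: "E \<subseteq> (\<Union>y\<in>J. ball y (5 * s y))"
  proof
    fix y assume y: "y \<in> E"
    then have "y \<in> ball y (s y)" using s by simp
    then show "y \<in> (\<Union>y\<in>J. ball y (5 * s y))" using J(3)[OF y] by blast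
  qed
  have "ennreal (4 * A ^ 3 * l) * emeasure M E = (\<integral>\<^sup>+y. ennreal (4 * A ^ 3 * l) * indicator E y \<partial>M)"
    by (simp add: nn_integral_cmult_indicator)
  also have "\<dots> \<le> (\<integral>\<^sup>+y\<in>(\<Union>y\<in>J. ball y (5 * s y)). h y \<partial>M)"
    using big EJ by (intro nn_integral_mono) (auto simp: indicator_def)
  also have "\<dots> \<le> (\<integral>\<^sup>+y. (\<integral>\<^sup>+z\<in>ball y (5 * s y). h z \<partial>M) \<partial>count_space J)"
    using cJ by (intro nn_integral_UN_le) auto
  also have "\<dots> \<le> (\<integral>\<^sup>+y. ennreal (l * A ^ 3) * (\<integral>\<^sup>+z\<in>ball y (s y). 1 \<partial>M) \<partial>count_space J)"
  proof (rule nn_integral_mono)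
    fix y assume "y \<in> space (count_space J)"
    then have y: "y \<in> E" using J by auto
    have "(\<integral>\<^sup>+z\<in>ball y (5 * s y). h z \<partial>M) \<le> ennreal (l * V y (5 * s y))"
      using s[OF y] by (intro small[OF y]) auto
    also have "\<dots> \<le> ennreal (l * (A ^ 3 * V y (s y)))"
      using s(1)[OF y] lam by (intro ennreal_leI mult_left_mono V_le_of_dist) auto
    also have "\<dots> = ennreal (l * A ^ 3) * emeasure M (ball y (s y))"
      using lam A_ge_1 by (simp add: emeasure_ball ennreal_mult[symmetric] mult_ac)
    finally show "(\<integral>\<^sup>+z\<in>ball y (5 * s y). h z \<partial>M) \<le> ennreal (l * A ^ 3) * (\<integral>\<^sup>+z\<in>ball y (s y). 1 \<partial>M)"
      by simp
  qed
  also have "\<dots> = ennreal (l * A ^ 3) * (\<integral>\<^sup>+y. (\<integral>\<^sup>+z\<in>ball y (s y). 1 \<partial>M) \<partial>count_space J)"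
    by (intro nn_integral_cmult) auto
  also have "\<dots> \<le> ennreal (l * A ^ 3) * (\<integral>\<^sup>+z\<in>U. 1 \<partial>M)"
    using J(2) cJ subU UM(1) by (intro mult_left_mono nn_integral_disjoint_balls_le) auto
  also have "\<dots> \<le> ennreal (l * A ^ 3) * ennreal (2 * e)"
    using U(3) UM by (intro mult_left_mono) (auto simp: less_imp_le)
  finally have "4 * A ^ 3 * l * e \<le> l * A ^ 3 * (2 * e)"
    using lam A_ge_1 e by (simp add: ennreal_mult[symmetric] ennreal_le_iff)
  moreover have "0 < A ^ 3 * l * e" using lam A_ge_1 e by simp
  ultimately show False by (simp add: mult_ac)
qed

text \<open>
  The stopping-time argument. Around each point of the ball where some average of \<open>h\<close> exceeds the height \<open>l\<close>,
  take a radius of this kind that is largest up to the factor \<open>5\<close>. A disjoint selection has small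
  total measure because the integral of \<open>h\<close> over each selected ball exceeds \<open>l\<close> times its measure, the fivefold balls have averages
  at most \<open>l\<close> because they are past the largest radius, and off their union all averages are at most \<open>l\<close>,
  so that \<open>small_averages_bound\<close> applies.
\<close>

lemma calderon_zygmund_covering:
  fixes h :: "'a \<Rightarrow> ennreal" and a l :: real
  assumes h [measurable]: "h \<in> borel_measurable M" and r: "0 < r" and a: "0 < a"
    and l: "l = 8 * A ^ 6 * a"
    and mean: "(\<integral>\<^sup>+z\<in>ball x (2 * r). h z \<partial>M) \<le> ennreal (a * V x r)"
  obtains J s where "countable J" "\<And>y. y \<in> J \<Longrightarrow> 0 < s y"
    "\<And>y. y \<in> J \<Longrightarrow> (\<integral>\<^sup>+z\<in>ball y (s y). h z \<partial>M) \<le> ennreal (l * V y (s y))"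
    "(\<integral>\<^sup>+y. emeasure M (ball y (s y)) \<partial>count_space J) \<le> ennreal (V x r / 8)"
    "AE y\<in>ball x r in M. y \<notin> (\<Union>z\<in>J. ball z (s z)) \<longrightarrow> h y \<le> ennreal (4 * A ^ 3 * l)"
proof -
  have A0: "0 < A" using A_ge_1 by simp
  have l0: "0 < l" using A0 a by (simp add: l)
  define bad where "bad y u \<longleftrightarrow> 0 < u \<and> u \<le> r \<and> ennreal (l * V y u) < (\<integral>\<^sup>+z\<in>ball y u. h z \<partial>M)" for y u
  \<comment> \<open>A ball of radius \<open>u \<ge> r / 20\<close> is comparable to the whole ball, so its average is at most the height \<open>l\<close>.
    As \<open>5 * (r / 20) < r\<close>, a fivefold bad radius is still among the radii tested by \<open>bad\<close>.\<close>
  have bad_small: "u < r / 20" if y: "y \<in> ball x r" and bad: "bad y u" for y u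
  proof (rule ccontr)
    assume u: "\<not> u < r / 20"
    have sub: "ball y u \<subseteq> ball x (2 * r)"
    proof
      fix z assume "z \<in> ball y u"
      then have "dist x z < r + r" using y bad dist_triangle[of x z y] by (simp add: bad_def)
      then show "z \<in> ball x (2 * r)" by simp
    qed
    have "(\<integral>\<^sup>+z\<in>ball y u. h z \<partial>M) \<le> (\<integral>\<^sup>+z\<in>ball x (2 * r). h z \<partial>M)"
      using sub by (intro nn_integral_mono) (auto simp: indicator_def)
    also have "\<dots> \<le> ennreal (a * V x r)" by (rule mean)
    also have "a * V x r \<le> a * (A ^ 6 * V y u)"
      using y u r bad a by (intro mult_left_mono V_le_of_dist) (auto simp: bad_def dist_commute)
    also have "\<dots> \<le> l * V y u"
      using a A0 by (simp add: l mult_ac)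
    finally show False using bad by (auto simp: bad_def ennreal_leI)
  qed
  define Y where "Y = {y \<in> ball x r. \<exists>u. bad y u}"
  have "\<forall>y\<in>Y. \<exists>s. bad y s \<and> \<not> bad y (5 * s)"
  proof
    fix y assume "y \<in> Y"
    then obtain u where u: "bad y u" by (auto simp: Y_def)
    define S where "S = Collect (bad y)"
    have bdd: "bdd_above S" by (auto simp: S_def bad_def bdd_above_def)
    have up: "v \<le> Sup S" if "bad y v" for v using bdd that by (intro cSup_upper) (auto simp: S_def)
    have "0 < Sup S" using up[OF u] u by (simp add: bad_def)
    then have "Sup S / 5 < Sup S" by simp
    then obtain s where "s \<in> S" "Sup S / 5 < s" by (rule less_cSupE) (use u in \<open>auto simp: S_def\<close>)
    then show "\<exists>s. bad y s \<and> \<not> bad y (5 * s)" using up[of "5 * s"] by (auto simp: S_def)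
  qed
  then obtain s where s: "\<And>y. y \<in> Y \<Longrightarrow> bad y (s y)" "\<And>y. y \<in> Y \<Longrightarrow> \<not> bad y (5 * s y)" by metis
  have s_pos: "0 < s y" and s_le: "s y \<le> r / 20" if "y \<in> Y" for y
    using s(1)[OF that] bad_small[of y "s y"] that by (auto simp: bad_def Y_def)
  have s_le_r: "s y \<le> r" if "y \<in> Y" for y using s_le[OF that] r by simp
  obtain J where J: "J \<subseteq> Y" "disjoint_family_on (\<lambda>y. ball y (s y)) J"
    "\<And>y. y \<in> Y \<Longrightarrow> \<exists>z\<in>J. ball y (s y) \<subseteq> ball z (5 * s z)"
    by (rule vitali_five_r[of Y s r, OF s_pos s_le_r]) blast+
  have sub: "ball y (s y) \<subseteq> ball x (2 * r)" if "y \<in> J" for y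
  proof
    fix z assume "z \<in> ball y (s y)"
    moreover have "y \<in> Y" "dist x y < r" using J(1) that by (auto simp: Y_def)
    ultimately have "dist x z < r + r"
      using s_le_r[of y] dist_triangle[of x z y] by simp
    then show "z \<in> ball x (2 * r)" by simp
  qed
  have cJ: "countable J"
    by (rule countable_disjoint_balls[OF J(2) _ sub _ ball_finite]) (use s_pos J in auto)
  show thesis
  proof (rule that[of J "\<lambda>y. 5 * s y"])
    show "countable J" by (rule cJ)
    show "0 < 5 * s y" if "y \<in> J" for y using s_pos[of y] J that by auto
    show "(\<integral>\<^sup>+z\<in>ball y (5 * s y). h z \<partial>M) \<le> ennreal (l * V y (5 * s y))" if "y \<in> J" for y
      using s(2)[of y] s_pos[of y] s_le[of y] J that r by (auto simp: bad_def not_less)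
    have "(\<integral>\<^sup>+y. emeasure M (ball y (5 * s y)) \<partial>count_space J)
        \<le> (\<integral>\<^sup>+y. ennreal (A ^ 3 / l) * (\<integral>\<^sup>+z\<in>ball y (s y). h z \<partial>M) \<partial>count_space J)"
    proof (rule nn_integral_mono)
      fix y assume "y \<in> space (count_space J)"
      then have y: "y \<in> Y" using J by auto
      have "emeasure M (ball y (5 * s y)) \<le> ennreal (A ^ 3 * V y (s y))"
        unfolding emeasure_ball using s_pos[OF y] by (intro ennreal_leI V_le_of_dist) auto
      also have "\<dots> = ennreal (A ^ 3 / l) * ennreal (l * V y (s y))"
        using l0 A0 by (simp add: ennreal_mult[symmetric])
      also have "\<dots> \<le> ennreal (A ^ 3 / l) * (\<integral>\<^sup>+z\<in>ball y (s y). h z \<partial>M)"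
        using s(1)[OF y] by (intro mult_left_mono) (auto simp: bad_def)
      finally show "emeasure M (ball y (5 * s y)) \<le> ennreal (A ^ 3 / l) * (\<integral>\<^sup>+z\<in>ball y (s y). h z \<partial>M)" .
    qed
    also have "\<dots> = ennreal (A ^ 3 / l) * (\<integral>\<^sup>+y. (\<integral>\<^sup>+z\<in>ball y (s y). h z \<partial>M) \<partial>count_space J)"
      by (intro nn_integral_cmult) auto
    also have "\<dots> \<le> ennreal (A ^ 3 / l) * (\<integral>\<^sup>+z\<in>ball x (2 * r). h z \<partial>M)"
      using J(2) cJ sub by (intro mult_left_mono nn_integral_disjoint_balls_le) auto
    also have "\<dots> \<le> ennreal (A ^ 3 / l) * ennreal (a * V x r)"
      using mean by (intro mult_left_mono) auto
    also have "\<dots> = ennreal (A ^ 3 / l * (a * V x r))"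
      using l0 A0 a by (intro ennreal_mult[symmetric]) auto
    also have "\<dots> \<le> ennreal (V x r / 8)"
    proof (rule ennreal_leI)
      have "A ^ 3 / l * (a * V x r) = V x r / 8 / A ^ 3"
        using A0 a by (simp add: l field_simps)
      also have "\<dots> \<le> V x r / 8"
        using divide_left_mono[of 1 "A ^ 3" "V x r / 8"] one_le_power[OF A_ge_1, of 3] A0 by simp
      finally show "A ^ 3 / l * (a * V x r) \<le> V x r / 8" .
    qed
    finally show "(\<integral>\<^sup>+y. emeasure M (ball y (5 * s y)) \<partial>count_space J) \<le> ennreal (V x r / 8)" .
    define W where "W = (\<Union>z\<in>J. ball z (5 * s z))"
    have W [measurable]: "W \<in> sets M" unfolding W_def using cJ by (intro sets.countable_UN') auto
    define E where "E = {y \<in> space M. y \<in> ball x r \<and> y \<notin> W \<and> ennreal (4 * A ^ 3 * l) < h y}"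
    have E [measurable]: "E \<in> sets M" unfolding E_def by measurable
    have "emeasure M E = 0"
    proof (rule small_averages_bound[OF h E _ r l0])
      have "emeasure M E \<le> emeasure M (ball x r)" by (intro emeasure_mono) (auto simp: E_def)
      then show "emeasure M E < \<infinity>" using ball_finite by (rule le_less_trans)
      show "ennreal (4 * A ^ 3 * l) \<le> h y" if "y \<in> E" for y using that by (simp add: E_def less_imp_le)
      show "(\<integral>\<^sup>+z\<in>ball y u. h z \<partial>M) \<le> ennreal (l * V y u)" if y: "y \<in> E" and u: "0 < u" "u \<le> r" for y u
      proof -
        have "y \<notin> Y"
        proof
          assume "y \<in> Y"
          then have "y \<in> ball y (s y)" "\<exists>z\<in>J. ball y (s y) \<subseteq> ball z (5 * s z)"
            using s_pos J(3) by auto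
          then have "y \<in> W" unfolding W_def by blast
          then show False using y by (simp add: E_def)
        qed
        then show ?thesis using y u by (auto simp: Y_def E_def bad_def not_less)
      qed
    qed
    then have "AE y in M. y \<notin> E" by (intro AE_not_in) auto
    then show "AE y\<in>ball x r in M. y \<notin> (\<Union>z\<in>J. ball z (5 * s z)) \<longrightarrow> h y \<le> ennreal (4 * A ^ 3 * l)"
      unfolding W_def[symmetric] by eventually_elim (auto simp: E_def not_less)
  qed
qed

section \<open>Means and the John--Nirenberg inequality\<close>

text \<open>
  \<open>a\<close> bounds the mean of \<open>|h|\<close> over the ball, written as a product so that no division of infinite values occurs.
\<close>

definition mean_le :: "('a \<Rightarrow> 'b::real_normed_vector) \<Rightarrow> 'a \<Rightarrow> real \<Rightarrow> real \<Rightarrow> bool" where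
  "mean_le h x s a \<longleftrightarrow> (\<integral>\<^sup>+y\<in>ball x s. ennreal (norm (h y)) \<partial>M) \<le> ennreal (a * V x s)"

lemma mean_le_mono: "mean_le h x s a \<Longrightarrow> a \<le> b \<Longrightarrow> mean_le h x s b"
  unfolding mean_le_def by (erule order_trans) (intro ennreal_leI mult_right_mono, auto)

lemma mean_le_subset:
  assumes "mean_le h z u a" "ball x s \<subseteq> ball z u" "V z u \<le> k * V x s" "0 \<le> a"
  shows "mean_le h x s (k * a)"
proof -
  have "(\<integral>\<^sup>+y\<in>ball x s. ennreal (norm (h y)) \<partial>M) \<le> (\<integral>\<^sup>+y\<in>ball z u. ennreal (norm (h y)) \<partial>M)"
    using assms(2) by (intro nn_integral_mono) (auto simp: indicator_def)
  also have "\<dots> \<le> ennreal (a * V z u)" using assms(1) by (simp add: mean_le_def)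
  also have "\<dots> \<le> ennreal (a * (k * V x s))"
    using assms by (intro ennreal_leI mult_left_mono) auto
  finally show ?thesis by (simp add: mean_le_def mult_ac)
qed

lemma mean_le_const: "mean_le (\<lambda>_. c) x s (norm c)"
  by (simp add: mean_le_def nn_integral_cmult_indicator emeasure_ball ennreal_mult[symmetric])

lemma mean_le_shift:
  fixes f :: "'a \<Rightarrow> 'b::{real_normed_vector, second_countable_topology}"
  assumes [measurable]: "f \<in> borel_measurable M"
    and "mean_le (\<lambda>y. f y - c) x s a" "norm (c - d) \<le> b" "0 \<le> a"
  shows "mean_le (\<lambda>y. f y - d) x s (a + b)"
proof -
  have b: "0 \<le> b" using assms(3) norm_ge_zero order_trans by blast
  have "(\<integral>\<^sup>+y\<in>ball x s. ennreal (norm (f y - d)) \<partial>M)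
      \<le> (\<integral>\<^sup>+y. ennreal (norm (f y - c)) * indicator (ball x s) y + ennreal b * indicator (ball x s) y \<partial>M)"
  proof (rule nn_integral_mono)
    fix y
    have "norm (f y - d) \<le> norm (f y - c) + norm (c - d)"
      using norm_triangle_ineq[of "f y - c" "c - d"] by simp
    then have "ennreal (norm (f y - d)) \<le> ennreal (norm (f y - c)) + ennreal b"
      using assms(3) b by (simp add: ennreal_plus[symmetric] del: ennreal_plus)
    then show "ennreal (norm (f y - d)) * indicator (ball x s) y
      \<le> ennreal (norm (f y - c)) * indicator (ball x s) y + ennreal b * indicator (ball x s) y"
      by (auto simp: indicator_def)
  qed
  also have "\<dots> = (\<integral>\<^sup>+y\<in>ball x s. ennreal (norm (f y - c)) \<partial>M) + ennreal b * ennreal (V x s)"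
    by (subst nn_integral_add) (auto simp: nn_integral_cmult_indicator emeasure_ball)
  also have "\<dots> \<le> ennreal (a * V x s) + ennreal b * ennreal (V x s)"
    using assms(2) by (intro add_right_mono) (simp add: mean_le_def)
  also have "\<dots> = ennreal ((a + b) * V x s)"
    using b assms(4) by (simp add: ennreal_mult[symmetric] ennreal_plus[symmetric] distrib_right del: ennreal_plus)
  finally show ?thesis by (simp add: mean_le_def)
qed

lemma norm_ball_avg_diff_le:
  fixes f :: "'a \<Rightarrow> 'b::{banach, second_countable_topology}"
  assumes f: "f \<in> L1_loc M" and r: "0 < r" and mean: "mean_le (\<lambda>y. f y - c) x r a" and a: "0 \<le> a"
  shows "norm (ball_avg M (ball x r) f - c) \<le> a"
proof -
  let ?B = "ball x r"
  have int: "set_integrable M ?B f" using f r by (auto simp: L1_loc_def)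
  have intc: "set_integrable M ?B (\<lambda>_. c)"
    unfolding set_integrable_def using ball_finite[of x r] by (intro integrable_scaleR_left) auto
  have "(LINT y:?B|M. c) = V x r *\<^sub>R c"
    unfolding set_lebesgue_integral_def using ball_finite[of x r]
    by (subst integral_scaleR_left) auto
  then have "(LINT y:?B|M. f y - c) = (LINT y:?B|M. f y) - V x r *\<^sub>R c"
    using int intc by (simp add: set_integral_diff)
  then have eq: "ball_avg M ?B f - c = (LINT y:?B|M. f y - c) /\<^sub>R V x r"
    using V_pos[OF r, of x] by (simp add: ball_avg_def scaleR_diff_right)
  have "set_integrable M ?B (\<lambda>y. f y - c)" using int intc by simp
  then have "ennreal (norm (LINT y:?B|M. f y - c)) \<le> (\<integral>\<^sup>+y. ennreal (norm (indicator ?B y *\<^sub>R (f y - c))) \<partial>M)"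
    unfolding set_lebesgue_integral_def set_integrable_def by (rule integral_norm_bound_ennreal)
  also have "\<dots> = (\<integral>\<^sup>+y\<in>?B. ennreal (norm (f y - c)) \<partial>M)"
    by (intro nn_integral_cong) (auto simp: indicator_def)
  also have "\<dots> \<le> ennreal (a * V x r)" using mean by (simp add: mean_le_def)
  finally have "norm (LINT y:?B|M. f y - c) \<le> a * V x r" using a by (simp add: ennreal_le_iff)
  then show ?thesis unfolding eq using V_pos[OF r, of x] by (simp add: divide_simps)
qed

lemma L1_loc_measurable:
  fixes f :: "'a \<Rightarrow> 'b::{banach, second_countable_topology}"
  assumes "f \<in> L1_loc M"
  shows "f \<in> borel_measurable M"
proof -
  fix x0 :: 'a
  show ?thesis
  proof (rule borel_measurable_LIMSEQ_metric)
    fix n :: nat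
    have "set_integrable M (ball x0 (real n + 1)) f" using assms by (auto simp: L1_loc_def)
    then show "(\<lambda>y. indicator (ball x0 (real n + 1)) y *\<^sub>R f y) \<in> borel_measurable M"
      by (auto simp: set_integrable_def)
  next
    fix y
    obtain N :: nat where N: "dist x0 y < real N" using reals_Archimedean2 by blast
    have "\<forall>\<^sub>F n in sequentially. indicator (ball x0 (real n + 1)) y *\<^sub>R f y = f y"
      using eventually_ge_at_top[of N] by eventually_elim (use N in \<open>auto simp: indicator_def\<close>)
    then show "(\<lambda>n. indicator (ball x0 (real n + 1)) y *\<^sub>R f y) \<longlonglongrightarrow> f y"
      by (rule tendsto_eventually)
  qed
qed

text \<open>
  \<open>b\<close> bounds the classical BMO seminorm, taken over balls of every radius.
\<close>

definition osc_le :: "('a \<Rightarrow> 'b::{banach, second_countable_topology}) \<Rightarrow> real \<Rightarrow> bool" where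
  "osc_le f b \<longleftrightarrow> f \<in> L1_loc M \<and>
     (\<forall>x r. 0 < r \<longrightarrow> mean_le (\<lambda>y. f y - ball_avg M (ball x r) f) x r b)"

lemma osc_le_measurable: "osc_le f b \<Longrightarrow> f \<in> borel_measurable M"
  by (auto simp: osc_le_def intro: L1_loc_measurable)

lemma ball_avg_double_diff_le:
  assumes "osc_le f b" "0 < r" "0 \<le> b"
  shows "norm (ball_avg M (ball x r) f - ball_avg M (ball x (2 * r)) f) \<le> A * b"
proof (rule norm_ball_avg_diff_le)
  show "mean_le (\<lambda>y. f y - ball_avg M (ball x (2 * r)) f) x r (A * b)"
    using assms by (intro mean_le_subset[where z = x and u = "2 * r"] doubling) (auto simp: osc_le_def)
qed (use assms A_ge_1 in \<open>auto simp: osc_le_def\<close>)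

text \<open>
  Induction on \<open>n\<close>. Where \<open>f\<close> is further than \<open>(n+1)K\<close> from its mean, it is almost everywhere in one of the balls
  of the stopping time. There the mean differs from the original one by at most \<open>K\<close>, so \<open>f\<close>
  is further than \<open>nK\<close> from the new mean, and the hypothesis applies to each ball; the total measure of the
  balls is at most one eighth of the original one.
\<close>

theorem john_nirenberg:
  fixes f :: "'a \<Rightarrow> 'b::{banach, second_countable_topology}"
  assumes osc: "osc_le f b" and b: "0 < b" and K: "K = 64 * A ^ 11 * b" and r: "0 < r"
  shows "emeasure M {y \<in> ball x r. real n * K < norm (f y - ball_avg M (ball x r) f)}
         \<le> ennreal (V x r / 8 ^ n)"
  using r
proof (induction n arbitrary: x r)
  case 0
  have "emeasure M {y \<in> ball x r. real 0 * K < norm (f y - ball_avg M (ball x r) f)} \<le> emeasure M (ball x r)"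
    by (intro emeasure_mono) auto
  then show ?case by (simp add: emeasure_ball)
next
  case (Suc n)
  note r = \<open>0 < r\<close>
  let ?c = "ball_avg M (ball x r) f"
  have fL: "f \<in> L1_loc M" using osc by (simp add: osc_le_def)
  then have f [measurable]: "f \<in> borel_measurable M" by (rule L1_loc_measurable)
  have A0: "0 < A" using A_ge_1 by simp
  \<comment> \<open>The stopping time needs a bound on the doubled ball, for the mean over the original one.\<close>
  have "mean_le (\<lambda>y. f y - ?c) x (2 * r) (b + A * b)"
    using osc r b ball_avg_double_diff_le[OF osc r, of x]
    by (intro mean_le_shift[where c = "ball_avg M (ball x (2 * r)) f"])
       (auto simp: osc_le_def norm_minus_commute)
  then have "(\<integral>\<^sup>+y\<in>ball x (2 * r). ennreal (norm (f y - ?c)) \<partial>M) \<le> ennreal ((b + A * b) * V x (2 * r))"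
    by (simp add: mean_le_def)
  also have "\<dots> \<le> ennreal ((2 * A ^ 2 * b) * V x r)"
  proof (rule ennreal_leI)
    have "(b + A * b) * V x (2 * r) \<le> (2 * A * b) * (A * V x r)"
      using b A_ge_1 doubling[OF r] by (intro mult_mono) auto
    then show "(b + A * b) * V x (2 * r) \<le> (2 * A ^ 2 * b) * V x r"
      by (simp add: power2_eq_square mult_ac)
  qed
  finally have mean: "(\<integral>\<^sup>+y\<in>ball x (2 * r). ennreal (norm (f y - ?c)) \<partial>M) \<le> ennreal ((2 * A ^ 2 * b) * V x r)" .
  define l where "l = 8 * A ^ 6 * (2 * A ^ 2 * b)"
  have l0: "0 < l" using A0 b by (simp add: l_def)
  have lK: "4 * A ^ 3 * l = K" unfolding l_def K by (simp add: mult_ac power_add[symmetric])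
  have "l * 1 \<le> l * (4 * A ^ 3)" using l0 one_le_power[OF A_ge_1, of 3] by (intro mult_left_mono) auto
  then have l_le: "l \<le> K" using lK by (simp add: mult_ac)
  have K0: "0 < K" using l0 l_le by simp
  obtain J s where J: "countable J" "\<And>y. y \<in> J \<Longrightarrow> 0 < s y"
    "\<And>y. y \<in> J \<Longrightarrow> (\<integral>\<^sup>+z\<in>ball y (s y). ennreal (norm (f z - ?c)) \<partial>M) \<le> ennreal (l * V y (s y))"
    "(\<integral>\<^sup>+y. emeasure M (ball y (s y)) \<partial>count_space J) \<le> ennreal (V x r / 8)"
    "AE y\<in>ball x r in M. y \<notin> (\<Union>z\<in>J. ball z (s z)) \<longrightarrow> ennreal (norm (f y - ?c)) \<le> ennreal (4 * A ^ 3 * l)"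
    by (rule calderon_zygmund_covering[OF _ r _ l_def mean]) (use A0 b in auto)
  define D where "D z = {y \<in> ball z (s z). real n * K < norm (f y - ball_avg M (ball z (s z)) f)}" for z
  have D [measurable]: "D z \<in> sets M" for z
  proof -
    have "D z = {y \<in> space M. y \<in> ball z (s z) \<and> real n * K < norm (f y - ball_avg M (ball z (s z)) f)}"
      by (auto simp: D_def)
    also have "\<dots> \<in> sets M" by measurable
    finally show ?thesis .
  qed
  have UD: "(\<Union>z\<in>J. D z) \<in> sets M" using J(1) by (intro sets.countable_UN') auto
  have "emeasure M {y \<in> ball x r. real (Suc n) * K < norm (f y - ?c)} \<le> emeasure M (\<Union>z\<in>J. D z)"
  proof (rule emeasure_mono_AE[OF _ UD])
    show "AE y in M. y \<in> {y \<in> ball x r. real (Suc n) * K < norm (f y - ?c)} \<longrightarrow> y \<in> (\<Union>z\<in>J. D z)"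
      using J(5)
    proof eventually_elim
      case (elim y)
      show ?case
      proof
        assume "y \<in> {y \<in> ball x r. real (Suc n) * K < norm (f y - ?c)}"
        then have y: "y \<in> ball x r" "real n * K + K < norm (f y - ?c)" by (auto simp: algebra_simps)
        have "K < norm (f y - ?c)" using y(2) K0 by (smt (verit) mult_nonneg_nonneg of_nat_0_le_iff)
        then have "y \<in> (\<Union>z\<in>J. ball z (s z))"
          using elim y(1) by (auto simp: lK ennreal_le_iff K0 less_imp_le)
        then obtain z where z: "z \<in> J" "y \<in> ball z (s z)" by blast
        have "norm (ball_avg M (ball z (s z)) f - ?c) \<le> l"
          using J(2,3) z(1) l0 by (intro norm_ball_avg_diff_le fL) (auto simp: mean_le_def)
        then have "real n * K < norm (f y - ball_avg M (ball z (s z)) f)"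
          using y(2) l_le norm_triangle_ineq[of "f y - ball_avg M (ball z (s z)) f" "ball_avg M (ball z (s z)) f - ?c"]
          by simp
        then show "y \<in> (\<Union>z\<in>J. D z)" using z by (auto simp: D_def)
      qed
    qed
  qed
  also have "\<dots> = (\<integral>\<^sup>+y\<in>(\<Union>z\<in>J. D z). 1 \<partial>M)"
    using UD by simp
  also have "\<dots> \<le> (\<integral>\<^sup>+z. (\<integral>\<^sup>+y\<in>D z. 1 \<partial>M) \<partial>count_space J)"
    using J(1) by (intro nn_integral_UN_le) auto
  also have "\<dots> \<le> (\<integral>\<^sup>+z. ennreal (1 / 8 ^ n) * emeasure M (ball z (s z)) \<partial>count_space J)"
  proof (rule nn_integral_mono)
    fix z assume "z \<in> space (count_space J)"
    then have "emeasure M (D z) \<le> ennreal (V z (s z) / 8 ^ n)"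
      unfolding D_def using J(2)[of z] Suc.IH[of "s z" z] by simp
    also have "\<dots> = ennreal (1 / 8 ^ n) * emeasure M (ball z (s z))"
      unfolding emeasure_ball by (subst ennreal_mult[symmetric]) auto
    finally show "(\<integral>\<^sup>+y\<in>D z. 1 \<partial>M) \<le> ennreal (1 / 8 ^ n) * emeasure M (ball z (s z))" by simp
  qed
  also have "\<dots> = ennreal (1 / 8 ^ n) * (\<integral>\<^sup>+z. emeasure M (ball z (s z)) \<partial>count_space J)"
    by (intro nn_integral_cmult) auto
  also have "\<dots> \<le> ennreal (1 / 8 ^ n) * ennreal (V x r / 8)"
    using J(4) by (intro mult_left_mono) auto
  also have "\<dots> = ennreal (V x r / 8 ^ Suc n)"
    by (subst ennreal_mult[symmetric]) auto
  finally show ?case .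
qed

corollary osc_le_imp_L2:
  fixes f :: "'a \<Rightarrow> 'b::{banach, second_countable_topology}"
  assumes osc: "osc_le f b" and b: "0 < b" and r: "0 < r"
  shows "(\<integral>\<^sup>+y\<in>ball x r. ennreal ((norm (f y - ball_avg M (ball x r) f))\<^sup>2) \<partial>M)
         \<le> ennreal (2 * (64 * A ^ 11 * b)\<^sup>2 * V x r)"
proof -
  define K where "K = 64 * A ^ 11 * b"
  have K0: "0 < K" using A_ge_1 b by (simp add: K_def)
  let ?u = "\<lambda>y. norm (f y - ball_avg M (ball x r) f)"
  have "f \<in> L1_loc M" using osc by (simp add: osc_le_def)
  then have f [measurable]: "f \<in> borel_measurable M" by (rule L1_loc_measurable)
  define D where "D k = {y \<in> ball x r. real k * K < ?u y}" for k
  have D [measurable]: "D k \<in> sets M" for k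
  proof -
    have "D k = {y \<in> space M. y \<in> ball x r \<and> real k * K < ?u y}"
      by (auto simp: D_def)
    also have "\<dots> \<in> sets M" by measurable
    finally show ?thesis .
  qed
  have "(\<integral>\<^sup>+y\<in>ball x r. ennreal ((?u y)\<^sup>2) \<partial>M) \<le> (\<integral>\<^sup>+y. (\<Sum>k. ennreal (K\<^sup>2 * 4 ^ k) * indicator (D k) y) \<partial>M)"
  proof (rule nn_integral_mono)
    fix y
    have "ennreal ((?u y)\<^sup>2) \<le> (\<Sum>k. ennreal (K\<^sup>2 * 4 ^ k) * indicator (D k) y)" if "y \<in> ball x r"
      using power2_le_layers[OF K0, of "?u y"] that by (simp add: D_def indicator_def of_bool_def)
    then show "ennreal ((?u y)\<^sup>2) * indicator (ball x r) y \<le> (\<Sum>k. ennreal (K\<^sup>2 * 4 ^ k) * indicator (D k) y)"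
      by (auto simp: indicator_def)
  qed
  also have "\<dots> = (\<Sum>k. ennreal (K\<^sup>2 * 4 ^ k) * emeasure M (D k))"
    by (subst nn_integral_suminf) (auto simp: nn_integral_cmult_indicator)
  also have "\<dots> \<le> (\<Sum>k. ennreal (K\<^sup>2 * V x r * (1 / 2) ^ k))"
  proof (rule suminf_le)
    fix k
    have "ennreal (K\<^sup>2 * 4 ^ k) * emeasure M (D k) \<le> ennreal (K\<^sup>2 * 4 ^ k) * ennreal (V x r / 8 ^ k)"
      unfolding D_def by (intro mult_left_mono john_nirenberg[OF osc b K_def r]) auto
    also have "\<dots> = ennreal (K\<^sup>2 * 4 ^ k * (V x r / 8 ^ k))"
      by (subst ennreal_mult[symmetric]) auto
    also have "K\<^sup>2 * 4 ^ k * (V x r / 8 ^ k) = K\<^sup>2 * V x r * (4 / 8) ^ k" by (simp only: power_divide) simp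
    finally show "ennreal (K\<^sup>2 * 4 ^ k) * emeasure M (D k) \<le> ennreal (K\<^sup>2 * V x r * (1 / 2) ^ k)" by simp
  qed auto
  also have "\<dots> = ennreal (K\<^sup>2 * V x r * 2)"
  proof (rule suminf_ennreal_eq)
    show "(\<lambda>k. K\<^sup>2 * V x r * (1 / 2) ^ k) sums (K\<^sup>2 * V x r * 2)"
      using geometric_sums[of "1 / 2 :: real"] by (intro sums_mult) simp
  qed simp
  finally show ?thesis by (simp add: K_def mult_ac)
qed

lemma osc_local_L2:
  fixes f :: "'a \<Rightarrow> 'b::{banach, second_countable_topology}"
  assumes osc: "osc_le f b" and b: "0 < b" and r: "0 < r"
    and c: "norm (ball_avg M (ball z (2 * r)) f - c) \<le> e"
  shows "(\<integral>\<^sup>+y\<in>ball z (2 * r). ennreal ((norm (f y - c))\<^sup>2) \<partial>M)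
    \<le> ennreal ((4 * (64 * A ^ 11 * b)\<^sup>2 + 2 * e\<^sup>2) * A * V z r)"
proof -
  let ?m = "ball_avg M (ball z (2 * r)) f" and ?B = "ball z (2 * r)"
  have "f \<in> L1_loc M" using osc by (simp add: osc_le_def)
  then have [measurable]: "f \<in> borel_measurable M" by (rule L1_loc_measurable)
  have "(\<integral>\<^sup>+y\<in>?B. ennreal ((norm (f y - c))\<^sup>2) \<partial>M)
    \<le> (\<integral>\<^sup>+y. 2 * (ennreal ((norm (f y - ?m))\<^sup>2) * indicator ?B y) + ennreal (2 * e\<^sup>2) * indicator ?B y \<partial>M)"
  proof (rule nn_integral_mono)
    fix y
    have "(norm (f y - c))\<^sup>2 \<le> 2 * ((norm (f y - ?m))\<^sup>2 + (norm (?m - c))\<^sup>2)"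
      using norm_add2_power2[of "f y - ?m" "?m - c"] by simp
    also have "\<dots> \<le> 2 * ((norm (f y - ?m))\<^sup>2 + e\<^sup>2)"
      using c by (intro mult_left_mono add_left_mono power_mono) auto
    finally have "ennreal ((norm (f y - c))\<^sup>2) \<le> ennreal (2 * (norm (f y - ?m))\<^sup>2 + 2 * e\<^sup>2)"
      by (intro ennreal_leI) simp
    also have "\<dots> = 2 * ennreal ((norm (f y - ?m))\<^sup>2) + ennreal (2 * e\<^sup>2)"
      by (subst ennreal_plus) (auto simp: ennreal_mult)
    finally show "ennreal ((norm (f y - c))\<^sup>2) * indicator ?B y
      \<le> 2 * (ennreal ((norm (f y - ?m))\<^sup>2) * indicator ?B y) + ennreal (2 * e\<^sup>2) * indicator ?B y"
      by (auto simp: indicator_def)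
  qed
  also have "\<dots> = 2 * (\<integral>\<^sup>+y\<in>?B. ennreal ((norm (f y - ?m))\<^sup>2) \<partial>M) + ennreal (2 * e\<^sup>2) * ennreal (V z (2 * r))"
    by (subst nn_integral_add) (auto simp: nn_integral_cmult nn_integral_cmult_indicator emeasure_ball)
  also have "\<dots> \<le> 2 * ennreal (2 * (64 * A ^ 11 * b)\<^sup>2 * V z (2 * r)) + ennreal (2 * e\<^sup>2) * ennreal (V z (2 * r))"
    using r by (intro add_right_mono mult_left_mono osc_le_imp_L2[OF osc b]) auto
  also have "\<dots> = ennreal ((4 * (64 * A ^ 11 * b)\<^sup>2 + 2 * e\<^sup>2) * V z (2 * r))"
  proof -
    have "2 * ennreal (2 * (64 * A ^ 11 * b)\<^sup>2 * V z (2 * r)) = ennreal (2 * (2 * (64 * A ^ 11 * b)\<^sup>2 * V z (2 * r)))"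
      by (subst ennreal_mult) auto
    moreover have "ennreal (2 * e\<^sup>2) * ennreal (V z (2 * r)) = ennreal (2 * e\<^sup>2 * V z (2 * r))"
      by (subst ennreal_mult) auto
    ultimately show ?thesis by (simp add: ennreal_plus[symmetric] algebra_simps del: ennreal_plus)
  qed
  also have "\<dots> \<le> ennreal ((4 * (64 * A ^ 11 * b)\<^sup>2 + 2 * e\<^sup>2) * (A * V z r))"
    by (intro ennreal_leI mult_left_mono doubling r) auto
  finally show ?thesis by (simp add: mult_ac)
qed

section \<open>Growth of the means of a BMO function\<close>

lemma ball_avg_dyadic_diff_le:
  assumes "osc_le f b" "0 < r" "0 \<le> b"
  shows "norm (ball_avg M (ball x r) f - ball_avg M (ball x (2 ^ k * r)) f) \<le> real k * (A * b)"
proof (induction k)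
  case (Suc k)
  have "norm (ball_avg M (ball x (2 ^ k * r)) f - ball_avg M (ball x (2 * (2 ^ k * r))) f) \<le> A * b"
    using assms by (intro ball_avg_double_diff_le) auto
  then show ?case
    using Suc norm_triangle_ineq[of "ball_avg M (ball x r) f - ball_avg M (ball x (2 ^ k * r)) f"
      "ball_avg M (ball x (2 ^ k * r)) f - ball_avg M (ball x (2 * (2 ^ k * r))) f"]
    by (simp add: algebra_simps)
qed simp

text \<open>
  Doubling the radius changes the mean by at most \<open>A b\<close>, and about \<open>log 2 (s / r)\<close> doublings lead
  from \<open>r\<close> to \<open>s\<close>.
\<close>

lemma mean_le_log_growth:
  fixes f :: "'a \<Rightarrow> 'b::{banach, second_countable_topology}"
  assumes osc: "osc_le f b" and b: "0 \<le> b" and r: "0 < r" and d: "dist z x \<le> r" and rs: "r \<le> s"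
  shows "mean_le (\<lambda>y. f y - ball_avg M (ball z r) f) x s (3 * A ^ 4 * b * (1 + log 2 (s / r)))"
proof -
  define k where "k = nat \<lceil>log 2 (s / r)\<rceil>"
  have lg: "0 \<le> log 2 (s / r)" using r rs by (simp add: zero_le_log_cancel_iff)
  have k1: "log 2 (s / r) \<le> real k" "real k \<le> log 2 (s / r) + 1"
    unfolding k_def using lg by linarith+
  have sr: "s / r = 2 powr log 2 (s / r)" using r rs by simp
  have "s / r \<le> 2 powr real k" using k1 by (subst sr) (intro powr_mono, auto)
  then have s1: "s \<le> 2 ^ k * r" using r by (simp add: powr_realpow field_simps)
  have "2 powr real k \<le> 2 powr (log 2 (s / r) + 1)" using k1 by (intro powr_mono) auto
  then have s2: "2 ^ k * r \<le> 2 * s" using r rs by (simp add: powr_realpow powr_add field_simps)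
  let ?u = "2 ^ Suc k * r"
  have fL: "f \<in> L1_loc M" using osc by (simp add: osc_le_def)
  have "mean_le (\<lambda>y. f y - ball_avg M (ball z r) f) z ?u (b + real (Suc k) * (A * b))"
    using osc b r ball_avg_dyadic_diff_le[OF osc r b, of z "Suc k"]
    by (intro mean_le_shift[where c = "ball_avg M (ball z ?u) f"] L1_loc_measurable fL)
       (auto simp: osc_le_def norm_minus_commute)
  then have "mean_le (\<lambda>y. f y - ball_avg M (ball z r) f) x s (A ^ 3 * (b + real (Suc k) * (A * b)))"
  proof (rule mean_le_subset)
    show "ball x s \<subseteq> ball z ?u"
    proof
      fix y assume "y \<in> ball x s"
      then have "dist z y < r + s" using d dist_triangle[of z y x] by simp
      also have "\<dots> \<le> ?u" using s1 rs by simp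
      finally show "y \<in> ball z ?u" by simp
    qed
    show "V z ?u \<le> A ^ 3 * V x s"
      using d rs r s2 by (intro V_le_of_dist) (auto simp: dist_commute)
    show "0 \<le> b + real (Suc k) * (A * b)" using b A_ge_1 by simp
  qed
  then show ?thesis
  proof (rule mean_le_mono)
    have "b + real (Suc k) * (A * b) \<le> A * b + (log 2 (s / r) + 2) * (A * b)"
      using b A_ge_1 k1 mult_right_mono[of 1 A b] by (intro add_mono mult_right_mono) auto
    also have "\<dots> = (3 + log 2 (s / r)) * (A * b)" by (simp add: algebra_simps)
    also have "\<dots> \<le> (3 * (1 + log 2 (s / r))) * (A * b)"
      using lg A_ge_1 b by (intro mult_right_mono) auto
    finally have "A ^ 3 * (b + real (Suc k) * (A * b)) \<le> A ^ 3 * ((3 * (1 + log 2 (s / r))) * (A * b))"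
      using A_ge_1 by (intro mult_left_mono) auto
    then show "A ^ 3 * (b + real (Suc k) * (A * b)) \<le> 3 * A ^ 4 * b * (1 + log 2 (s / r))"
      by (simp add: numeral_eq_Suc mult_ac)
  qed
qed

text \<open>
  \<open>b\<close> bounds both the mean oscillation over all balls and the means of \<open>|f|\<close> over the balls with \<open>\<rho> x \<le> r\<close>. It is equivalent
  to a bound of the norm of \<open>BMO\<^sub>\<rho>\<close>, which asks for the oscillation only over the remaining balls.
\<close>

definition bmo_le :: "('a \<Rightarrow> real) \<Rightarrow> ('a \<Rightarrow> 'b::{banach, second_countable_topology}) \<Rightarrow> real \<Rightarrow> bool" where
  "bmo_le \<rho> f b \<longleftrightarrow> osc_le f b \<and> (\<forall>x r. 0 < r \<longrightarrow> \<rho> x \<le> r \<longrightarrow> mean_le f x r b)"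

text \<open>
  On a ball with \<open>\<rho> x \<le> r\<close> both \<open>|f|\<close> and the mean of \<open>f\<close> are controlled by \<open>N\<close>, hence the oscillation
  by \<open>2N\<close>.
\<close>

lemma BMO_norm_imp_bmo_le:
  assumes f: "f \<in> L1_loc M" and norm: "BMO_norm M \<rho> f \<le> ennreal N" and N: "0 \<le> N"
  shows "bmo_le \<rho> f (2 * N)"
proof -
  have small: "mean_le (\<lambda>y. f y - ball_avg M (ball x r) f) x r N" if r: "0 < r" "r < \<rho> x" for x r
  proof -
    have "(\<integral>\<^sup>+y\<in>ball x r. ennreal (norm (f y - ball_avg M (ball x r) f)) \<partial>M) / emeasure M (ball x r)
      \<le> (SUP (x, r)\<in>balls_not_D \<rho>.
       (\<integral>\<^sup>+y\<in>ball x r. ennreal (norm (f y - ball_avg M (ball x r) f)) \<partial>M) / emeasure M (ball x r))"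
      using r by (intro SUP_upper2[of "(x, r)"]) (auto simp: balls_not_D_def)
    also have "\<dots> \<le> BMO_norm M \<rho> f" by (simp add: BMO_norm_def)
    also note norm
    finally show ?thesis using r N by (simp add: average_le_iff mean_le_def)
  qed
  have large: "mean_le f x r N" if r: "0 < r" "\<rho> x \<le> r" for x r
  proof -
    have "(\<integral>\<^sup>+y\<in>ball x r. ennreal (norm (f y)) \<partial>M) / emeasure M (ball x r)
      \<le> (SUP (x, r)\<in>balls_D \<rho>. (\<integral>\<^sup>+y\<in>ball x r. ennreal (norm (f y)) \<partial>M) / emeasure M (ball x r))"
      using r by (intro SUP_upper2[of "(x, r)"]) (auto simp: balls_D_def)
    also have "\<dots> \<le> BMO_norm M \<rho> f" by (simp add: BMO_norm_def)
    also note norm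
    finally show ?thesis using r N by (simp add: average_le_iff mean_le_def)
  qed
  have "mean_le (\<lambda>y. f y - ball_avg M (ball x r) f) x r (2 * N)" if r: "0 < r" for x r
  proof (cases "r < \<rho> x")
    case True
    then show ?thesis using small[OF r True] N by (auto intro: mean_le_mono)
  next
    case False
    then have m: "mean_le (\<lambda>y. f y - 0) x r N" using large[OF r] by simp
    have "norm (ball_avg M (ball x r) f - 0) \<le> N" by (rule norm_ball_avg_diff_le[OF f r m N])
    then have "mean_le (\<lambda>y. f y - ball_avg M (ball x r) f) x r (N + N)"
      by (intro mean_le_shift[OF L1_loc_measurable[OF f] m _ N]) simp
    then show ?thesis by simp
  qed
  moreover have "mean_le f x r (2 * N)" if "0 < r" "\<rho> x \<le> r" for x r
    using mean_le_mono[OF large[OF that], of "2 * N"] N by simp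
  ultimately show ?thesis using f by (simp add: bmo_le_def osc_le_def)
qed

lemma bmo_le_mean_le:
  assumes f: "bmo_le \<rho> f b" and b: "0 \<le> b" and s: "0 < s" "\<rho> z \<le> s" "dist z x \<le> s"
  shows "mean_le f x s (A ^ 2 * b)"
proof (rule mean_le_subset)
  show "mean_le f z (2 * s) b" using f s by (simp add: bmo_le_def)
  show "ball x s \<subseteq> ball z (2 * s)"
  proof
    fix y assume "y \<in> ball x s"
    then show "y \<in> ball z (2 * s)" using s dist_triangle[of z y x] by simp
  qed
  show "V z (2 * s) \<le> A ^ 2 * V x s" using s by (intro V_le_of_dist) (auto simp: dist_commute)
qed (rule b)

text \<open>
  At radius \<open>\<rho> z\<close> the mean itself is bounded; from there to radius \<open>t\<close> it grows at most logarithmically.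
\<close>

lemma ball_avg_powr_bound:
  assumes f: "bmo_le \<rho> f b" and b: "0 \<le> b" and t: "0 < t" "t \<le> \<rho> z" and d: "0 < d"
  shows "norm (ball_avg M (ball z t) f) \<le> 4 * A ^ 4 * (1 + 1 / (d * ln 2)) * b * (\<rho> z / t) powr d"
proof -
  have osc: "osc_le f b" and fL: "f \<in> L1_loc M" using f by (auto simp: bmo_le_def osc_le_def)
  let ?l = "1 + log 2 (\<rho> z / t)"
  have l: "1 \<le> ?l" using t by simp
  have r: "0 < \<rho> z" using t by simp
  have A4: "1 \<le> A ^ 4" by (rule one_le_power[OF A_ge_1])
  have "norm (ball_avg M (ball z (\<rho> z)) f - 0) \<le> b"
    using f r b by (intro norm_ball_avg_diff_le fL) (auto simp: bmo_le_def)
  moreover have "norm (ball_avg M (ball z (\<rho> z)) f - ball_avg M (ball z t) f) \<le> 3 * A ^ 4 * b * ?l"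
    using r b t l A_ge_1
    by (intro norm_ball_avg_diff_le fL mean_le_log_growth[OF osc]) auto
  ultimately have "norm (ball_avg M (ball z t) f) \<le> b + 3 * A ^ 4 * b * ?l"
    using norm_triangle_ineq4[of "ball_avg M (ball z (\<rho> z)) f"
        "ball_avg M (ball z (\<rho> z)) f - ball_avg M (ball z t) f"] by simp
  also have "\<dots> \<le> A ^ 4 * b * ?l + 3 * A ^ 4 * b * ?l"
  proof -
    have "1 * b * 1 \<le> A ^ 4 * b * ?l" using A4 b l by (intro mult_mono) auto
    then show ?thesis by (simp only: mult_1 mult_1_right add_right_mono)
  qed
  also have "\<dots> = 4 * A ^ 4 * b * ?l" by simp
  also have "\<dots> \<le> 4 * A ^ 4 * b * ((1 + 1 / (d * ln 2)) * (\<rho> z / t) powr d)"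
    using b A4 t d by (intro mult_left_mono one_plus_log_le_powr) auto
  finally show ?thesis by (simp add: mult_ac)
qed

section \<open>Kernels with polynomial decay\<close>

text \<open>
  The majorant shared by the size and smoothness conditions on \<open>Q\<^sub>t(x, y)\<close>.
\<close>

definition decay_kernel :: "real \<Rightarrow> real \<Rightarrow> 'a \<Rightarrow> 'a \<Rightarrow> real" where
  "decay_kernel g t x y = 1 / (V x t + V x (dist x y)) * (t / (t + dist x y)) powr g"

lemma decay_kernel_nonneg: "0 \<le> decay_kernel g t x y"
  by (simp add: decay_kernel_def)

text \<open>
  The value \<open>1 / (1 - q)\<^sup>2\<close> is that of the series of all \<open>(j+1) q\<^sup>j\<close> with \<open>q = 2\<^sup>-\<^sup>g\<close>, which comes from integrating the kernel
  against functions with means of linear growth in the number \<open>j\<close> of doublings.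
\<close>

definition kernel_const :: "real \<Rightarrow> real" where
  "kernel_const g = A * 2 powr g / (1 - 2 powr - g)\<^sup>2"

lemma kernel_const_pos: "0 < g \<Longrightarrow> 0 < kernel_const g"
proof -
  assume "0 < g"
  then have "2 powr - g < 2 powr (0::real)" by (intro powr_less_mono) auto
  then have "0 < (1 - 2 powr - g)\<^sup>2" by (intro zero_less_power) simp
  then show ?thesis using A_ge_1 unfolding kernel_const_def by (intro divide_pos_pos mult_pos_pos) auto
qed

text \<open>
  On the dyadic annulus \<open>2\<^sup>j\<^sup>-\<^sup>1t \<le> d(x,y) < 2\<^sup>jt\<close> the kernel is at most a multiple of \<open>2\<^sup>-\<^sup>j\<^sup>g / V(x,2\<^sup>jt)\<close>, by
  the doubling property.
\<close>

lemma decay_kernel_le_layers: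
  assumes g: "0 < g" and t: "0 < t"
  shows "ennreal (decay_kernel g t x y)
    \<le> (\<Sum>j. ennreal (A * 2 powr g * (2 powr - g) ^ j / V x (2 ^ j * t)) * indicator (ball x (2 ^ j * t)) y)"
    (is "_ \<le> (\<Sum>j. ?F j)")
proof -
  have A0: "0 < A" using A_ge_1 by simp
  have "\<exists>j. dist x y < 2 ^ j * t \<and> decay_kernel g t x y \<le> A * 2 powr g * (2 powr - g) ^ j / V x (2 ^ j * t)"
  proof (cases "dist x y < t")
    case True
    have "t / (t + dist x y) \<le> 1" using t by (subst divide_le_eq_1_pos) (auto intro: add_pos_nonneg)
    then have "(t / (t + dist x y)) powr g \<le> 1" using t g by (intro powr_le1) auto
    moreover have "1 / (V x t + V x (dist x y)) \<le> 1 / V x t"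
      using V_pos[OF t, of x] by (intro divide_left_mono) (auto intro!: mult_pos_pos add_pos_nonneg)
    ultimately have "decay_kernel g t x y \<le> 1 / V x t * 1"
      unfolding decay_kernel_def by (intro mult_mono) auto
    also have "\<dots> \<le> A * 2 powr g / V x t"
    proof -
      have "1 * 1 \<le> A * 2 powr g" using A_ge_1 g by (intro mult_mono ge_one_powr_ge_zero) auto
      then show ?thesis using V_pos[OF t, of x] by (simp add: divide_right_mono)
    qed
    finally show ?thesis using True by (intro exI[of _ 0]) simp
  next
    case False
    obtain n where "dist x y / t < 2 ^ n" using real_arch_pow[of 2 "dist x y / t"] by auto
    then have ex: "dist x y < 2 ^ n * t" using t by (simp add: field_simps)
    define j where "j = (LEAST j. dist x y < 2 ^ j * t)"
    have j: "dist x y < 2 ^ j * t" unfolding j_def using ex by (rule LeastI)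
    then have "j \<noteq> 0" using False by (intro notI) simp
    then obtain i where i: "j = Suc i" by (cases j) auto
    have "\<not> dist x y < 2 ^ i * t" using not_less_Least[of i "\<lambda>j. dist x y < 2 ^ j * t"] i by (simp add: j_def)
    then have di: "2 ^ i * t \<le> dist x y" by simp
    have it: "0 < 2 ^ i * t" using t by simp
    have "t / (t + dist x y) \<le> t / (2 ^ i * t)"
      using di t it by (intro divide_left_mono) (auto intro!: mult_pos_pos add_pos_nonneg)
    also have "\<dots> = 2 powr - real i" using t by (simp add: powr_minus powr_realpow field_simps)
    finally have "(t / (t + dist x y)) powr g \<le> (2 powr - real i) powr g"
      using t g by (intro powr_mono2) auto
    also have "\<dots> = (2 powr - g) powr real i" by (simp add: powr_powr mult.commute)
    also have "\<dots> = (2 powr - g) ^ i" by (simp add: powr_realpow)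
    finally have 1: "(t / (t + dist x y)) powr g \<le> (2 powr - g) ^ i" .
    have "V x (2 ^ j * t) \<le> A * V x (2 ^ i * t)" using doubling[OF it, of x] by (simp add: i mult.assoc)
    also have "\<dots> \<le> A * (V x t + V x (dist x y))"
      using A0 V_mono_radius[OF di, of x] V_pos[OF t, of x] by (intro mult_left_mono) auto
    finally have "1 / (V x t + V x (dist x y)) \<le> A / V x (2 ^ j * t)"
      using V_pos[of "2 ^ j * t" x] V_pos[OF t, of x] t by (simp add: divide_simps add_pos_nonneg)
    then have "decay_kernel g t x y \<le> A / V x (2 ^ j * t) * (2 powr - g) ^ i"
      unfolding decay_kernel_def using 1 A0 by (intro mult_mono) auto
    also have "(2 powr - g) ^ i = 2 powr g * (2 powr - g) ^ j"
      by (simp add: i powr_minus)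
    finally show ?thesis using j by (intro exI[of _ j]) (simp add: mult_ac)
  qed
  then obtain j where j: "y \<in> ball x (2 ^ j * t)"
    "decay_kernel g t x y \<le> A * 2 powr g * (2 powr - g) ^ j / V x (2 ^ j * t)" by auto
  have "ennreal (decay_kernel g t x y) \<le> ?F j" using j by (simp add: ennreal_leI)
  also have "\<dots> \<le> (\<Sum>j. ?F j)" by (rule term_le_suminf)
  finally show ?thesis .
qed

text \<open>
  All integrals against the kernel are estimated by this lemma: only the means over the balls of radius \<open>2\<^sup>jt\<close> matter,
  and they may grow linearly in \<open>j\<close>.
\<close>

lemma kernel_integral_le:
  assumes g: "0 < g" and t: "0 < t" and a: "0 \<le> a" and h [measurable]: "h \<in> borel_measurable M"
    and mean: "\<And>j. mean_le h x (2 ^ j * t) (real (Suc j) * a)"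
  shows "(\<integral>\<^sup>+y. ennreal (decay_kernel g t x y * norm (h y)) \<partial>M) \<le> ennreal (kernel_const g * a)"
proof -
  have A0: "0 < A" using A_ge_1 by simp
  define c where "c j = A * 2 powr g * (2 powr - g) ^ j" for j
  have c: "0 < c j" for j using A0 by (simp add: c_def)
  have Vp: "0 < V x (2 ^ j * t)" for j using t by (intro V_pos) simp
  have "(\<integral>\<^sup>+y. ennreal (decay_kernel g t x y * norm (h y)) \<partial>M)
    \<le> (\<integral>\<^sup>+y. (\<Sum>j. ennreal (c j / V x (2 ^ j * t)) * (ennreal (norm (h y)) * indicator (ball x (2 ^ j * t)) y)) \<partial>M)"
  proof (rule nn_integral_mono)
    fix y
    have "ennreal (decay_kernel g t x y * norm (h y)) = ennreal (norm (h y)) * ennreal (decay_kernel g t x y)"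
      by (subst ennreal_mult'') (auto simp: mult.commute)
    also have "\<dots> \<le> ennreal (norm (h y)) * (\<Sum>j. ennreal (c j / V x (2 ^ j * t)) * indicator (ball x (2 ^ j * t)) y)"
      unfolding c_def by (intro mult_left_mono decay_kernel_le_layers g t) auto
    also have "\<dots> = (\<Sum>j. ennreal (c j / V x (2 ^ j * t)) * (ennreal (norm (h y)) * indicator (ball x (2 ^ j * t)) y))"
      by (subst ennreal_suminf_cmult[symmetric]) (simp add: mult_ac)
    finally show "ennreal (decay_kernel g t x y * norm (h y))
      \<le> (\<Sum>j. ennreal (c j / V x (2 ^ j * t)) * (ennreal (norm (h y)) * indicator (ball x (2 ^ j * t)) y))" .
  qed
  also have "\<dots> = (\<Sum>j. ennreal (c j / V x (2 ^ j * t)) * (\<integral>\<^sup>+y\<in>ball x (2 ^ j * t). ennreal (norm (h y)) \<partial>M))"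
    by (subst nn_integral_suminf) (auto simp: nn_integral_cmult)
  also have "\<dots> \<le> (\<Sum>j. ennreal (A * 2 powr g * a * (real (Suc j) * (2 powr - g) ^ j)))"
  proof (rule suminf_le)
    fix j
    have "ennreal (c j / V x (2 ^ j * t)) * (\<integral>\<^sup>+y\<in>ball x (2 ^ j * t). ennreal (norm (h y)) \<partial>M)
      \<le> ennreal (c j / V x (2 ^ j * t)) * ennreal (real (Suc j) * a * V x (2 ^ j * t))"
      using mean by (intro mult_left_mono) (auto simp: mean_le_def)
    also have "\<dots> = ennreal (c j / V x (2 ^ j * t) * (real (Suc j) * a * V x (2 ^ j * t)))"
      using less_imp_le[OF c] a by (intro ennreal_mult[symmetric]) auto
    also have "c j / V x (2 ^ j * t) * (real (Suc j) * a * V x (2 ^ j * t))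
        = A * 2 powr g * a * (real (Suc j) * (2 powr - g) ^ j)"
      using Vp[of j] by (simp add: c_def)
    finally show "ennreal (c j / V x (2 ^ j * t)) * (\<integral>\<^sup>+y\<in>ball x (2 ^ j * t). ennreal (norm (h y)) \<partial>M)
      \<le> ennreal (A * 2 powr g * a * (real (Suc j) * (2 powr - g) ^ j))" .
  qed auto
  also have "\<dots> = ennreal (A * 2 powr g * a * (1 / (1 - 2 powr - g)\<^sup>2))"
  proof (rule suminf_ennreal_eq)
    have "2 powr - g < 2 powr (0::real)" using g by (intro powr_less_mono) auto
    then have "(\<lambda>j. of_nat (Suc j) * (2 powr - g) ^ j) sums (1 / (1 - 2 powr - g)\<^sup>2)"
      by (intro geometric_deriv_sums) auto
    then show "(\<lambda>j. A * 2 powr g * a * (real (Suc j) * (2 powr - g) ^ j)) sums (A * 2 powr g * a * (1 / (1 - 2 powr - g)\<^sup>2))"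
      by (intro sums_mult)
  qed (use A0 a in auto)
  also have "A * 2 powr g * a * (1 / (1 - 2 powr - g)\<^sup>2) = kernel_const g * a"
    by (simp add: kernel_const_def)
  finally show ?thesis .
qed

lemma decay_kernel_far:
  assumes "0 < g" "0 < t" "0 < r" "r \<le> dist x y"
  shows "decay_kernel g t x y \<le> (t / r) powr (g / 2) * decay_kernel (g / 2) t x y"
proof -
  let ?q = "t / (t + dist x y)"
  have q: "0 < ?q" using assms by (intro divide_pos_pos add_pos_nonneg) auto
  have "?q \<le> t / r" using assms by (intro divide_left_mono) (auto intro!: mult_pos_pos add_pos_nonneg)
  then have "?q powr (g / 2) \<le> (t / r) powr (g / 2)" using q assms by (intro powr_mono2) auto
  then have "?q powr (g / 2) * ?q powr (g / 2) \<le> (t / r) powr (g / 2) * ?q powr (g / 2)"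
    by (intro mult_right_mono) auto
  then have "?q powr g \<le> (t / r) powr (g / 2) * ?q powr (g / 2)"
    by (simp add: powr_add[symmetric])
  then have "1 / (V x t + V x (dist x y)) * ?q powr g
      \<le> 1 / (V x t + V x (dist x y)) * ((t / r) powr (g / 2) * ?q powr (g / 2))"
    by (intro mult_left_mono) auto
  then show ?thesis by (simp add: decay_kernel_def mult_ac)
qed

text \<open>
  At distance at least \<open>r\<close>, half of the decay of the kernel is already worth \<open>(t / r)\<^sup>g\<^sup>/\<^sup>2\<close>; the other half keeps
  the sum over the annuli convergent.
\<close>

lemma kernel_integral_far_le:
  assumes g: "0 < g" and t: "0 < t" and r: "0 < r" and a: "0 \<le> a" and h [measurable]: "h \<in> borel_measurable M"
    and mean: "\<And>j. mean_le h x (2 ^ j * t) (real (Suc j) * a)"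
    and far: "\<And>y. dist x y < r \<Longrightarrow> h y = 0"
  shows "(\<integral>\<^sup>+y. ennreal (decay_kernel g t x y * norm (h y)) \<partial>M)
    \<le> ennreal ((t / r) powr (g / 2) * kernel_const (g / 2) * a)"
proof -
  have "(\<integral>\<^sup>+y. ennreal (decay_kernel g t x y * norm (h y)) \<partial>M)
    \<le> (\<integral>\<^sup>+y. ennreal (decay_kernel (g / 2) t x y * norm ((t / r) powr (g / 2) *\<^sub>R h y)) \<partial>M)"
  proof (intro nn_integral_mono ennreal_leI)
    fix y
    show "decay_kernel g t x y * norm (h y) \<le> decay_kernel (g / 2) t x y * norm ((t / r) powr (g / 2) *\<^sub>R h y)"
    proof (cases "dist x y < r")
      case False
      then have "decay_kernel g t x y * norm (h y) \<le> (t / r) powr (g / 2) * decay_kernel (g / 2) t x y * norm (h y)"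
        using g t r by (intro mult_right_mono decay_kernel_far) auto
      then show ?thesis by (simp add: mult_ac)
    qed (simp add: far)
  qed
  also have "\<dots> \<le> ennreal (kernel_const (g / 2) * ((t / r) powr (g / 2) * a))"
  proof (rule kernel_integral_le)
    fix j
    have "(\<integral>\<^sup>+y\<in>ball x (2 ^ j * t). ennreal (norm ((t / r) powr (g / 2) *\<^sub>R h y)) \<partial>M)
      = ennreal ((t / r) powr (g / 2)) * (\<integral>\<^sup>+y\<in>ball x (2 ^ j * t). ennreal (norm (h y)) \<partial>M)"
      by (subst nn_integral_cmult[symmetric]) (auto simp: ennreal_mult mult_ac)
    also have "\<dots> \<le> ennreal ((t / r) powr (g / 2)) * ennreal (real (Suc j) * a * V x (2 ^ j * t))"
      using mean[of j] by (intro mult_left_mono) (auto simp: mean_le_def)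
    also have "\<dots> = ennreal ((t / r) powr (g / 2) * (real (Suc j) * a * V x (2 ^ j * t)))"
      using a by (intro ennreal_mult[symmetric]) auto
    finally show "mean_le (\<lambda>y. (t / r) powr (g / 2) *\<^sub>R h y) x (2 ^ j * t) (real (Suc j) * ((t / r) powr (g / 2) * a))"
      unfolding mean_le_def by (simp only: mult_ac)
  qed (use g t a in auto)
  finally show ?thesis by (simp only: mult_ac)
qed

lemma integral_decay_bound:
  fixes k h :: "'a \<Rightarrow> complex"
  assumes [measurable]: "k \<in> borel_measurable M" "h \<in> borel_measurable M"
    and k: "\<And>y. norm (k y) \<le> c * decay_kernel g t x y" and c: "0 \<le> c" and b: "0 \<le> b"
    and int: "(\<integral>\<^sup>+y. ennreal (decay_kernel g t x y * norm (h y)) \<partial>M) \<le> ennreal b"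
  shows "integrable M (\<lambda>y. k y * h y)" "norm (LINT y|M. k y * h y) \<le> c * b"
proof -
  have "(\<integral>\<^sup>+y. ennreal (norm (k y * h y)) \<partial>M) \<le> (\<integral>\<^sup>+y. ennreal c * ennreal (decay_kernel g t x y * norm (h y)) \<partial>M)"
  proof (rule nn_integral_mono)
    fix y
    have "norm (k y * h y) \<le> c * decay_kernel g t x y * norm (h y)"
      unfolding norm_mult by (intro mult_right_mono k) auto
    then show "ennreal (norm (k y * h y)) \<le> ennreal c * ennreal (decay_kernel g t x y * norm (h y))"
      using c decay_kernel_nonneg[of g t x y] by (simp add: ennreal_mult[symmetric] mult.assoc ennreal_leI)
  qed
  also have "\<dots> = ennreal c * (\<integral>\<^sup>+y. ennreal (decay_kernel g t x y * norm (h y)) \<partial>M)"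
  proof (rule nn_integral_cmult)
    have [measurable]: "(\<lambda>y. dist x y) \<in> borel_measurable M"
      by (subst measurable_cong_sets[OF sets_M refl]) (intro borel_measurable_continuous_onI continuous_intros)
    have "(\<lambda>s. V x s) \<in> borel_measurable borel"
      by (intro borel_measurable_mono monoI V_mono_radius)
    from measurable_compose[OF \<open>(\<lambda>y. dist x y) \<in> borel_measurable M\<close> this]
    have [measurable]: "(\<lambda>y. V x (dist x y)) \<in> borel_measurable M" .
    show "(\<lambda>y. ennreal (decay_kernel g t x y * norm (h y))) \<in> borel_measurable M"
      unfolding decay_kernel_def by measurable
  qed
  also have "\<dots> \<le> ennreal c * ennreal b" using int by (intro mult_left_mono) auto
  also have "\<dots> = ennreal (c * b)" using c b by (simp add: ennreal_mult)
  finally have fin: "(\<integral>\<^sup>+y. ennreal (norm (k y * h y)) \<partial>M) \<le> ennreal (c * b)" .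
  show *: "integrable M (\<lambda>y. k y * h y)"
    by (rule integrableI_bounded) (use fin in \<open>auto intro: le_less_trans\<close>)
  show "norm (LINT y|M. k y * h y) \<le> c * b"
    using order_trans[OF integral_norm_bound_ennreal[OF *] fin] c b by (simp add: ennreal_le_iff)
qed

end

section \<open>The square function and its kernel\<close>

locale localized_square_function = doubling_space M A
  for M :: "'a::metric_space measure" and A :: real +
  fixes \<rho> :: "'a \<Rightarrow> real" and Q :: "real \<Rightarrow> 'a \<Rightarrow> 'a \<Rightarrow> complex" and C1 \<delta>1 \<beta> \<delta>2 \<gamma> :: real
  assumes adm: "admissible \<rho>"
    and Q_measurable: "jointly_measurable_kernel M Q"
    and C1: "0 < C1" and \<delta>1: "0 < \<delta>1" and \<beta>: "0 < \<beta>" and \<delta>2: "0 < \<delta>2" and \<gamma>: "0 < \<gamma>"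
    and Q_size: "\<And>t x y. 0 < t \<Longrightarrow>
      norm (Q t x y) \<le> C1 * decay_kernel \<gamma> t x y * (\<rho> x / (t + \<rho> x)) powr \<delta>1"
    and Q_smooth: "\<And>t x x' y. 0 < t \<Longrightarrow> dist x x' \<le> t / 2 \<Longrightarrow>
      norm (Q t x y - Q t x' y) \<le> C1 * (dist x x' / (t + dist x y)) powr \<beta> * decay_kernel \<gamma> t x y"
    and Q_cancel: "\<And>t x. 0 < t \<Longrightarrow> norm (LINT y|M. Q t x y) \<le> C1 * (t / (t + \<rho> x)) powr \<delta>2"
    and g_bounded: "L2_bounded_nonneg M (g_function M Q)"

begin

sublocale sigma_finite_measure M by (rule sigma_finite)

lemma \<rho>_pos: "0 < \<rho> x"
  using adm by (simp add: admissible_def)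

lemma \<rho>_factor_le_1: "0 < t \<Longrightarrow> (\<rho> x / (t + \<rho> x)) powr \<delta>1 \<le> 1"
  using \<rho>_pos[of x] \<delta>1 by (intro powr_le1) auto

lemma Q_size': "0 < t \<Longrightarrow> norm (Q t x y) \<le> C1 * decay_kernel \<gamma> t x y"
proof -
  assume t: "0 < t"
  have "0 \<le> C1 * decay_kernel \<gamma> t x y" using C1 decay_kernel_nonneg[of \<gamma> t x y] by simp
  from mult_left_mono[OF \<rho>_factor_le_1[OF t, of x] this] Q_size[OF t, of x y] show ?thesis by simp
qed

text \<open>
  The kernel is measurable only for \<open>t > 0\<close>. Replacing the parameters \<open>t \<le> 0\<close> by \<open>1\<close> makes it measurable on a
  product of \<open>\<sigma>\<close>-finite spaces, without changing anything on the scales \<open>t > 0\<close> that are integrated over.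
\<close>

lemma joint_measurable:
  "(\<lambda>p. Q (if 0 < fst (fst p) then fst (fst p) else 1) (snd (fst p)) (snd p))
    \<in> borel_measurable ((borel \<Otimes>\<^sub>M M) \<Otimes>\<^sub>M M)"
proof -
  have Q: "(\<lambda>(t, x, y). Q t x y) \<in> borel_measurable (restrict_space borel {0<..} \<Otimes>\<^sub>M (M \<Otimes>\<^sub>M M))"
    using Q_measurable by (simp add: jointly_measurable_kernel_def)
  have \<tau>: "(\<lambda>t::real. if 0 < t then t else 1) \<in> measurable borel (restrict_space borel {0<..})"
    by (rule measurable_restrict_space2) auto
  have "(\<lambda>p. fst (fst p)) \<in> borel_measurable ((borel \<Otimes>\<^sub>M M) \<Otimes>\<^sub>M M)" by measurable
  note 1 = measurable_compose[OF this \<tau>]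
  have 2: "(\<lambda>p. snd (fst p)) \<in> measurable ((borel \<Otimes>\<^sub>M M) \<Otimes>\<^sub>M M) M"
    and 3: "snd \<in> measurable ((borel \<Otimes>\<^sub>M M) \<Otimes>\<^sub>M M) M" by measurable
  from measurable_Pair[OF 1 measurable_Pair[OF 2 3]]
  have "(\<lambda>p. ((if 0 < fst (fst p) then fst (fst p) else 1), snd (fst p), snd p))
    \<in> measurable ((borel \<Otimes>\<^sub>M M) \<Otimes>\<^sub>M M) (restrict_space (borel :: real measure) {0<..} \<Otimes>\<^sub>M (M \<Otimes>\<^sub>M M))"
    .
  from measurable_compose[OF this Q] show ?thesis by simp
qed

lemma Q_measurable_snd [measurable]:
  assumes "0 < t" shows "Q t x \<in> borel_measurable M"
proof -
  have "(\<lambda>y. ((t, x), y)) \<in> measurable M ((borel \<Otimes>\<^sub>M M) \<Otimes>\<^sub>M M)" by measurable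
  from measurable_compose[OF this joint_measurable] show ?thesis using assms by simp
qed

lemma kernel_op_measurable:
  assumes f: "f \<in> borel_measurable M"
  shows "(\<lambda>(t, x). kernel_op M (Q (if 0 < t then t else 1)) f x) \<in> borel_measurable (borel \<Otimes>\<^sub>M M)"
proof -
  have "(\<lambda>p. Q (if 0 < fst (fst p) then fst (fst p) else 1) (snd (fst p)) (snd p) * f (snd p))
      \<in> borel_measurable ((borel \<Otimes>\<^sub>M M) \<Otimes>\<^sub>M M)"
    by (intro borel_measurable_times joint_measurable measurable_compose[OF measurable_snd f])
  then have "(\<lambda>p. LINT y|M. Q (if 0 < fst p then fst p else 1) (snd p) y * f y) \<in> borel_measurable (borel \<Otimes>\<^sub>M M)"
    by (intro borel_measurable_lebesgue_integral) (simp add: split_beta')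
  then show ?thesis by (simp add: kernel_op_def split_beta')
qed

text \<open>
  The square of the square function, restricted to the scales in \<open>S\<close>.
\<close>

definition sq_part :: "real set \<Rightarrow> ('a \<Rightarrow> complex) \<Rightarrow> 'a \<Rightarrow> ennreal" where
  "sq_part S f x = (\<integral>\<^sup>+t\<in>S. ennreal ((norm (kernel_op M (Q t) f x))\<^sup>2 / t) \<partial>lborel)"

lemma g_function_power2: "(g_function M Q f x)\<^sup>2 = sq_part {0<..} f x"
  by (simp add: g_function_def sq_part_def ennsqrt_power2)

lemma integrand_measurable:
  assumes [measurable]: "f \<in> borel_measurable M" "S \<in> sets borel" and S: "S \<subseteq> {0<..}"
  shows "(\<lambda>(x, t). ennreal ((norm (kernel_op M (Q t) f x))\<^sup>2 / t) * indicator S t) \<in> borel_measurable (M \<Otimes>\<^sub>M borel)"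
proof -
  note kernel_op_measurable[OF assms(1), measurable]
  have "(\<lambda>(x, t). ennreal ((norm (case (t, x) of (t, x) \<Rightarrow> kernel_op M (Q (if 0 < t then t else 1)) f x))\<^sup>2 / t) * indicator S t)
    \<in> borel_measurable (M \<Otimes>\<^sub>M borel)"
    by measurable
  also have "(\<lambda>(x, t). ennreal ((norm (case (t, x) of (t, x) \<Rightarrow> kernel_op M (Q (if 0 < t then t else 1)) f x))\<^sup>2 / t) * indicator S t)
    = (\<lambda>(x, t). ennreal ((norm (kernel_op M (Q t) f x))\<^sup>2 / t) * indicator S t)"
    using S by (auto simp: fun_eq_iff indicator_def)
  finally show ?thesis .
qed

lemma integrand_measurable_t:
  assumes "f \<in> borel_measurable M" "S \<in> sets borel" "S \<subseteq> {0<..}"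
  shows "(\<lambda>t. ennreal ((norm (kernel_op M (Q t) f x))\<^sup>2 / t) * indicator S t) \<in> borel_measurable lborel"
proof -
  have "(\<lambda>t. (x, t)) \<in> measurable borel (M \<Otimes>\<^sub>M borel)" by measurable
  from measurable_compose[OF this integrand_measurable[OF assms]] show ?thesis by simp
qed

lemma sq_part_measurable:
  assumes "f \<in> borel_measurable M" "S \<in> sets borel" "S \<subseteq> {0<..}"
  shows "sq_part S f \<in> borel_measurable M"
  unfolding sq_part_def[abs_def]
  using integrand_measurable[OF assms] by (intro lborel.borel_measurable_nn_integral) simp

lemma sq_part_split:
  assumes "f \<in> borel_measurable M" "0 \<le> R"
  shows "sq_part {0<..} f x = sq_part {0<..R} f x + sq_part {R<..} f x"
proof -
  have "sq_part {0<..R} f x + sq_part {R<..} f x =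
    (\<integral>\<^sup>+t. ennreal ((norm (kernel_op M (Q t) f x))\<^sup>2 / t) * indicator {0<..R} t
         + ennreal ((norm (kernel_op M (Q t) f x))\<^sup>2 / t) * indicator {R<..} t \<partial>lborel)"
    unfolding sq_part_def using assms
    by (intro nn_integral_add[symmetric] integrand_measurable_t) auto
  also have "\<dots> = sq_part {0<..} f x"
    unfolding sq_part_def using assms by (intro nn_integral_cong) (auto simp: indicator_def)
  finally show ?thesis by simp
qed

lemma sq_part_mono: "S \<subseteq> T \<Longrightarrow> sq_part S f x \<le> sq_part T f x"
  unfolding sq_part_def by (intro nn_integral_mono) (auto simp: indicator_def)

lemma g_L2_bound:
  obtains K :: real where "0 \<le> K" "\<And>f :: 'a \<Rightarrow> complex. f \<in> borel_measurable M \<Longrightarrow> (\<integral>\<^sup>+x. ennreal ((norm (f x))\<^sup>2) \<partial>M) < \<infinity> \<Longrightarrow>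
    (\<integral>\<^sup>+x. sq_part {0<..} f x \<partial>M) \<le> ennreal (K\<^sup>2) * (\<integral>\<^sup>+x. ennreal ((norm (f x))\<^sup>2) \<partial>M)"
proof -
  obtain K :: real where K: "0 \<le> K" "\<And>f. f \<in> L2_space M \<Longrightarrow>
      L2_norm M (g_function M Q f) \<le> ennreal K * L2_norm M (\<lambda>x. ennreal (norm (f x)))"
    using g_bounded by (auto simp: L2_bounded_nonneg_def)
  show thesis
  proof
    fix f :: "'a \<Rightarrow> complex"
    assume f: "f \<in> borel_measurable M" and fin: "(\<integral>\<^sup>+x. ennreal ((norm (f x))\<^sup>2) \<partial>M) < \<infinity>"
    have eq: "(L2_norm M (\<lambda>x. ennreal (norm (f x))))\<^sup>2 = (\<integral>\<^sup>+x. ennreal ((norm (f x))\<^sup>2) \<partial>M)"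
      by (simp add: L2_norm_power2 ennreal_power)
    have "L2_norm M (\<lambda>x. ennreal (norm (f x))) < \<infinity>"
    proof (rule ccontr)
      assume "\<not> ?thesis"
      then have "L2_norm M (\<lambda>x. ennreal (norm (f x))) = top" by (simp add: not_less top_unique)
      then show False using fin unfolding eq[symmetric] by (simp add: power2_eq_square ennreal_top_mult)
    qed
    then have "f \<in> L2_space M" using f by (simp add: L2_space_def)
    then have "(L2_norm M (g_function M Q f))\<^sup>2 \<le> (ennreal K * L2_norm M (\<lambda>x. ennreal (norm (f x))))\<^sup>2"
      by (intro power_mono K) auto
    then show "(\<integral>\<^sup>+x. sq_part {0<..} f x \<partial>M) \<le> ennreal (K\<^sup>2) * (\<integral>\<^sup>+x. ennreal ((norm (f x))\<^sup>2) \<partial>M)"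
      using K(1) by (simp add: power_mult_distrib eq L2_norm_power2 g_function_power2 ennreal_power)
  qed (rule K(1))
qed

lemma kernel_op_bound:
  assumes t: "0 < t" and a: "0 \<le> a" and h: "h \<in> borel_measurable M"
    and mean: "\<And>j. mean_le h x (2 ^ j * t) (real (Suc j) * a)"
  shows "integrable M (\<lambda>y. Q t x y * h y)"
    and "norm (kernel_op M (Q t) h x) \<le> C1 * kernel_const \<gamma> * (\<rho> x / (t + \<rho> x)) powr \<delta>1 * a"
    and "\<And>x'. dist x x' \<le> t / 2 \<Longrightarrow>
      norm (LINT y|M. (Q t x y - Q t x' y) * h y) \<le> C1 * kernel_const \<gamma> * (dist x x' / t) powr \<beta> * a"
proof -
  note bnd = kernel_integral_le[OF \<gamma> t a h mean]
  have c: "0 \<le> C1 * (\<rho> x / (t + \<rho> x)) powr \<delta>1" and c': "0 \<le> C1 * (dist x x' / t) powr \<beta>" for x'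
    using C1 by auto
  have b: "0 \<le> kernel_const \<gamma> * a" using kernel_const_pos[OF \<gamma>] a by simp
  have sz: "norm (Q t x y) \<le> C1 * (\<rho> x / (t + \<rho> x)) powr \<delta>1 * decay_kernel \<gamma> t x y" for y
    using Q_size[OF t, of x y] by (simp add: mult_ac)
  note * = integral_decay_bound[OF Q_measurable_snd[OF t] h sz c b bnd]
  show "integrable M (\<lambda>y. Q t x y * h y)" by (rule *(1))
  show "norm (kernel_op M (Q t) h x) \<le> C1 * kernel_const \<gamma> * (\<rho> x / (t + \<rho> x)) powr \<delta>1 * a"
    using *(2) by (simp add: kernel_op_def mult_ac)
  fix x' assume d: "dist x x' \<le> t / 2"
  have sm: "norm (Q t x y - Q t x' y) \<le> C1 * (dist x x' / t) powr \<beta> * decay_kernel \<gamma> t x y" for y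
  proof -
    have "dist x x' / (t + dist x y) \<le> dist x x' / t"
      using t by (intro divide_left_mono) (auto intro!: mult_pos_pos add_pos_nonneg)
    then have "(dist x x' / (t + dist x y)) powr \<beta> \<le> (dist x x' / t) powr \<beta>"
      using t \<beta> by (intro powr_mono2) auto
    then have "C1 * (dist x x' / (t + dist x y)) powr \<beta> * decay_kernel \<gamma> t x y
        \<le> C1 * (dist x x' / t) powr \<beta> * decay_kernel \<gamma> t x y"
      using C1 decay_kernel_nonneg by (intro mult_right_mono mult_left_mono) auto
    then show ?thesis using Q_smooth[OF t d, of y] by linarith
  qed
  have "(\<lambda>y. Q t x y - Q t x' y) \<in> borel_measurable M"
    by (intro borel_measurable_diff Q_measurable_snd t)
  from integral_decay_bound(2)[OF this h sm c' b bnd]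
  show "norm (LINT y|M. (Q t x y - Q t x' y) * h y) \<le> C1 * kernel_const \<gamma> * (dist x x' / t) powr \<beta> * a"
    by (simp add: mult_ac)
qed

lemma kernel_op_far_bound:
  assumes t: "0 < t" and a: "0 \<le> a" and r: "0 < r" and h: "h \<in> borel_measurable M"
    and mean: "\<And>j. mean_le h x (2 ^ j * t) (real (Suc j) * a)"
    and far: "\<And>y. dist x y < r \<Longrightarrow> h y = 0"
  shows "norm (kernel_op M (Q t) h x) \<le> C1 * kernel_const (\<gamma> / 2) * a * (t / r) powr (\<gamma> / 2)"
proof -
  have "norm (LINT y|M. Q t x y * h y) \<le> C1 * ((t / r) powr (\<gamma> / 2) * kernel_const (\<gamma> / 2) * a)"
    using kernel_const_pos[of "\<gamma> / 2"] \<gamma> a C1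
    by (intro integral_decay_bound(2)[OF Q_measurable_snd[OF t] h Q_size'[OF t] _ _
          kernel_integral_far_le[OF \<gamma> t r a h mean far]]) auto
  then show ?thesis by (simp add: kernel_op_def mult_ac)
qed

lemma Q_one:
  assumes t: "0 < t"
  shows "integrable M (Q t x)"
    and "dist x x' \<le> t / 2 \<Longrightarrow>
      norm ((LINT y|M. Q t x y) - (LINT y|M. Q t x' y)) \<le> C1 * kernel_const \<gamma> * (dist x x' / t) powr \<beta>"
proof -
  have "mean_le (\<lambda>_. 1 :: complex) x (2 ^ j * t) (real (Suc j) * 1)" for x :: 'a and j
    using mean_le_mono[OF mean_le_const[of "1::complex" x "2 ^ j * t"], of "real (Suc j) * 1"] by simp
  note b = kernel_op_bound[of t 1 "\<lambda>_. 1", OF t _ _ this]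
  show int: "integrable M (Q t x)" for x using b(1)[of x] by simp
  show "dist x x' \<le> t / 2 \<Longrightarrow>
      norm ((LINT y|M. Q t x y) - (LINT y|M. Q t x' y)) \<le> C1 * kernel_const \<gamma> * (dist x x' / t) powr \<beta>"
    using b(3)[of x x'] int by (simp add: Bochner_Integration.integral_diff)
qed

lemma osc_mean_le:
  assumes osc: "osc_le f b" and b: "0 \<le> b" and t: "0 < t" and d: "dist z x \<le> t"
  shows "mean_le (\<lambda>y. f y - ball_avg M (ball z t) f) x (2 ^ j * t) (real (Suc j) * (3 * A ^ 4 * b))"
proof -
  have "1 + log 2 (2 ^ j * t / t) = real (Suc j)" using t by (simp add: log_nat_power)
  moreover have "t \<le> 2 ^ j * t" using t by simp
  ultimately show ?thesis
    using mean_le_log_growth[OF osc b t d, of "2 ^ j * t"] by (simp add: mult_ac)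
qed

lemma osc_integrable:
  assumes osc: "osc_le f b" and b: "0 \<le> b" and t: "0 < t"
  shows "integrable M (\<lambda>y. Q t x y * f y)"
proof -
  let ?c = "ball_avg M (ball x t) f"
  have "f \<in> L1_loc M" using osc by (simp add: osc_le_def)
  then have [measurable]: "f \<in> borel_measurable M" by (rule L1_loc_measurable)
  have "integrable M (\<lambda>y. Q t x y * (f y - ?c))"
    using A_ge_1 b t by (intro kernel_op_bound(1)[OF t _ _ osc_mean_le[OF osc b t]]) auto
  moreover have "integrable M (\<lambda>y. Q t x y * ?c)" using Q_one(1)[OF t, of x] by simp
  ultimately have "integrable M (\<lambda>y. Q t x y * (f y - ?c) + Q t x y * ?c)" by (rule Bochner_Integration.integrable_add)
  then show ?thesis by (simp add: algebra_simps)
qed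

section \<open>Pointwise estimates and small scales\<close>

text \<open>
  The contribution of the scales \<open>t \<le> 4r\<close> on a ball of radius \<open>r\<close>. Write \<open>f = f1 + f2 + c\<close>, where \<open>f1\<close> is the part of
  \<open>f - c\<close> in the doubled ball and \<open>f2\<close> the part outside. For \<open>f1\<close> one uses the \<open>L\<^sup>2\<close> bound of the square
  function, for \<open>f2\<close> the decay of the kernel at distance \<open>r\<close>, and for \<open>c\<close> the second hypothesis. The constant \<open>c\<close> is left open
  because it is \<open>0\<close> on large balls and the mean of \<open>f\<close> on small ones.
\<close>

lemma near_estimate:
  assumes \<kappa>: "0 \<le> \<kappa>" and \<eta>: "0 < \<eta>"
  obtains C where "0 \<le> C"
    "\<And>f N z r c. 0 < N \<Longrightarrow> 0 < r \<Longrightarrow> osc_le f N \<Longrightarrow>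
      (\<And>x s. x \<in> ball z r \<Longrightarrow> r \<le> s \<Longrightarrow> mean_le (\<lambda>y. f y - c) x s (\<kappa> * N * (1 + log 2 (s / r)))) \<Longrightarrow>
      (\<And>x t. x \<in> ball z r \<Longrightarrow> 0 < t \<Longrightarrow> t \<le> 4 * r \<Longrightarrow>
          norm c * norm (LINT y|M. Q t x y) \<le> \<kappa> * N * (t / r) powr \<eta>) \<Longrightarrow>
      (\<integral>\<^sup>+x\<in>ball z r. sq_part {0<..4 * r} f x \<partial>M) \<le> ennreal (C * N\<^sup>2 * V z r)"
proof -
  obtain K :: real where K: "0 \<le> K" "\<And>f :: 'a \<Rightarrow> complex. f \<in> borel_measurable M \<Longrightarrow>
      (\<integral>\<^sup>+x. ennreal ((norm (f x))\<^sup>2) \<partial>M) < \<infinity> \<Longrightarrow>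
      (\<integral>\<^sup>+x. sq_part {0<..} f x \<partial>M) \<le> ennreal (K\<^sup>2) * (\<integral>\<^sup>+x. ennreal ((norm (f x))\<^sup>2) \<partial>M)"
    by (rule g_L2_bound) blast
  define E where "E = (4 * (64 * A ^ 11)\<^sup>2 + 8 * \<kappa>\<^sup>2) * A"
  define D where "D = C1 * kernel_const (\<gamma> / 2) * (3 * \<kappa>)"
  define C where "C = 3 * K\<^sup>2 * E + (3 * D\<^sup>2 * (4 powr \<gamma> / \<gamma>) + 3 * \<kappa>\<^sup>2 * (4 powr (2 * \<eta>) / (2 * \<eta>)))"
  have E0: "0 \<le> E" using A_ge_1 by (simp add: E_def)
  have C0: "0 \<le> C" using E0 \<gamma> \<eta> by (simp add: C_def)
  show thesis
  proof (rule that[OF C0])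
    fix f :: "'a \<Rightarrow> complex" and N r :: real and z c
    assume N: "0 < N" and r: "0 < r" and osc: "osc_le f N"
      and mean: "\<And>x s. x \<in> ball z r \<Longrightarrow> r \<le> s \<Longrightarrow> mean_le (\<lambda>y. f y - c) x s (\<kappa> * N * (1 + log 2 (s / r)))"
      and const: "\<And>x t. x \<in> ball z r \<Longrightarrow> 0 < t \<Longrightarrow> t \<le> 4 * r \<Longrightarrow>
          norm c * norm (LINT y|M. Q t x y) \<le> \<kappa> * N * (t / r) powr \<eta>"
    have f [measurable]: "f \<in> borel_measurable M" by (rule osc_le_measurable[OF osc])
    have fL: "f \<in> L1_loc M" using osc by (simp add: osc_le_def)
    define B where "B = ball z (2 * r)"
    have [measurable]: "B \<in> sets M" by (simp add: B_def)
    define f1 where "f1 y = (if y \<in> B then f y - c else 0)" for y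
    define f2 where "f2 y = (if y \<in> B then 0 else f y - c)" for y
    have f1 [measurable]: "f1 \<in> borel_measurable M" unfolding f1_def by measurable
    have f2 [measurable]: "f2 \<in> borel_measurable M" unfolding f2_def by measurable
    have f12: "f y = f1 y + f2 y + c" for y by (simp add: f1_def f2_def)
    have "mean_le (\<lambda>y. f y - c) z (2 * r) (2 * \<kappa> * N)" using mean[of z "2 * r"] r by (simp add: mult_ac)
    then have avg: "norm (ball_avg M (ball z (2 * r)) f - c) \<le> 2 * \<kappa> * N"
      using r \<kappa> N by (intro norm_ball_avg_diff_le fL) auto
    have "(\<integral>\<^sup>+y. ennreal ((norm (f1 y))\<^sup>2) \<partial>M) = (\<integral>\<^sup>+y\<in>ball z (2 * r). ennreal ((norm (f y - c))\<^sup>2) \<partial>M)"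
      by (intro nn_integral_cong) (auto simp: f1_def B_def indicator_def)
    also have "\<dots> \<le> ennreal ((4 * (64 * A ^ 11 * N)\<^sup>2 + 2 * (2 * \<kappa> * N)\<^sup>2) * A * V z r)"
      by (rule osc_local_L2[OF osc N r avg])
    also have "(4 * (64 * A ^ 11 * N)\<^sup>2 + 2 * (2 * \<kappa> * N)\<^sup>2) * A * V z r = E * N\<^sup>2 * V z r"
      by (simp add: E_def power_mult_distrib algebra_simps)
    finally have L2: "(\<integral>\<^sup>+y. ennreal ((norm (f1 y))\<^sup>2) \<partial>M) \<le> ennreal (E * N\<^sup>2 * V z r)" .
    have g1: "(\<integral>\<^sup>+x. sq_part {0<..} f1 x \<partial>M) \<le> ennreal (K\<^sup>2 * (E * N\<^sup>2 * V z r))"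
    proof -
      have "(\<integral>\<^sup>+x. sq_part {0<..} f1 x \<partial>M) \<le> ennreal (K\<^sup>2) * (\<integral>\<^sup>+x. ennreal ((norm (f1 x))\<^sup>2) \<partial>M)"
        using L2 by (intro K(2) f1) (auto intro: le_less_trans)
      also have "\<dots> \<le> ennreal (K\<^sup>2) * ennreal (E * N\<^sup>2 * V z r)" using L2 by (intro mult_left_mono) auto
      also have "\<dots> = ennreal (K\<^sup>2 * (E * N\<^sup>2 * V z r))" using E0 by (intro ennreal_mult[symmetric]) auto
      finally show ?thesis .
    qed
    \<comment> \<open>A ball of radius less than \<open>r\<close> does not leave the doubled ball, so \<open>f2\<close> vanishes there; for the other
      radii the bound \<open>t \<le> 4 * r\<close> turns \<open>1 + log 2 (2 ^ j * t / r)\<close> into \<open>j + 3\<close>.\<close>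
    have mean2: "mean_le f2 x (2 ^ j * t) (real (Suc j) * (3 * \<kappa> * N))"
      if x: "x \<in> ball z r" and t: "0 < t" "t \<le> 4 * r" for x t j
    proof (cases "2 ^ j * t < r")
      case True
      have "f2 y = 0" if "y \<in> ball x (2 ^ j * t)" for y
      proof -
        have "dist z y < r + r" using x that True dist_triangle[of z y x] by simp
        then show ?thesis by (simp add: f2_def B_def)
      qed
      then have "(\<integral>\<^sup>+y\<in>ball x (2 ^ j * t). ennreal (norm (f2 y)) \<partial>M) = (\<integral>\<^sup>+y. 0 \<partial>M)"
        by (intro nn_integral_cong) (auto simp: indicator_def)
      then show ?thesis by (simp add: mean_le_def)
    next
      case False
      have "log 2 (2 ^ j * t / r) \<le> log 2 (2 ^ j * 4)"
        using t r by (intro log_mono) (auto simp: field_simps)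
      also have "\<dots> = log 2 (2 ^ (j + 2))" by (simp add: power_add mult.commute)
      also have "\<dots> = real j + 2" by (subst log_nat_power) auto
      finally have "\<kappa> * N * (1 + log 2 (2 ^ j * t / r)) \<le> \<kappa> * N * (3 * real (Suc j))"
        using \<kappa> N by (intro mult_left_mono) auto
      then have "mean_le (\<lambda>y. f y - c) x (2 ^ j * t) (real (Suc j) * (3 * \<kappa> * N))"
        using mean[OF x, of "2 ^ j * t"] False by (auto intro: mean_le_mono simp: mult_ac)
      moreover have "(\<integral>\<^sup>+y\<in>ball x (2 ^ j * t). ennreal (norm (f2 y)) \<partial>M)
          \<le> (\<integral>\<^sup>+y\<in>ball x (2 ^ j * t). ennreal (norm (f y - c)) \<partial>M)"
        by (intro nn_integral_mono) (auto simp: f2_def indicator_def)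
      ultimately show ?thesis unfolding mean_le_def by (blast intro: order_trans)
    qed
    have pt: "(norm (kernel_op M (Q t) f x))\<^sup>2
        \<le> 3 * (norm (kernel_op M (Q t) f1 x))\<^sup>2 + (3 * (D * N)\<^sup>2 * (t / r) powr \<gamma> + 3 * (\<kappa> * N)\<^sup>2 * (t / r) powr (2 * \<eta>))"
      if x: "x \<in> ball z r" and t: "0 < t" "t \<le> 4 * r" for x t
    proof -
      have far: "f2 y = 0" if "dist x y < r" for y
      proof -
        have "dist z y < r + r" using x that dist_triangle[of z y x] by simp
        then show ?thesis by (simp add: f2_def B_def)
      qed
      have a: "0 \<le> 3 * \<kappa> * N" using \<kappa> N by simp
      have i: "integrable M (\<lambda>y. Q t x y * f y)" by (rule osc_integrable[OF osc _ t(1)]) (use N in simp)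
      have i2: "integrable M (\<lambda>y. Q t x y * f2 y)"
        by (rule kernel_op_bound(1)[OF t(1) a f2 mean2[OF x t]])
      have ic: "integrable M (\<lambda>y. Q t x y * c)" using Q_one(1)[OF t(1), of x] by simp
      have "integrable M (\<lambda>y. Q t x y * f y - Q t x y * f2 y - Q t x y * c)"
        by (intro Bochner_Integration.integrable_diff i i2 ic)
      then have i1: "integrable M (\<lambda>y. Q t x y * f1 y)" by (simp add: f12 algebra_simps)
      have "kernel_op M (Q t) f x = (LINT y|M. Q t x y * f1 y + Q t x y * f2 y + Q t x y * c)"
        unfolding kernel_op_def by (subst f12) (simp add: algebra_simps)
      also have "\<dots> = kernel_op M (Q t) f1 x + kernel_op M (Q t) f2 x + (LINT y|M. Q t x y) * c"
        unfolding kernel_op_def using i1 i2 ic by (simp add: Bochner_Integration.integral_add)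
      finally have "(norm (kernel_op M (Q t) f x))\<^sup>2 \<le> 3 * ((norm (kernel_op M (Q t) f1 x))\<^sup>2
          + (norm (kernel_op M (Q t) f2 x))\<^sup>2 + (norm ((LINT y|M. Q t x y) * c))\<^sup>2)"
        by (simp only: norm_add3_power2)
      moreover have "(norm (kernel_op M (Q t) f2 x))\<^sup>2 \<le> (D * N * (t / r) powr (\<gamma> / 2))\<^sup>2"
        using kernel_op_far_bound[OF t(1) a r f2 mean2[OF x t] far]
        by (intro power_mono) (auto simp: D_def mult_ac)
      moreover have "(norm ((LINT y|M. Q t x y) * c))\<^sup>2 \<le> (\<kappa> * N * (t / r) powr \<eta>)\<^sup>2"
        using const[OF x t] by (intro power_mono) (auto simp: norm_mult mult_ac)
      ultimately show ?thesis by (simp add: power_mult_distrib powr_power2)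
    qed
    let ?b = "(3 * (D * N)\<^sup>2 * (4 powr \<gamma> / \<gamma>) + 3 * (\<kappa> * N)\<^sup>2 * (4 powr (2 * \<eta>) / (2 * \<eta>)))"
    have sq: "sq_part {0<..4 * r} f x \<le> 3 * sq_part {0<..} f1 x + ennreal ?b" if x: "x \<in> ball z r" for x
    proof -
      let ?S = "{0<..4 * r}"
      let ?u = "\<lambda>t. ennreal ((norm (kernel_op M (Q t) f1 x))\<^sup>2 / t) * indicator ?S t"
      let ?v = "\<lambda>t. ennreal (3 * (D * N)\<^sup>2 * (t / r) powr \<gamma> / t) * indicator ?S t"
      let ?w = "\<lambda>t. ennreal (3 * (\<kappa> * N)\<^sup>2 * (t / r) powr (2 * \<eta>) / t) * indicator ?S t"
      have [measurable]: "?u \<in> borel_measurable lborel"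
        by (intro integrand_measurable_t f1) auto
      have "sq_part ?S f x \<le> (\<integral>\<^sup>+t. 3 * ?u t + (?v t + ?w t) \<partial>lborel)"
        unfolding sq_part_def
      proof (rule nn_integral_mono)
        fix t :: real
        show "ennreal ((norm (kernel_op M (Q t) f x))\<^sup>2 / t) * indicator ?S t \<le> 3 * ?u t + (?v t + ?w t)"
        proof (cases "t \<in> ?S")
          case True
          then have t: "0 < t" "t \<le> 4 * r" by auto
          have "(norm (kernel_op M (Q t) f x))\<^sup>2 / t \<le> (3 * (norm (kernel_op M (Q t) f1 x))\<^sup>2
            + (3 * (D * N)\<^sup>2 * (t / r) powr \<gamma> + 3 * (\<kappa> * N)\<^sup>2 * (t / r) powr (2 * \<eta>))) / t"
            using t by (intro divide_right_mono pt x) auto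
          also have "\<dots> = 3 * ((norm (kernel_op M (Q t) f1 x))\<^sup>2 / t)
            + (3 * (D * N)\<^sup>2 * (t / r) powr \<gamma> / t + 3 * (\<kappa> * N)\<^sup>2 * (t / r) powr (2 * \<eta>) / t)"
            by (simp add: add_divide_distrib)
          finally have "ennreal ((norm (kernel_op M (Q t) f x))\<^sup>2 / t)
            \<le> ennreal (3 * ((norm (kernel_op M (Q t) f1 x))\<^sup>2 / t)
            + (3 * (D * N)\<^sup>2 * (t / r) powr \<gamma> / t + 3 * (\<kappa> * N)\<^sup>2 * (t / r) powr (2 * \<eta>) / t))"
            by (rule ennreal_leI)
          also have "\<dots> = ennreal (3 * ((norm (kernel_op M (Q t) f1 x))\<^sup>2 / t))
            + (ennreal (3 * (D * N)\<^sup>2 * (t / r) powr \<gamma> / t) + ennreal (3 * (\<kappa> * N)\<^sup>2 * (t / r) powr (2 * \<eta>) / t))"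
            using t by (subst ennreal_plus[symmetric] | simp del: ennreal_plus)+
          also have "ennreal (3 * ((norm (kernel_op M (Q t) f1 x))\<^sup>2 / t)) = 3 * ennreal ((norm (kernel_op M (Q t) f1 x))\<^sup>2 / t)"
            by (subst ennreal_mult') auto
          finally show ?thesis using True by simp
        qed simp
      qed
      also have "\<dots> = 3 * sq_part ?S f1 x + (integral\<^sup>N lborel ?v + integral\<^sup>N lborel ?w)"
        unfolding sq_part_def by (subst nn_integral_add, measurable)+ (simp add: nn_integral_cmult)
      also have "integral\<^sup>N lborel ?v + integral\<^sup>N lborel ?w = ennreal ?b"
        using \<gamma> \<eta> r by (simp add: nn_integral_powr_ratio_up_to_4r_cmult)
      also have "3 * sq_part ?S f1 x \<le> 3 * sq_part {0<..} f1 x"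
        by (intro mult_left_mono sq_part_mono) auto
      finally show ?thesis by (simp add: add_right_mono)
    qed
    have b0: "0 \<le> ?b" using \<gamma> \<eta> by simp
    have [measurable]: "sq_part {0<..} f1 \<in> borel_measurable M" by (intro sq_part_measurable f1) auto
    have "(\<integral>\<^sup>+x\<in>ball z r. sq_part {0<..4 * r} f x \<partial>M)
      \<le> (\<integral>\<^sup>+x. 3 * sq_part {0<..} f1 x + ennreal ?b * indicator (ball z r) x \<partial>M)"
      using sq by (intro nn_integral_mono) (auto simp: indicator_def)
    also have "\<dots> = 3 * (\<integral>\<^sup>+x. sq_part {0<..} f1 x \<partial>M) + ennreal ?b * ennreal (V z r)"
      by (subst nn_integral_add) (auto simp: nn_integral_cmult nn_integral_cmult_indicator emeasure_ball)
    also have "\<dots> \<le> 3 * ennreal (K\<^sup>2 * (E * N\<^sup>2 * V z r)) + ennreal ?b * ennreal (V z r)"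
      by (intro add_right_mono mult_left_mono g1) auto
    also have "3 * ennreal (K\<^sup>2 * (E * N\<^sup>2 * V z r)) = ennreal (3 * (K\<^sup>2 * (E * N\<^sup>2 * V z r)))"
      by (subst ennreal_mult') auto
    also have "ennreal ?b * ennreal (V z r) = ennreal (?b * V z r)"
      using b0 by (intro ennreal_mult[symmetric]) auto
    also have "ennreal (3 * (K\<^sup>2 * (E * N\<^sup>2 * V z r))) + ennreal (?b * V z r)
        = ennreal (3 * (K\<^sup>2 * (E * N\<^sup>2 * V z r)) + ?b * V z r)"
      using b0 E0 by (intro ennreal_plus[symmetric] mult_nonneg_nonneg) auto
    also have "3 * (K\<^sup>2 * (E * N\<^sup>2 * V z r)) + ?b * V z r = C * N\<^sup>2 * V z r"
      unfolding C_def power_mult_distrib by (simp only: distrib_right distrib_left mult_ac)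
    finally show "(\<integral>\<^sup>+x\<in>ball z r. sq_part {0<..4 * r} f x \<partial>M) \<le> ennreal (C * N\<^sup>2 * V z r)" .
  qed
qed

text \<open>
  The admissibility condition read at distance at most \<open>\<rho> y\<close>, where its last factor is at most \<open>2\<^sup>k\<^sup>0\<close>.
\<close>

lemma \<rho>_comparable:
  obtains c where "1 \<le> c" "\<And>z x R. \<rho> z \<le> R \<Longrightarrow> dist z x \<le> R \<Longrightarrow> \<rho> x \<le> c * R"
    "\<And>z x. dist z x \<le> \<rho> z \<Longrightarrow> \<rho> z \<le> c * \<rho> x"
proof -
  obtain C0 k0 where C0: "0 < C0" "0 < k0" and
    ad: "\<And>x y. 1 / \<rho> x \<le> C0 * (1 / \<rho> y) * (1 + dist x y / \<rho> y) powr k0"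
    using adm unfolding admissible_def by blast
  have near: "\<rho> y \<le> C0 * 2 powr k0 * \<rho> x" if "dist x y \<le> \<rho> y" for x y
  proof -
    have "1 / \<rho> x \<le> C0 * (1 / \<rho> y) * (1 + dist x y / \<rho> y) powr k0" by (rule ad)
    also have "\<dots> \<le> C0 * (1 / \<rho> y) * 2 powr k0"
      using that \<rho>_pos[of y] C0 by (intro mult_left_mono powr_mono2) auto
    finally show ?thesis using \<rho>_pos[of x] \<rho>_pos[of y] by (simp add: field_simps)
  qed
  show thesis
  proof (rule that[of "max 1 (C0 * 2 powr k0)"])
    show "\<rho> z \<le> max 1 (C0 * 2 powr k0) * \<rho> x" if "dist z x \<le> \<rho> z" for z x
    proof -
      have "\<rho> z \<le> C0 * 2 powr k0 * \<rho> x" using near[of x z] that by (simp add: dist_commute)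
      also have "\<dots> \<le> max 1 (C0 * 2 powr k0) * \<rho> x" using \<rho>_pos[of x] by (intro mult_right_mono) auto
      finally show ?thesis .
    qed
    show "\<rho> x \<le> max 1 (C0 * 2 powr k0) * R" if R: "\<rho> z \<le> R" "dist z x \<le> R" for z x R
    proof (cases "\<rho> x \<le> R")
      case True
      have "1 * R \<le> max 1 (C0 * 2 powr k0) * R" using R \<rho>_pos[of z] by (intro mult_right_mono) auto
      then show ?thesis using True by simp
    next
      case False
      then have "\<rho> x \<le> C0 * 2 powr k0 * \<rho> z" using near[of z x] R by simp
      also have "\<dots> \<le> max 1 (C0 * 2 powr k0) * R"
        using R \<rho>_pos[of z] C0 by (intro mult_mono) auto
      finally show ?thesis .
    qed
  qed simp
qed

text \<open>
  At scales \<open>t \<ge> R \<ge> \<rho> z\<close> all means that enter are over balls on which \<open>|f|\<close> itself is controlled, and the factor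
  \<open>(\<rho> x / (t + \<rho> x))\<^sup>\<delta>\<^sup>1\<close> of the size condition gives the decay.
\<close>

lemma tail_pointwise:
  obtains C where "0 < C"
    "\<And>f N z x R t. 0 \<le> N \<Longrightarrow> bmo_le \<rho> f N \<Longrightarrow> \<rho> z \<le> R \<Longrightarrow> dist z x \<le> R \<Longrightarrow> R \<le> t \<Longrightarrow>
      norm (kernel_op M (Q t) f x) \<le> C * N * (R / t) powr \<delta>1"
proof -
  obtain c where c: "1 \<le> c" "\<And>z x R. \<rho> z \<le> R \<Longrightarrow> dist z x \<le> R \<Longrightarrow> \<rho> x \<le> c * R"
    by (rule \<rho>_comparable) blast
  have A0: "0 < A" using A_ge_1 by simp
  define C where "C = C1 * kernel_const \<gamma> * c powr \<delta>1 * A ^ 2"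
  have C0: "0 < C" using C1 kernel_const_pos[OF \<gamma>] c(1) A0 by (simp add: C_def)
  show thesis
  proof (rule that[OF C0])
    fix f :: "'a \<Rightarrow> complex" and N z x R t
    assume N: "0 \<le> N" and f: "bmo_le \<rho> f N" and R: "\<rho> z \<le> R" "dist z x \<le> R" "R \<le> t"
    have R0: "0 < R" and t: "0 < t" using R \<rho>_pos[of z] by linarith+
    have osc: "osc_le f N" using f by (simp add: bmo_le_def)
    have mean: "mean_le f x (2 ^ j * t) (real (Suc j) * (A ^ 2 * N))" for j
    proof (rule mean_le_mono)
      have tj: "t \<le> 2 ^ j * t" using t by simp
      show "mean_le f x (2 ^ j * t) (A ^ 2 * N)"
        by (rule bmo_le_mean_le[OF f N, of _ z]) (use tj R t in linarith)+
      show "A ^ 2 * N \<le> real (Suc j) * (A ^ 2 * N)"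
        using N mult_right_mono[of 1 "real (Suc j)" "A ^ 2 * N"] by simp
    qed
    have "norm (kernel_op M (Q t) f x) \<le> C1 * kernel_const \<gamma> * (\<rho> x / (t + \<rho> x)) powr \<delta>1 * (A ^ 2 * N)"
      using N by (intro kernel_op_bound(2)[OF t _ osc_le_measurable[OF osc] mean]) auto
    also have "\<dots> \<le> C1 * kernel_const \<gamma> * (c * (R / t)) powr \<delta>1 * (A ^ 2 * N)"
    proof (intro mult_right_mono mult_left_mono powr_mono2)
      have "\<rho> x / (t + \<rho> x) \<le> \<rho> x / t" using t \<rho>_pos[of x] by (intro divide_left_mono) auto
      also have "\<dots> \<le> c * R / t" using c(2)[OF R(1,2)] t by (intro divide_right_mono) auto
      finally show "\<rho> x / (t + \<rho> x) \<le> c * (R / t)" by simp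
    qed (use \<delta>1 t \<rho>_pos[of x] C1 kernel_const_pos[OF \<gamma>] N in auto)
    also have "\<dots> = C * N * (R / t) powr \<delta>1"
      unfolding C_def powr_mult by (simp only: mult_ac)
    finally show "norm (kernel_op M (Q t) f x) \<le> C * N * (R / t) powr \<delta>1" .
  qed
qed

lemma Q_one_at_scale:
  obtains c where "1 \<le> c"
    "\<And>z x t. 0 < t \<Longrightarrow> dist z x \<le> \<rho> z \<Longrightarrow> norm (LINT y|M. Q t x y) \<le> c * (t / \<rho> z) powr \<delta>2"
proof -
  obtain c where c: "1 \<le> c" "\<And>z x. dist z x \<le> \<rho> z \<Longrightarrow> \<rho> z \<le> c * \<rho> x"
    by (rule \<rho>_comparable) blast
  show thesis
  proof (rule that[of "max 1 (C1 * c powr \<delta>2)"])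
    fix z x :: 'a and t :: real
    assume t: "0 < t" and d: "dist z x \<le> \<rho> z"
    have "norm (LINT y|M. Q t x y) \<le> C1 * (t / (t + \<rho> x)) powr \<delta>2" by (rule Q_cancel[OF t])
    also have "\<dots> \<le> C1 * (c * (t / \<rho> z)) powr \<delta>2"
    proof (intro mult_left_mono powr_mono2)
      have "t / (t + \<rho> x) \<le> t / \<rho> x" using t \<rho>_pos[of x] by (intro divide_left_mono) auto
      also have "\<dots> \<le> t / (\<rho> z / c)"
        using t c(1) c(2)[OF d] \<rho>_pos[of z] \<rho>_pos[of x]
        by (intro divide_left_mono) (auto simp: field_simps intro!: mult_pos_pos)
      finally show "t / (t + \<rho> x) \<le> c * (t / \<rho> z)" by (simp add: mult_ac)
    qed (use \<delta>2 C1 t \<rho>_pos[of x] in auto)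
    also have "\<dots> = C1 * c powr \<delta>2 * (t / \<rho> z) powr \<delta>2"
      using c(1) t \<rho>_pos[of z] by (subst powr_mult) auto
    also have "\<dots> \<le> max 1 (C1 * c powr \<delta>2) * (t / \<rho> z) powr \<delta>2" by (intro mult_right_mono) auto
    finally show "norm (LINT y|M. Q t x y) \<le> max 1 (C1 * c powr \<delta>2) * (t / \<rho> z) powr \<delta>2" .
  qed simp
qed

text \<open>
  Subtract from \<open>f\<close> its mean \<open>m\<close> over \<open>ball z t\<close>. The smoothness condition handles \<open>f - m\<close>. For the constant \<open>m\<close>, the
  difference \<open>Q\<^sub>t1(x) - Q\<^sub>t1(x')\<close> is bounded both by \<open>(r / t)\<^sup>\<beta>\<close>, from smoothness, and by \<open>(t / \<rho> z)\<^sup>\<delta>\<^sup>2\<close>, from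
  cancellation, hence by the geometric mean of the two: half of the second power absorbs the growth of \<open>m\<close>, and half of the
  first is left as decay.
\<close>

lemma middle_pointwise:
  obtains C where "0 < C"
    "\<And>f N z x x' r t. 0 \<le> N \<Longrightarrow> bmo_le \<rho> f N \<Longrightarrow> x \<in> ball z r \<Longrightarrow> x' \<in> ball z r \<Longrightarrow> 4 * r \<le> t \<Longrightarrow> t \<le> \<rho> z \<Longrightarrow>
      norm (kernel_op M (Q t) f x) \<le> C * N \<and>
      norm (kernel_op M (Q t) f x - kernel_op M (Q t) f x') \<le> C * N * (r / t) powr (\<beta> / 2)"
proof -
  obtain c where c: "1 \<le> c"
    "\<And>z x t. 0 < t \<Longrightarrow> dist z x \<le> \<rho> z \<Longrightarrow> norm (LINT y|M. Q t x y) \<le> c * (t / \<rho> z) powr \<delta>2"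
    by (rule Q_one_at_scale) blast
  have A0: "0 < A" using A_ge_1 by simp
  define k where "k = C1 * kernel_const \<gamma>"
  have k: "0 < k" using C1 kernel_const_pos[OF \<gamma>] by (simp add: k_def)
  define L where "L = (\<lambda>d. 4 * A ^ 4 * (1 + 1 / (d * ln 2)))"
  have L: "0 < L d" if "0 < d" for d using that A0 unfolding L_def
    by (intro mult_pos_pos add_pos_pos divide_pos_pos) auto
  define E where "E = k * 2 powr \<beta> + 2 * c"
  have E: "0 < E" using k c(1) by (simp add: E_def add_pos_pos)
  define Ca where "Ca = k * (3 * A ^ 4) + L \<delta>2 * c"
  define Cb where "Cb = k * 2 powr \<beta> * (3 * A ^ 4) + L (\<delta>2 / 2) * E"
  have Ca: "0 < Ca" and Cb: "0 < Cb"
    using k A0 L[of \<delta>2] L[of "\<delta>2 / 2"] \<delta>2 c(1) E by (auto simp: Ca_def Cb_def intro!: add_pos_pos)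
  show thesis
  proof (rule that[of "Ca + Cb"])
    show "0 < Ca + Cb" using Ca Cb by simp
    fix f :: "'a \<Rightarrow> complex" and N r t :: real and z x x'
    assume N: "0 \<le> N" and f: "bmo_le \<rho> f N" and x: "x \<in> ball z r" and x': "x' \<in> ball z r"
      and t4: "4 * r \<le> t" and t\<rho>: "t \<le> \<rho> z"
    have r: "0 < r" using x by (auto intro: le_less_trans[OF zero_le_dist])
    have t: "0 < t" using r t4 by simp
    have osc: "osc_le f N" using f by (simp add: bmo_le_def)
    have [measurable]: "f \<in> borel_measurable M" by (rule osc_le_measurable[OF osc])
    have dx: "dist z x \<le> t" "dist z x \<le> \<rho> z" "dist z x' \<le> \<rho> z"
      using x x' r t4 t\<rho> by (auto simp: less_imp_le)
    have xx: "dist x x' \<le> 2 * r" "dist x x' \<le> t / 2"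
      using x x' t4 dist_triangle[of x x' z] by (auto simp: dist_commute)
    define m where "m = ball_avg M (ball z t) f"
    have fm: "(\<lambda>y. f y - m) \<in> borel_measurable M" by measurable
    have a: "0 \<le> 3 * A ^ 4 * N" using A0 N by simp
    note mean = osc_mean_le[OF osc N t dx(1), folded m_def]
    note b = kernel_op_bound[OF t a fm mean]
    have m_le: "norm m \<le> L d * N * (\<rho> z / t) powr d" if "0 < d" for d
      using ball_avg_powr_bound[OF f N t t\<rho> that] by (simp add: m_def L_def)
    have iQ: "integrable M (Q t y)" for y by (rule Q_one(1)[OF t])
    have iQf: "integrable M (\<lambda>w. Q t y w * f w)" for y by (rule osc_integrable[OF osc N t])
    have iQm: "integrable M (\<lambda>w. Q t y w * (f w - m))" for y
      using Bochner_Integration.integrable_diff[OF iQf[of y] integrable_mult_left[OF iQ[of y], of m]]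
      by (simp add: algebra_simps)
    have dec: "kernel_op M (Q t) f y = kernel_op M (Q t) (\<lambda>w. f w - m) y + (LINT w|M. Q t y w) * m" for y
    proof -
      have "kernel_op M (Q t) f y = (LINT w|M. Q t y w * (f w - m) + Q t y w * m)"
        by (simp add: kernel_op_def algebra_simps)
      then show ?thesis using iQm[of y] iQ[of y] by (simp add: kernel_op_def)
    qed
    have tz: "(\<rho> z / t) powr d * (t / \<rho> z) powr d = 1" for d
      using t \<rho>_pos[of z] by (subst powr_mult[symmetric]) auto
    have "norm (kernel_op M (Q t) f x) \<le> norm (kernel_op M (Q t) (\<lambda>w. f w - m) x) + norm (LINT w|M. Q t x w) * norm m"
      unfolding dec[of x] using norm_triangle_ineq by (metis norm_mult)
    also have "norm (kernel_op M (Q t) (\<lambda>w. f w - m) x) \<le> k * 1 * (3 * A ^ 4 * N)"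
    proof -
      have "norm (kernel_op M (Q t) (\<lambda>w. f w - m) x) \<le> k * (\<rho> x / (t + \<rho> x)) powr \<delta>1 * (3 * A ^ 4 * N)"
        unfolding k_def by (rule b(2))
      also have "\<dots> \<le> k * 1 * (3 * A ^ 4 * N)"
        using k a by (intro mult_right_mono mult_left_mono \<rho>_factor_le_1 t) auto
      finally show ?thesis .
    qed
    also have "norm (LINT w|M. Q t x w) * norm m \<le> (c * (t / \<rho> z) powr \<delta>2) * (L \<delta>2 * N * (\<rho> z / t) powr \<delta>2)"
      using c(1) by (intro mult_mono c(2) m_le dx t \<delta>2) auto
    also have "\<dots> = L \<delta>2 * c * N * ((\<rho> z / t) powr \<delta>2 * (t / \<rho> z) powr \<delta>2)" by (simp only: mult_ac)
    also have "\<dots> = L \<delta>2 * c * N" by (simp only: tz mult_1_right)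
    finally have "norm (kernel_op M (Q t) f x) \<le> Ca * N" by (simp add: Ca_def algebra_simps)
    also have "\<dots> \<le> (Ca + Cb) * N" using Cb N by (intro mult_right_mono) auto
    finally have 1: "norm (kernel_op M (Q t) f x) \<le> (Ca + Cb) * N" .
    \<comment> \<open>The two bounds of the difference are multiples of \<open>u\<^sup>2\<close> and \<open>v\<^sup>2\<close>, hence it is one of \<open>u * v\<close>.\<close>
    define u where "u = (r / t) powr (\<beta> / 2)"
    define v where "v = (t / \<rho> z) powr (\<delta>2 / 2)"
    have u0: "0 < u" and v0: "0 < v" using r t \<rho>_pos[of z] by (auto simp: u_def v_def)
    have u1: "u \<le> 1" unfolding u_def using r t t4 \<beta> by (intro powr_le1) auto
    have u2: "u\<^sup>2 = (r / t) powr \<beta>" and v2: "v\<^sup>2 = (t / \<rho> z) powr \<delta>2" by (simp_all add: u_def v_def powr_power2)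
    have dp: "(dist x x' / t) powr \<beta> \<le> 2 powr \<beta> * u\<^sup>2"
    proof -
      have "(dist x x' / t) powr \<beta> \<le> (2 * (r / t)) powr \<beta>"
        using xx t \<beta> by (intro powr_mono2) (auto simp: divide_right_mono)
      also have "\<dots> = 2 powr \<beta> * u\<^sup>2" unfolding u2 using r t by (subst powr_mult) auto
      finally show ?thesis .
    qed
    define X where "X = norm ((LINT w|M. Q t x w) - (LINT w|M. Q t x' w))"
    have X1: "X \<le> E * u\<^sup>2"
    proof -
      have "X \<le> k * (dist x x' / t) powr \<beta>" unfolding X_def k_def by (rule Q_one(2)[OF t xx(2)])
      also have "\<dots> \<le> k * (2 powr \<beta> * u\<^sup>2)" using k dp by (intro mult_left_mono) auto
      also have "\<dots> \<le> E * u\<^sup>2" using c(1) by (simp add: E_def algebra_simps)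
      finally show ?thesis .
    qed
    have X2: "X \<le> E * v\<^sup>2"
    proof -
      have "X \<le> norm (LINT w|M. Q t x w) + norm (LINT w|M. Q t x' w)" unfolding X_def by (rule norm_triangle_ineq4)
      also have "\<dots> \<le> c * v\<^sup>2 + c * v\<^sup>2" unfolding v2 by (intro add_mono c(2) t dx)
      also have "\<dots> \<le> E * v\<^sup>2" using k by (simp add: E_def algebra_simps)
      finally show ?thesis .
    qed
    have "X \<le> E * (u * v)"
    proof (cases "u \<le> v")
      case True
      then have "E * u\<^sup>2 \<le> E * (u * v)" using E u0 by (simp add: power2_eq_square)
      then show ?thesis using X1 by simp
    next
      case False
      then have "E * v\<^sup>2 \<le> E * (u * v)" using E v0 by (simp add: power2_eq_square)
      then show ?thesis using X2 by simp
    qed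
    then have "X * norm m \<le> (E * (u * v)) * (L (\<delta>2 / 2) * N * (\<rho> z / t) powr (\<delta>2 / 2))"
      using E u0 v0 \<delta>2 by (intro mult_mono m_le) auto
    also have "\<dots> = L (\<delta>2 / 2) * E * N * u * ((\<rho> z / t) powr (\<delta>2 / 2) * v)" by (simp only: mult_ac)
    also have "\<dots> = L (\<delta>2 / 2) * E * N * u" by (simp only: v_def tz mult_1_right)
    finally have Xm: "X * norm m \<le> L (\<delta>2 / 2) * E * N * u" .
    have "kernel_op M (Q t) f x - kernel_op M (Q t) f x'
      = (LINT w|M. (Q t x w - Q t x' w) * (f w - m)) + ((LINT w|M. Q t x w) - (LINT w|M. Q t x' w)) * m"
    proof -
      have "(LINT w|M. (Q t x w - Q t x' w) * (f w - m))
        = kernel_op M (Q t) (\<lambda>w. f w - m) x - kernel_op M (Q t) (\<lambda>w. f w - m) x'"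
        unfolding kernel_op_def by (subst Bochner_Integration.integral_diff[symmetric, OF iQm iQm]) (simp only: left_diff_distrib)
      then show ?thesis by (simp add: dec[of x] dec[of x'] algebra_simps)
    qed
    then have "norm (kernel_op M (Q t) f x - kernel_op M (Q t) f x')
      \<le> norm (LINT w|M. (Q t x w - Q t x' w) * (f w - m)) + X * norm m"
      unfolding X_def by (metis norm_triangle_ineq norm_mult)
    also have "norm (LINT w|M. (Q t x w - Q t x' w) * (f w - m)) \<le> k * 2 powr \<beta> * (3 * A ^ 4) * N * u"
    proof -
      have "norm (LINT w|M. (Q t x w - Q t x' w) * (f w - m)) \<le> k * (dist x x' / t) powr \<beta> * (3 * A ^ 4 * N)"
        unfolding k_def by (rule b(3)[OF xx(2)])
      also have "\<dots> \<le> k * (2 powr \<beta> * u) * (3 * A ^ 4 * N)"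
      proof (intro mult_right_mono mult_left_mono order_trans[OF dp])
        show "u\<^sup>2 \<le> u" using u0 u1 by (simp add: power2_eq_square mult_left_le)
      qed (use k a in auto)
      finally show ?thesis by (simp add: mult_ac)
    qed
    also note Xm
    finally have "norm (kernel_op M (Q t) f x - kernel_op M (Q t) f x') \<le> Cb * N * u"
      by (simp add: Cb_def algebra_simps)
    also have "\<dots> \<le> (Ca + Cb) * N * u" using Ca N u0 by (intro mult_right_mono) auto
    finally show "norm (kernel_op M (Q t) f x) \<le> (Ca + Cb) * N \<and>
      norm (kernel_op M (Q t) f x - kernel_op M (Q t) f x') \<le> (Ca + Cb) * N * (r / t) powr (\<beta> / 2)"
      using 1 by (simp add: u_def)
  qed
qed

section \<open>Large and small balls\<close>

lemma large_ball_estimate: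
  obtains C where "0 \<le> C"
    "\<And>f N z r. 0 < N \<Longrightarrow> bmo_le \<rho> f N \<Longrightarrow> 0 < r \<Longrightarrow> \<rho> z \<le> r \<Longrightarrow>
      (\<integral>\<^sup>+x\<in>ball z r. sq_part {0<..} f x \<partial>M) \<le> ennreal (C * N\<^sup>2 * V z r)"
proof -
  obtain C1' where near: "0 \<le> C1'"
    "\<And>f N z r c. 0 < N \<Longrightarrow> 0 < r \<Longrightarrow> osc_le f N \<Longrightarrow>
      (\<And>x s. x \<in> ball z r \<Longrightarrow> r \<le> s \<Longrightarrow> mean_le (\<lambda>y. f y - c) x s (A ^ 2 * N * (1 + log 2 (s / r)))) \<Longrightarrow>
      (\<And>x t. x \<in> ball z r \<Longrightarrow> 0 < t \<Longrightarrow> t \<le> 4 * r \<Longrightarrow>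
          norm c * norm (LINT y|M. Q t x y) \<le> A ^ 2 * N * (t / r) powr \<delta>2) \<Longrightarrow>
      (\<integral>\<^sup>+x\<in>ball z r. sq_part {0<..4 * r} f x \<partial>M) \<le> ennreal (C1' * N\<^sup>2 * V z r)"
    by (rule near_estimate[of "A ^ 2" \<delta>2]) (use \<delta>2 in auto)
  obtain D where D: "0 < D"
    "\<And>f N z x R t. 0 \<le> N \<Longrightarrow> bmo_le \<rho> f N \<Longrightarrow> \<rho> z \<le> R \<Longrightarrow> dist z x \<le> R \<Longrightarrow> R \<le> t \<Longrightarrow>
      norm (kernel_op M (Q t) f x) \<le> D * N * (R / t) powr \<delta>1"
    by (rule tail_pointwise) blast
  let ?d = "D\<^sup>2 / (2 * \<delta>1)"
  show thesis
  proof (rule that[of "C1' + ?d"])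
    show "0 \<le> C1' + ?d" using near(1) \<delta>1 by simp
    fix f :: "'a \<Rightarrow> complex" and N r :: real and z
    assume N: "0 < N" and f: "bmo_le \<rho> f N" and r: "0 < r" and \<rho>: "\<rho> z \<le> r"
    have osc: "osc_le f N" using f by (simp add: bmo_le_def)
    have fm [measurable]: "f \<in> borel_measurable M" by (rule osc_le_measurable[OF osc])
    have 1: "(\<integral>\<^sup>+x\<in>ball z r. sq_part {0<..4 * r} f x \<partial>M) \<le> ennreal (C1' * N\<^sup>2 * V z r)"
    proof (rule near(2)[OF N r osc, of z 0])
      fix x s assume x: "x \<in> ball z r" and s: "r \<le> s"
      have "mean_le f x s (A ^ 2 * N)"
        using x s r \<rho> N by (intro bmo_le_mean_le[OF f, of _ z]) auto
      moreover have "A ^ 2 * N * 1 \<le> A ^ 2 * N * (1 + log 2 (s / r))"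
        using N s r by (intro mult_left_mono) auto
      ultimately show "mean_le (\<lambda>y. f y - 0) x s (A ^ 2 * N * (1 + log 2 (s / r)))"
        by (auto intro: mean_le_mono)
    qed (use N in auto)
    have 2: "sq_part {4 * r<..} f x \<le> ennreal (?d * N\<^sup>2)" if x: "x \<in> ball z r" for x
    proof -
      have "sq_part {4 * r<..} f x \<le> (\<integral>\<^sup>+t\<in>{4 * r..}. ennreal ((D * N)\<^sup>2 * ((4 * r) / t) powr (2 * \<delta>1) / t) \<partial>lborel)"
        unfolding sq_part_def
      proof (rule nn_integral_mono)
        fix t
        show "ennreal ((norm (kernel_op M (Q t) f x))\<^sup>2 / t) * indicator {4 * r<..} t
          \<le> ennreal ((D * N)\<^sup>2 * ((4 * r) / t) powr (2 * \<delta>1) / t) * indicator {4 * r..} t"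
        proof (cases "4 * r < t")
          case True
          have "norm (kernel_op M (Q t) f x) \<le> D * N * ((4 * r) / t) powr \<delta>1"
            using True x r N \<rho> by (intro D(2)[OF _ f, of z]) auto
          then have "(norm (kernel_op M (Q t) f x))\<^sup>2 \<le> (D * N * ((4 * r) / t) powr \<delta>1)\<^sup>2"
            by (intro power_mono) auto
          also have "\<dots> = (D * N)\<^sup>2 * ((4 * r) / t) powr (2 * \<delta>1)"
            by (simp only: power_mult_distrib powr_power2)
          finally show ?thesis using True r by (auto intro!: ennreal_leI divide_right_mono)
        qed simp
      qed
      also have "\<dots> = ennreal ((D * N)\<^sup>2 / (2 * \<delta>1))"
        using \<delta>1 r by (intro nn_integral_powr_ratio_from_cmult) auto
      finally show ?thesis by (simp add: power_mult_distrib)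
    qed
    have [measurable]: "sq_part {0<..4 * r} f \<in> borel_measurable M" by (intro sq_part_measurable fm) auto
    have "(\<integral>\<^sup>+x\<in>ball z r. sq_part {0<..} f x \<partial>M)
      \<le> (\<integral>\<^sup>+x. sq_part {0<..4 * r} f x * indicator (ball z r) x + ennreal (?d * N\<^sup>2) * indicator (ball z r) x \<partial>M)"
    proof (rule nn_integral_mono)
      fix x
      show "sq_part {0<..} f x * indicator (ball z r) x
        \<le> sq_part {0<..4 * r} f x * indicator (ball z r) x + ennreal (?d * N\<^sup>2) * indicator (ball z r) x"
        using 2[of x] r by (auto simp: sq_part_split[OF fm, of "4 * r"] indicator_def intro!: add_left_mono)
    qed
    also have "\<dots> = (\<integral>\<^sup>+x\<in>ball z r. sq_part {0<..4 * r} f x \<partial>M) + ennreal (?d * N\<^sup>2) * ennreal (V z r)"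
      by (subst nn_integral_add) (auto simp: nn_integral_cmult_indicator emeasure_ball)
    also have "\<dots> \<le> ennreal (C1' * N\<^sup>2 * V z r) + ennreal (?d * N\<^sup>2) * ennreal (V z r)"
      by (intro add_right_mono 1)
    also have "ennreal (?d * N\<^sup>2) * ennreal (V z r) = ennreal (?d * N\<^sup>2 * V z r)"
      using \<delta>1 by (intro ennreal_mult[symmetric]) auto
    also have "ennreal (C1' * N\<^sup>2 * V z r) + ennreal (?d * N\<^sup>2 * V z r) = ennreal (C1' * N\<^sup>2 * V z r + ?d * N\<^sup>2 * V z r)"
      using \<delta>1 near(1) by (intro ennreal_plus[symmetric]) auto
    also have "C1' * N\<^sup>2 * V z r + ?d * N\<^sup>2 * V z r = (C1' + ?d) * N\<^sup>2 * V z r" by (simp only: distrib_right)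
    finally show "(\<integral>\<^sup>+x\<in>ball z r. sq_part {0<..} f x \<partial>M) \<le> ennreal ((C1' + ?d) * N\<^sup>2 * V z r)" .
  qed
qed

text \<open>
  Here \<open>c\<close> is the mean of \<open>f\<close> over the ball. It may be as large as a power of \<open>\<rho> z / r\<close>, and \<open>Q\<^sub>t1\<close> is as small as the
  same power of \<open>t / \<rho> z\<close>; the product is a power of \<open>t / r\<close>.
\<close>

lemma small_ball_near_estimate:
  obtains C where "0 \<le> C"
    "\<And>f N z r. 0 < N \<Longrightarrow> bmo_le \<rho> f N \<Longrightarrow> 0 < r \<Longrightarrow> r < \<rho> z \<Longrightarrow>
      (\<integral>\<^sup>+x\<in>ball z r. sq_part {0<..4 * r} f x \<partial>M) \<le> ennreal (C * N\<^sup>2 * V z r)"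
proof -
  obtain c where c: "1 \<le> c"
    "\<And>z x t. 0 < t \<Longrightarrow> dist z x \<le> \<rho> z \<Longrightarrow> norm (LINT y|M. Q t x y) \<le> c * (t / \<rho> z) powr \<delta>2"
    by (rule Q_one_at_scale) blast
  have A0: "0 < A" using A_ge_1 by simp
  define L where "L = 4 * A ^ 4 * (1 + 1 / (\<delta>2 * ln 2))"
  have L: "0 < L" using \<delta>2 A0 unfolding L_def
    by (intro mult_pos_pos add_pos_pos divide_pos_pos) auto
  define \<kappa> where "\<kappa> = 3 * A ^ 4 + L * c"
  have \<kappa>: "3 * A ^ 4 \<le> \<kappa>" "L * c \<le> \<kappa>" "0 \<le> \<kappa>" using L c(1) A0 by (auto simp: \<kappa>_def)
  obtain C where near: "0 \<le> C"
    "\<And>f N z r c. 0 < N \<Longrightarrow> 0 < r \<Longrightarrow> osc_le f N \<Longrightarrow>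
      (\<And>x s. x \<in> ball z r \<Longrightarrow> r \<le> s \<Longrightarrow> mean_le (\<lambda>y. f y - c) x s (\<kappa> * N * (1 + log 2 (s / r)))) \<Longrightarrow>
      (\<And>x t. x \<in> ball z r \<Longrightarrow> 0 < t \<Longrightarrow> t \<le> 4 * r \<Longrightarrow>
          norm c * norm (LINT y|M. Q t x y) \<le> \<kappa> * N * (t / r) powr \<delta>2) \<Longrightarrow>
      (\<integral>\<^sup>+x\<in>ball z r. sq_part {0<..4 * r} f x \<partial>M) \<le> ennreal (C * N\<^sup>2 * V z r)"
    by (rule near_estimate[OF \<kappa>(3) \<delta>2]) blast
  show thesis
  proof (rule that[OF near(1)])
    fix f :: "'a \<Rightarrow> complex" and N r :: real and z
    assume N: "0 < N" and f: "bmo_le \<rho> f N" and r: "0 < r" and \<rho>: "r < \<rho> z"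
    have osc: "osc_le f N" using f by (simp add: bmo_le_def)
    show "(\<integral>\<^sup>+x\<in>ball z r. sq_part {0<..4 * r} f x \<partial>M) \<le> ennreal (C * N\<^sup>2 * V z r)"
    proof (rule near(2)[OF N r osc, of z "ball_avg M (ball z r) f"])
      fix x s assume x: "x \<in> ball z r" and s: "r \<le> s"
      have "mean_le (\<lambda>y. f y - ball_avg M (ball z r) f) x s (3 * A ^ 4 * N * (1 + log 2 (s / r)))"
        using x s r N by (intro mean_le_log_growth[OF osc]) auto
      moreover have "3 * A ^ 4 * N * (1 + log 2 (s / r)) \<le> \<kappa> * N * (1 + log 2 (s / r))"
        using N s r \<kappa> by (intro mult_right_mono) auto
      ultimately show "mean_le (\<lambda>y. f y - ball_avg M (ball z r) f) x s (\<kappa> * N * (1 + log 2 (s / r)))"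
        by (rule mean_le_mono)
    next
      fix x t assume x: "x \<in> ball z r" and t: "0 < t" "t \<le> 4 * r"
      have "norm (ball_avg M (ball z r) f) * norm (LINT y|M. Q t x y)
        \<le> (L * N * (\<rho> z / r) powr \<delta>2) * (c * (t / \<rho> z) powr \<delta>2)"
      proof (rule mult_mono)
        show "norm (ball_avg M (ball z r) f) \<le> L * N * (\<rho> z / r) powr \<delta>2"
          unfolding L_def using N \<rho> by (intro ball_avg_powr_bound[OF f _ r _ \<delta>2]) auto
        show "norm (LINT y|M. Q t x y) \<le> c * (t / \<rho> z) powr \<delta>2"
          using x \<rho> by (intro c(2) t) auto
      qed (use L N in auto)
      also have "\<dots> = L * c * N * ((\<rho> z / r) powr \<delta>2 * (t / \<rho> z) powr \<delta>2)" by (simp only: mult_ac)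
      also have "(\<rho> z / r) powr \<delta>2 * (t / \<rho> z) powr \<delta>2 = (t / r) powr \<delta>2"
        using t r \<rho>_pos[of z] by (subst powr_mult[symmetric]) auto
      also have "L * c * N * (t / r) powr \<delta>2 \<le> \<kappa> * N * (t / r) powr \<delta>2"
        using \<kappa> N by (intro mult_right_mono) auto
      finally show "norm (ball_avg M (ball z r) f) * norm (LINT y|M. Q t x y) \<le> \<kappa> * N * (t / r) powr \<delta>2" .
    qed
  qed
qed

text \<open>
  For \<open>t \<le> \<rho> z\<close>, factor the difference of the squares as \<open>(a - b)(a + b)\<close>: the first factor decays by \<open>middle_pointwise\<close> and
  the second is bounded. For \<open>t > \<rho> z\<close> the decay of the single terms suffices.
\<close>

lemma small_ball_far_comparison:
  obtains C where "0 \<le> C"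
    "\<And>f N z r x x'. 0 < N \<Longrightarrow> bmo_le \<rho> f N \<Longrightarrow> 0 < r \<Longrightarrow> r < \<rho> z \<Longrightarrow> x \<in> ball z r \<Longrightarrow> x' \<in> ball z r \<Longrightarrow>
      sq_part {4 * r<..} f x \<le> sq_part {4 * r<..} f x' + ennreal (C * N\<^sup>2)"
proof -
  obtain D where D: "0 < D"
    "\<And>f N z x R t. 0 \<le> N \<Longrightarrow> bmo_le \<rho> f N \<Longrightarrow> \<rho> z \<le> R \<Longrightarrow> dist z x \<le> R \<Longrightarrow> R \<le> t \<Longrightarrow>
      norm (kernel_op M (Q t) f x) \<le> D * N * (R / t) powr \<delta>1"
    by (rule tail_pointwise) blast
  obtain C where C: "0 < C"
    "\<And>f N z x x' r t. 0 \<le> N \<Longrightarrow> bmo_le \<rho> f N \<Longrightarrow> x \<in> ball z r \<Longrightarrow> x' \<in> ball z r \<Longrightarrow> 4 * r \<le> t \<Longrightarrow> t \<le> \<rho> z \<Longrightarrow>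
      norm (kernel_op M (Q t) f x) \<le> C * N \<and>
      norm (kernel_op M (Q t) f x - kernel_op M (Q t) f x') \<le> C * N * (r / t) powr (\<beta> / 2)"
    by (rule middle_pointwise) blast
  let ?c = "2 * C\<^sup>2 / (\<beta> / 2)" and ?d = "D\<^sup>2 / (2 * \<delta>1)"
  show thesis
  proof (rule that[of "?c + ?d"])
    show "0 \<le> ?c + ?d" using \<beta> \<delta>1 by simp
    fix f :: "'a \<Rightarrow> complex" and N r :: real and z x x'
    assume N: "0 < N" and f: "bmo_le \<rho> f N" and r: "0 < r" and \<rho>: "r < \<rho> z"
      and x: "x \<in> ball z r" and x': "x' \<in> ball z r"
    have osc: "osc_le f N" using f by (simp add: bmo_le_def)
    have fm [measurable]: "f \<in> borel_measurable M" by (rule osc_le_measurable[OF osc])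
    let ?a = "\<lambda>t. norm (kernel_op M (Q t) f x)" and ?b = "\<lambda>t. norm (kernel_op M (Q t) f x')"
    let ?u = "\<lambda>t. ennreal ((?b t)\<^sup>2 / t) * indicator {4 * r<..} t"
    let ?v = "\<lambda>t. ennreal (2 * (C * N)\<^sup>2 * (r / t) powr (\<beta> / 2) / t) * indicator {r..} t"
    let ?w = "\<lambda>t. ennreal ((D * N)\<^sup>2 * (\<rho> z / t) powr (2 * \<delta>1) / t) * indicator {\<rho> z..} t"
    have [measurable]: "?u \<in> borel_measurable lborel"
      using r by (intro integrand_measurable_t fm) auto
    have "sq_part {4 * r<..} f x \<le> (\<integral>\<^sup>+t. ?u t + (?v t + ?w t) \<partial>lborel)"
      unfolding sq_part_def
    proof (rule nn_integral_mono)
      fix t :: real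
      show "ennreal ((?a t)\<^sup>2 / t) * indicator {4 * r<..} t \<le> ?u t + (?v t + ?w t)"
      proof (cases "4 * r < t")
        case t4: True
        then have t: "0 < t" using r by simp
        show ?thesis
        proof (cases "t \<le> \<rho> z")
          case True
          have ab: "?a t \<le> C * N" "?b t \<le> C * N"
            "norm (kernel_op M (Q t) f x - kernel_op M (Q t) f x') \<le> C * N * (r / t) powr (\<beta> / 2)"
            using C(2)[OF less_imp_le[OF N] f x x' _ True] C(2)[OF less_imp_le[OF N] f x' x _ True] t4 by auto
          have "?a t - ?b t \<le> C * N * (r / t) powr (\<beta> / 2)"
            using ab(3) norm_triangle_ineq2[of "kernel_op M (Q t) f x" "kernel_op M (Q t) f x'"] by linarith
          then have "(?a t - ?b t) * (?a t + ?b t) \<le> (C * N * (r / t) powr (\<beta> / 2)) * (C * N + C * N)"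
            using ab C(1) N by (intro mult_mono add_mono) auto
          then have "(?a t)\<^sup>2 \<le> (?b t)\<^sup>2 + 2 * (C * N)\<^sup>2 * (r / t) powr (\<beta> / 2)"
            by (simp add: power2_eq_square algebra_simps)
          then have "(?a t)\<^sup>2 / t \<le> (?b t)\<^sup>2 / t + 2 * (C * N)\<^sup>2 * (r / t) powr (\<beta> / 2) / t"
            using t by (simp add: add_divide_distrib[symmetric] divide_right_mono)
          then have "ennreal ((?a t)\<^sup>2 / t) \<le> ennreal ((?b t)\<^sup>2 / t + 2 * (C * N)\<^sup>2 * (r / t) powr (\<beta> / 2) / t)"
            by (rule ennreal_leI)
          also have "\<dots> = ennreal ((?b t)\<^sup>2 / t) + ennreal (2 * (C * N)\<^sup>2 * (r / t) powr (\<beta> / 2) / t)"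
            using t by (intro ennreal_plus) auto
          also have "\<dots> = ?u t + ?v t" using t4 r by simp
          also have "\<dots> \<le> ?u t + (?v t + ?w t)" by (intro add_left_mono) simp
          finally show ?thesis using t4 by simp
        next
          case False
          have "?a t \<le> D * N * (\<rho> z / t) powr \<delta>1"
            using False x \<rho> N by (intro D(2)[OF _ f, of z]) auto
          then have "(?a t)\<^sup>2 \<le> (D * N * (\<rho> z / t) powr \<delta>1)\<^sup>2" by (intro power_mono) auto
          also have "\<dots> = (D * N)\<^sup>2 * (\<rho> z / t) powr (2 * \<delta>1)"
            by (simp only: power_mult_distrib powr_power2)
          finally have "ennreal ((?a t)\<^sup>2 / t) * indicator {4 * r<..} t \<le> ?w t"
            using False t4 t by (auto intro!: ennreal_leI divide_right_mono)
          also have "\<dots> \<le> ?u t + (?v t + ?w t)" by (simp add: add_increasing)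
          finally show ?thesis .
        qed
      qed simp
    qed
    also have "\<dots> = sq_part {4 * r<..} f x' + (integral\<^sup>N lborel ?v + integral\<^sup>N lborel ?w)"
    proof -
      have "(\<integral>\<^sup>+t. ?u t + (?v t + ?w t) \<partial>lborel) = integral\<^sup>N lborel ?u + (\<integral>\<^sup>+t. ?v t + ?w t \<partial>lborel)"
        by (rule nn_integral_add) measurable
      also have "(\<integral>\<^sup>+t. ?v t + ?w t \<partial>lborel) = integral\<^sup>N lborel ?v + integral\<^sup>N lborel ?w"
        by (rule nn_integral_add) measurable
      finally show ?thesis by (simp only: sq_part_def)
    qed
    also have "integral\<^sup>N lborel ?v = ennreal (2 * (C * N)\<^sup>2 / (\<beta> / 2))"
      using \<beta> r by (intro nn_integral_powr_ratio_from_cmult) auto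
    also have "integral\<^sup>N lborel ?w = ennreal ((D * N)\<^sup>2 / (2 * \<delta>1))"
      using \<delta>1 \<rho>_pos[of z] by (intro nn_integral_powr_ratio_from_cmult) auto
    also have "ennreal (2 * (C * N)\<^sup>2 / (\<beta> / 2)) + ennreal ((D * N)\<^sup>2 / (2 * \<delta>1))
        = ennreal (2 * (C * N)\<^sup>2 / (\<beta> / 2) + (D * N)\<^sup>2 / (2 * \<delta>1))"
      using \<beta> \<delta>1 by (intro ennreal_plus[symmetric]) auto
    also have "2 * (C * N)\<^sup>2 / (\<beta> / 2) + (D * N)\<^sup>2 / (2 * \<delta>1) = (?c + ?d) * N\<^sup>2"
      by (simp add: power_mult_distrib distrib_right)
    finally show "sq_part {4 * r<..} f x \<le> sq_part {4 * r<..} f x' + ennreal ((?c + ?d) * N\<^sup>2)" .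
  qed
qed

section \<open>From BMO to BLO\<close>

text \<open>
  The space is a countable union of balls \<open>ball z r\<close> with \<open>\<rho> z \<le> r\<close>, on each of which the integral is finite.
\<close>

lemma square_function_AE_finite:
  assumes N: "0 < N" and f: "bmo_le \<rho> f N"
  shows "AE x in M. sq_part {0<..} f x < \<infinity>"
proof -
  obtain C where C: "0 \<le> C"
    "\<And>f N z r. 0 < N \<Longrightarrow> bmo_le \<rho> f N \<Longrightarrow> 0 < r \<Longrightarrow> \<rho> z \<le> r \<Longrightarrow>
      (\<integral>\<^sup>+x\<in>ball z r. sq_part {0<..} f x \<partial>M) \<le> ennreal (C * N\<^sup>2 * V z r)"
    by (rule large_ball_estimate) blast
  have fm: "f \<in> borel_measurable M" using f by (auto simp: bmo_le_def intro: osc_le_measurable)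
  have [measurable]: "sq_part {0<..} f \<in> borel_measurable M" by (intro sq_part_measurable fm) auto
  fix z :: 'a
  have "AE x in M. x \<in> ball z (\<rho> z + real n) \<longrightarrow> sq_part {0<..} f x < \<infinity>" for n :: nat
  proof -
    have "0 < \<rho> z + real n" using \<rho>_pos[of z] by (intro add_pos_nonneg) auto
    then have "(\<integral>\<^sup>+x\<in>ball z (\<rho> z + real n). sq_part {0<..} f x \<partial>M) \<le> ennreal (C * N\<^sup>2 * V z (\<rho> z + real n))"
      by (intro C(2) N f) auto
    then have "(\<integral>\<^sup>+x\<in>ball z (\<rho> z + real n). sq_part {0<..} f x \<partial>M) \<noteq> \<infinity>"
      by (auto simp: top_unique)
    then have "AE x in M. sq_part {0<..} f x * indicator (ball z (\<rho> z + real n)) x \<noteq> \<infinity>"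
      by (intro nn_integral_PInf_AE) auto
    then show ?thesis by eventually_elim (auto simp: indicator_def less_top)
  qed
  then have "AE x in M. \<forall>n::nat. x \<in> ball z (\<rho> z + real n) \<longrightarrow> sq_part {0<..} f x < \<infinity>"
    by (subst AE_all_countable) blast
  then show ?thesis
  proof eventually_elim
    case (elim x)
    obtain n :: nat where "dist z x < real n" using reals_Archimedean2 by blast
    then have "x \<in> ball z (\<rho> z + real n)" using \<rho>_pos[of z] by simp
    then show ?case using elim by blast
  qed
qed

text \<open>
  On a ball with \<open>r < \<rho> z\<close>, the contribution \<open>g\<close> of the scales \<open>t > 4r\<close> at a point, less \<open>Cf N\<^sup>2\<close>, is a lower bound of
  the whole square at almost every other point, hence of the essential infimum. What remains above it is the contribution of the scales
  \<open>t \<le> 4r\<close>, up to \<open>Cf N\<^sup>2\<close>.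
\<close>

lemma square_function_BLO_norm:
  obtains C where "0 < C"
    "\<And>f N. 0 < N \<Longrightarrow> bmo_le \<rho> f N \<Longrightarrow>
      (\<lambda>x. enn2real (sq_part {0<..} f x)) \<in> L1_loc M \<and>
      BLO_norm M \<rho> (\<lambda>x. enn2real (sq_part {0<..} f x)) \<le> ennreal (C * N\<^sup>2)"
proof -
  obtain Cl where Cl: "0 \<le> Cl"
    "\<And>f N z r. 0 < N \<Longrightarrow> bmo_le \<rho> f N \<Longrightarrow> 0 < r \<Longrightarrow> \<rho> z \<le> r \<Longrightarrow>
      (\<integral>\<^sup>+x\<in>ball z r. sq_part {0<..} f x \<partial>M) \<le> ennreal (Cl * N\<^sup>2 * V z r)"
    by (rule large_ball_estimate) blast
  obtain Cn where Cn: "0 \<le> Cn"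
    "\<And>f N z r. 0 < N \<Longrightarrow> bmo_le \<rho> f N \<Longrightarrow> 0 < r \<Longrightarrow> r < \<rho> z \<Longrightarrow>
      (\<integral>\<^sup>+x\<in>ball z r. sq_part {0<..4 * r} f x \<partial>M) \<le> ennreal (Cn * N\<^sup>2 * V z r)"
    by (rule small_ball_near_estimate) blast
  obtain Cf where Cf: "0 \<le> Cf"
    "\<And>f N z r x x'. 0 < N \<Longrightarrow> bmo_le \<rho> f N \<Longrightarrow> 0 < r \<Longrightarrow> r < \<rho> z \<Longrightarrow> x \<in> ball z r \<Longrightarrow> x' \<in> ball z r \<Longrightarrow>
      sq_part {4 * r<..} f x \<le> sq_part {4 * r<..} f x' + ennreal (Cf * N\<^sup>2)"
    by (rule small_ball_far_comparison) blast
  show thesis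
  proof (rule that[of "Cn + Cf + Cl + 1"])
    show "0 < Cn + Cf + Cl + 1" using Cn(1) Cf(1) Cl(1) by simp
    fix f :: "'a \<Rightarrow> complex" and N :: real
    assume N: "0 < N" and f: "bmo_le \<rho> f N"
    have fm: "f \<in> borel_measurable M" using f by (auto simp: bmo_le_def intro: osc_le_measurable)
    define G where "G x = sq_part {0<..} f x" for x
    define F where "F x = enn2real (G x)" for x
    have G [measurable]: "G \<in> borel_measurable M"
      unfolding G_def[abs_def] by (intro sq_part_measurable fm) auto
    have F [measurable]: "F \<in> borel_measurable M" unfolding F_def by measurable
    have fin: "AE x in M. G x < \<infinity>" unfolding G_def by (rule square_function_AE_finite[OF N f])
    have F_le: "ennreal \<bar>F x\<bar> \<le> G x" for x by (cases "G x") (auto simp: F_def)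
    have large: "(\<integral>\<^sup>+x\<in>ball z r. ennreal \<bar>F x\<bar> \<partial>M) \<le> ennreal (Cl * N\<^sup>2 * V z r)"
      if r: "0 < r" "\<rho> z \<le> r" for z r
    proof -
      have "(\<integral>\<^sup>+x\<in>ball z r. ennreal \<bar>F x\<bar> \<partial>M) \<le> (\<integral>\<^sup>+x\<in>ball z r. G x \<partial>M)"
        by (intro nn_integral_mono mult_right_mono F_le) auto
      also have "\<dots> \<le> ennreal (Cl * N\<^sup>2 * V z r)" unfolding G_def by (rule Cl(2)[OF N f r])
      finally show ?thesis .
    qed
    have small: "(\<integral>\<^sup>+y\<in>ball z r. e2ennreal (ereal (F y) - ess_inf M (ball z r) F) \<partial>M)
        \<le> ennreal ((Cn + Cf) * N\<^sup>2 * V z r)"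
      if r: "0 < r" "r < \<rho> z" for z r
    proof -
      have split: "G x = sq_part {0<..4 * r} f x + sq_part {4 * r<..} f x" for x
        unfolding G_def using r by (intro sq_part_split fm) auto
      have "(\<integral>\<^sup>+y\<in>ball z r. e2ennreal (ereal (F y) - ess_inf M (ball z r) F) \<partial>M)
        \<le> (\<integral>\<^sup>+y. sq_part {0<..4 * r} f y * indicator (ball z r) y + ennreal (Cf * N\<^sup>2) * indicator (ball z r) y \<partial>M)"
      proof (rule nn_integral_mono_AE)
        show "AE y in M. e2ennreal (ereal (F y) - ess_inf M (ball z r) F) * indicator (ball z r) y
          \<le> sq_part {0<..4 * r} f y * indicator (ball z r) y + ennreal (Cf * N\<^sup>2) * indicator (ball z r) y"
          using fin
        proof eventually_elim
          case (elim y)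
          show ?case
          proof (cases "y \<in> ball z r")
            case y: True
            obtain l where l: "sq_part {0<..4 * r} f y = ennreal l" "0 \<le> l"
              using elim split[of y] by (cases "sq_part {0<..4 * r} f y") auto
            obtain g where g: "sq_part {4 * r<..} f y = ennreal g" "0 \<le> g"
              using elim split[of y] by (cases "sq_part {4 * r<..} f y") auto
            have Fy: "F y = l + g"
              using l g by (simp add: F_def split ennreal_plus[symmetric] del: ennreal_plus)
            have "AE y' in M. y' \<in> ball z r \<longrightarrow> ereal (g - Cf * N\<^sup>2) \<le> ereal (F y')"
              using fin
            proof eventually_elim
              case (elim y')
              show ?case
              proof
                assume y': "y' \<in> ball z r"
                have "ennreal g \<le> sq_part {4 * r<..} f y' + ennreal (Cf * N\<^sup>2)"
                  using Cf(2)[OF N f r y y'] g by simp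
                also have "\<dots> \<le> G y' + ennreal (Cf * N\<^sup>2)"
                  unfolding split[of y'] by (intro add_right_mono) simp
                also have "G y' = ennreal (F y')" using elim by (simp add: F_def)
                also have "ennreal (F y') + ennreal (Cf * N\<^sup>2) = ennreal (F y' + Cf * N\<^sup>2)"
                  using Cf(1) by (intro ennreal_plus[symmetric]) (auto simp: F_def)
                finally have "ennreal g \<le> ennreal (F y' + Cf * N\<^sup>2)" .
                moreover have "0 \<le> F y' + Cf * N\<^sup>2" using Cf(1) by (simp add: F_def)
                ultimately have "g \<le> F y' + Cf * N\<^sup>2" by (simp only: ennreal_le_iff)
                then show "ereal (g - Cf * N\<^sup>2) \<le> ereal (F y')" by simp
              qed
            qed
            then have "ereal (g - Cf * N\<^sup>2) \<le> ess_inf M (ball z r) F"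
              unfolding ess_inf_def by (intro Sup_upper) simp
            then have "ereal (F y) - ess_inf M (ball z r) F \<le> ereal (F y) - ereal (g - Cf * N\<^sup>2)"
              by (intro ereal_minus_mono) auto
            then have "e2ennreal (ereal (F y) - ess_inf M (ball z r) F) \<le> e2ennreal (ereal (l + Cf * N\<^sup>2))"
              by (intro e2ennreal_mono) (simp add: Fy algebra_simps)
            also have "\<dots> = ennreal l + ennreal (Cf * N\<^sup>2)"
              using l Cf(1) by (simp add: ennreal_plus)
            finally show ?thesis using y l by simp
          qed simp
        qed
      qed
      also have "\<dots> = (\<integral>\<^sup>+y\<in>ball z r. sq_part {0<..4 * r} f y \<partial>M) + ennreal (Cf * N\<^sup>2) * ennreal (V z r)"
      proof -
        have [measurable]: "sq_part {0<..4 * r} f \<in> borel_measurable M" by (intro sq_part_measurable fm) auto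
        show ?thesis
          by (subst nn_integral_add) (auto simp: nn_integral_cmult_indicator emeasure_ball)
      qed
      also have "\<dots> \<le> ennreal (Cn * N\<^sup>2 * V z r) + ennreal (Cf * N\<^sup>2) * ennreal (V z r)"
        by (intro add_right_mono Cn(2)[OF N f r])
      also have "\<dots> = ennreal (Cn * N\<^sup>2 * V z r) + ennreal (Cf * N\<^sup>2 * V z r)"
        using Cf(1) by (subst ennreal_mult[symmetric]) auto
      also have "\<dots> = ennreal (Cn * N\<^sup>2 * V z r + Cf * N\<^sup>2 * V z r)"
        using Cf(1) Cn(1) by (intro ennreal_plus[symmetric]) auto
      finally show ?thesis by (simp only: distrib_right)
    qed
    have L1: "F \<in> L1_loc M"
      unfolding L1_loc_def
    proof (intro CollectI allI impI)
      fix x :: 'a and r :: real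
      assume "0 < r"
      have "(\<integral>\<^sup>+y. ennreal (norm (indicator (ball x r) y *\<^sub>R F y)) \<partial>M)
        \<le> (\<integral>\<^sup>+y\<in>ball x (max r (\<rho> x)). ennreal \<bar>F y\<bar> \<partial>M)"
        by (intro nn_integral_mono) (auto simp: indicator_def)
      also have "\<dots> \<le> ennreal (Cl * N\<^sup>2 * V x (max r (\<rho> x)))" using \<open>0 < r\<close> by (intro large) auto
      also have "\<dots> < \<infinity>" by simp
      finally show "set_integrable M (ball x r) F"
        unfolding set_integrable_def by (intro integrableI_bounded) auto
    qed
    have "BLO_norm M \<rho> F \<le> ennreal ((Cn + Cf) * N\<^sup>2) + ennreal (Cl * N\<^sup>2)"
      unfolding BLO_norm_def
      using small large Cn(1) Cf(1) Cl(1)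
      by (intro add_mono SUP_least) (auto simp: balls_not_D_def balls_D_def average_le_iff)
    also have "\<dots> = ennreal ((Cn + Cf + Cl) * N\<^sup>2)"
      using Cn(1) Cf(1) Cl(1) by (subst ennreal_plus[symmetric]) (auto simp: distrib_right)
    also have "\<dots> \<le> ennreal ((Cn + Cf + Cl + 1) * N\<^sup>2)"
      by (intro ennreal_leI mult_right_mono) auto
    finally show "(\<lambda>x. enn2real (sq_part {0<..} f x)) \<in> L1_loc M \<and>
      BLO_norm M \<rho> (\<lambda>x. enn2real (sq_part {0<..} f x)) \<le> ennreal ((Cn + Cf + Cl + 1) * N\<^sup>2)"
      using L1 by (simp add: F_def[abs_def] G_def[abs_def])
  qed
qed

lemma square_function_BMO_to_BLO:
  "\<exists>C>0. \<forall>f\<in>BMO M \<rho>.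
     (AE x in M. (g_function M Q f x)\<^sup>2 < \<infinity>) \<and>
     (\<lambda>x. enn2real ((g_function M Q f x)\<^sup>2)) \<in> BLO M \<rho> \<and>
     BLO_norm M \<rho> (\<lambda>x. enn2real ((g_function M Q f x)\<^sup>2)) \<le> ennreal C * (BMO_norm M \<rho> f)\<^sup>2"
proof -
  obtain C where C: "0 < C"
    "\<And>f N. 0 < N \<Longrightarrow> bmo_le \<rho> f N \<Longrightarrow>
      (\<lambda>x. enn2real (sq_part {0<..} f x)) \<in> L1_loc M \<and>
      BLO_norm M \<rho> (\<lambda>x. enn2real (sq_part {0<..} f x)) \<le> ennreal (C * N\<^sup>2)"
    by (rule square_function_BLO_norm) blast
  show ?thesis
  proof (intro exI[of _ "4 * C"] conjI ballI)
    show "0 < 4 * C" using C(1) by simp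
    fix f assume f: "f \<in> BMO M \<rho>"
    then have fL: "f \<in> L1_loc M" and fin: "BMO_norm M \<rho> f < \<infinity>" by (auto simp: BMO_def)
    obtain n where n: "BMO_norm M \<rho> f = ennreal n" "0 \<le> n" using fin by (cases "BMO_norm M \<rho> f") auto
    \<comment> \<open>The norm may be \<open>0\<close>, so the estimate is used for all \<open>N > n\<close> and passes to the limit.\<close>
    have bmo: "bmo_le \<rho> f (2 * N)" if "n < N" for N
      using n that by (intro BMO_norm_imp_bmo_le[OF fL]) (auto simp: ennreal_leI)
    let ?F = "\<lambda>x. enn2real (sq_part {0<..} f x)"
    have *: "?F \<in> L1_loc M \<and> BLO_norm M \<rho> ?F \<le> ennreal (4 * C * N\<^sup>2)" if "n < N" for N
      using C(2)[OF _ bmo[OF that]] n(2) that by (simp add: power_mult_distrib mult_ac)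
    show "AE x in M. (g_function M Q f x)\<^sup>2 < \<infinity>"
      using square_function_AE_finite[OF _ bmo[of "n + 1"]] n(2) by (simp add: g_function_power2)
    have "BLO_norm M \<rho> ?F < \<infinity>" using *[of "n + 1"] by (auto intro: le_less_trans)
    then obtain b where b: "BLO_norm M \<rho> ?F = ennreal b" "0 \<le> b" by (cases "BLO_norm M \<rho> ?F") auto
    have "b \<le> 4 * C * (n + inverse (real (Suc k)))\<^sup>2" for k
      using *[of "n + inverse (real (Suc k))"] C(1) by (simp add: b ennreal_le_iff)
    moreover have "(\<lambda>k. 4 * C * (n + inverse (real (Suc k)))\<^sup>2) \<longlonglongrightarrow> 4 * C * (n + 0)\<^sup>2"
      by (intro tendsto_intros LIMSEQ_inverse_real_of_nat)
    ultimately have "b \<le> 4 * C * (n + 0)\<^sup>2" by (intro LIMSEQ_le_const) auto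
    then have "BLO_norm M \<rho> ?F \<le> ennreal (4 * C) * (BMO_norm M \<rho> f)\<^sup>2"
      using C(1) n by (simp add: b ennreal_power ennreal_mult[symmetric] ennreal_leI)
    then show "BLO_norm M \<rho> (\<lambda>x. enn2real ((g_function M Q f x)\<^sup>2)) \<le> ennreal (4 * C) * (BMO_norm M \<rho> f)\<^sup>2"
      by (simp add: g_function_power2)
    show "(\<lambda>x. enn2real ((g_function M Q f x)\<^sup>2)) \<in> BLO M \<rho>"
      using *[of "n + 1"] \<open>BLO_norm M \<rho> ?F < \<infinity>\<close> by (simp add: BLO_def g_function_power2)
  qed
qed

end

theorem theorem6p1:
  fixes M :: "'a::metric_space measure"
    and \<rho> :: "'a \<Rightarrow> real"
    and Q :: "real \<Rightarrow> 'a \<Rightarrow> 'a \<Rightarrow> complex"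
    and C\<^sub>1 \<delta>\<^sub>1 \<beta> \<delta>\<^sub>2 \<gamma> :: real
  assumes "rd_space M"
    and "admissible \<rho>"
    and "jointly_measurable_kernel M Q"
    and "\<And>t. 0 < t \<Longrightarrow> L2_bounded M (kernel_op M (Q t))"
    and "0 < C\<^sub>1" and "0 < \<delta>\<^sub>1" and "0 < \<beta>" "\<beta> \<le> 1" and "0 < \<delta>\<^sub>2" "\<delta>\<^sub>2 < 1" and "0 < \<gamma>"
    and Qi: "\<And>t x y. 0 < t \<Longrightarrow>
      norm (Q t x y) \<le> C\<^sub>1 * (1 / (vol M t x + vol2 M x y)) * (t / (t + dist x y)) powr \<gamma>
                         * (\<rho> x / (t + \<rho> x)) powr \<delta>\<^sub>1"
    and Qii: "\<And>t x x' y. 0 < t \<Longrightarrow> dist x x' \<le> t / 2 \<Longrightarrow>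
      norm (Q t x y - Q t x' y) \<le> C\<^sub>1 * (dist x x' / (t + dist x y)) powr \<beta>
                         * (1 / (vol M t x + vol2 M x y)) * (t / (t + dist x y)) powr \<gamma>"
    and Qiii: "\<And>t x. 0 < t \<Longrightarrow>
      norm (LINT y|M. Q t x y) \<le> C\<^sub>1 * (t / (t + \<rho> x)) powr \<delta>\<^sub>2"
    and "L2_bounded_nonneg M (g_function M Q)"
  shows "\<exists>C>0. \<forall>f\<in>BMO M \<rho>.
           (AE x in M. (g_function M Q f x)\<^sup>2 < \<infinity>) \<and>
           (\<lambda>x. enn2real ((g_function M Q f x)\<^sup>2)) \<in> BLO M \<rho> \<and>
           BLO_norm M \<rho> (\<lambda>x. enn2real ((g_function M Q f x)\<^sup>2)) \<le> ennreal C * (BMO_norm M \<rho> f)\<^sup>2"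
proof -
  have reg: "regular_borel_measure M"
    and balls: "\<And>x r. 0 < r \<Longrightarrow> 0 < emeasure M (ball x r) \<and> emeasure M (ball x r) < \<infinity>"
    and "doubling_measure M"
    using assms(1) by (auto simp: rd_space_def)
  then obtain A where A: "1 \<le> A"
    "\<And>x r. 0 < r \<Longrightarrow> measure M (ball x (2 * r)) \<le> A * measure M (ball x r)"
    unfolding doubling_measure_def by blast
  interpret doubling_space M A
  proof
    show "emeasure M (ball x r) < \<infinity>" for x r
      using balls[of r x] by (cases "0 < r") (auto simp: ball_empty not_less)
  qed (use reg balls A in \<open>auto simp: regular_borel_measure_def\<close>)
  interpret localized_square_function M A \<rho> Q C\<^sub>1 \<delta>\<^sub>1 \<beta> \<delta>\<^sub>2 \<gamma>
    using assms by unfold_locales (simp_all add: decay_kernel_def vol_def vol2_def mult.assoc)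
  show ?thesis by (rule square_function_BMO_to_BLO)
qed

end
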